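(* Let $M$ be a smooth manifold equipped with a $C^2$ Riemannian metric $g$, let $\mathsf d$ be the associated Riemannian distance and $\mu$ the associated Riemannian volume measure, and assume that $(M,\mathsf d,\mu)$ is a metric measure space. Let $u\in L^1_{\mathrm{loc}}(M,\mu)$. Then for $\mu$-a.e. $x\in M$, $$\lim_{r\downarrow0}\left|\Delta^{\mathsf d}_{\mu,r}u(x)-\tilde\Delta^{\mathsf d}_{\mu,r}u(x)\right|=0.$$ In particular, for $\mu$-a.e. $x\in M$, $\Delta^{\mathsf d}_{\mu,r}u(x)$ converges as $r\downarrow0$ if and only if $\tilde\Delta^{\mathsf d}_{\mu,r}u(x)$ does, in which case the two limits coincide: $\Delta^{\mathsf d}_{\mu}u(x)=\tilde\Delta^{\mathsf d}_{\mu}u(x)$.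
   Context: A metric measure space $(X,\mathsf d,\mu)$ is a metric space $(X,\mathsf d)$ with a fully supported Borel measure $\mu$ such that $0<\mu(B_r(x))<+\infty$ for all $x\in X$, $r>0$, where $B_r(x)=\{y:\mathsf d(x,y)<r\}$. $\fint_A f\,d\mu:=\frac1{\mu(A)}\int_A f\,d\mu$. Manifolds are connected and without boundary. For $u\in L^1_{\mathrm{loc}}(X,\mu)$, a point $x$ is a Lebesgue point of $u$ (written $x\in\mathrm{Leb}(u)$) if there is a real number $u^*(x)$ with $\lim_{r\downarrow0}\fint_{B_r(x)}|u(y)-u^*(x)|\,d\mu(y)=0$. For $x\in \mathrm{Leb}(u)$ and $r>0$, $$\Delta^{\mathsf d}_{\mu,r}u(x):=\frac1{r^2}\fint_{B_r(x)}(u(y)-u^*(x))\,d\mu(y),$$ $$\tilde\Delta^{\mathsf d}_{\mu,r}u(x):=\frac1{2r^2}\fint_{B_r(x)}(u(y)-u^*(x))\left(1+\frac{\mu(B_r(x))}{\mu(B_r(y))}\right)d\mu(y).$$ When the (finite) limits as $r\downarrow0$ exist they are denoted $\Delta^{\mathsf d}_{\mu}u(x)$ (pointwise AMV Laplacian) and $\tilde\Delta^{\mathsf d}_{\mu}u(x)$ (pointwise SAMV Laplacian). Part of the assertion is that $\mu$-a.e. $x$ is a Lebesgue point of $u$. *)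

theory Defs
  imports "HOL-Analysis.Analysis"
begin

section \<open>Metric measure spaces and (symmetrised) AMV Laplacians\<close>

definition borel_sets_of :: "'a topology \<Rightarrow> 'a set set" where
  "borel_sets_of X = sigma_sets (topspace X) {U. openin X U}"

definition metric_measure_space :: "'a set \<Rightarrow> ('a \<Rightarrow> 'a \<Rightarrow> real) \<Rightarrow> 'a measure \<Rightarrow> bool" where
  "metric_measure_space M d \<mu> \<longleftrightarrow>
     Metric_space M d \<and>
     space \<mu> = M \<and> sets \<mu> = borel_sets_of (Metric_space.mtopology M d) \<and>
     (\<forall>U. openin (Metric_space.mtopology M d) U \<and> U \<noteq> {} \<longrightarrow> 0 < emeasure \<mu> U) \<and>
     (\<forall>x\<in>M. \<forall>r>0. 0 < emeasure \<mu> (Metric_space.mball M d x r) \<and>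
                  emeasure \<mu> (Metric_space.mball M d x r) < \<infinity>)"

definition L1_loc :: "'a set \<Rightarrow> ('a \<Rightarrow> 'a \<Rightarrow> real) \<Rightarrow> 'a measure \<Rightarrow> ('a \<Rightarrow> real) \<Rightarrow> bool" where
  "L1_loc M d \<mu> u \<longleftrightarrow>
     u \<in> borel_measurable \<mu> \<and>
     (\<forall>x\<in>M. \<exists>r>0. set_integrable \<mu> (Metric_space.mball M d x r) u)"

definition avg :: "'a measure \<Rightarrow> 'a set \<Rightarrow> ('a \<Rightarrow> real) \<Rightarrow> real" where
  "avg \<mu> A f = 1 / measure \<mu> A * set_lebesgue_integral \<mu> A f"

text \<open>The Bochner integral of a non-integrable function is \<open>0\<close>; the limits below are only
  meaningful for locally integrable \<open>u\<close>, for which all integrands involved are integrable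
  once the radius is small (depending on the centre).\<close>

definition has_lebesgue_value ::
  "'a set \<Rightarrow> ('a \<Rightarrow> 'a \<Rightarrow> real) \<Rightarrow> 'a measure \<Rightarrow> ('a \<Rightarrow> real) \<Rightarrow> 'a \<Rightarrow> real \<Rightarrow> bool" where
  "has_lebesgue_value M d \<mu> u x a \<longleftrightarrow>
     ((\<lambda>r. avg \<mu> (Metric_space.mball M d x r) (\<lambda>y. \<bar>u y - a\<bar>)) \<longlongrightarrow> 0) (at_right 0)"

definition Leb :: "'a set \<Rightarrow> ('a \<Rightarrow> 'a \<Rightarrow> real) \<Rightarrow> 'a measure \<Rightarrow> ('a \<Rightarrow> real) \<Rightarrow> 'a set" where
  "Leb M d \<mu> u = {x \<in> M. \<exists>a. has_lebesgue_value M d \<mu> u x a}"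

definition leb_value ::
  "'a set \<Rightarrow> ('a \<Rightarrow> 'a \<Rightarrow> real) \<Rightarrow> 'a measure \<Rightarrow> ('a \<Rightarrow> real) \<Rightarrow> 'a \<Rightarrow> real" where
  "leb_value M d \<mu> u x = (THE a. has_lebesgue_value M d \<mu> u x a)"

definition AMV_approx ::
  "'a set \<Rightarrow> ('a \<Rightarrow> 'a \<Rightarrow> real) \<Rightarrow> 'a measure \<Rightarrow> real \<Rightarrow> ('a \<Rightarrow> real) \<Rightarrow> 'a \<Rightarrow> real" where
  "AMV_approx M d \<mu> r u x =
     1 / r\<^sup>2 * avg \<mu> (Metric_space.mball M d x r) (\<lambda>y. u y - leb_value M d \<mu> u x)"

definition SAMV_approx ::
  "'a set \<Rightarrow> ('a \<Rightarrow> 'a \<Rightarrow> real) \<Rightarrow> 'a measure \<Rightarrow> real \<Rightarrow> ('a \<Rightarrow> real) \<Rightarrow> 'a \<Rightarrow> real" where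
  "SAMV_approx M d \<mu> r u x =
     1 / (2 * r\<^sup>2) * avg \<mu> (Metric_space.mball M d x r)
       (\<lambda>y. (u y - leb_value M d \<mu> u x) *
             (1 + measure \<mu> (Metric_space.mball M d x r) / measure \<mu> (Metric_space.mball M d y r)))"

definition AMV_converges ::
  "'a set \<Rightarrow> ('a \<Rightarrow> 'a \<Rightarrow> real) \<Rightarrow> 'a measure \<Rightarrow> ('a \<Rightarrow> real) \<Rightarrow> 'a \<Rightarrow> bool" where
  "AMV_converges M d \<mu> u x \<longleftrightarrow> (\<exists>l. ((\<lambda>r. AMV_approx M d \<mu> r u x) \<longlongrightarrow> l) (at_right 0))"

definition SAMV_converges ::
  "'a set \<Rightarrow> ('a \<Rightarrow> 'a \<Rightarrow> real) \<Rightarrow> 'a measure \<Rightarrow> ('a \<Rightarrow> real) \<Rightarrow> 'a \<Rightarrow> bool" where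
  "SAMV_converges M d \<mu> u x \<longleftrightarrow> (\<exists>l. ((\<lambda>r. SAMV_approx M d \<mu> r u x) \<longlongrightarrow> l) (at_right 0))"

definition AMV_Laplacian ::
  "'a set \<Rightarrow> ('a \<Rightarrow> 'a \<Rightarrow> real) \<Rightarrow> 'a measure \<Rightarrow> ('a \<Rightarrow> real) \<Rightarrow> 'a \<Rightarrow> real" where
  "AMV_Laplacian M d \<mu> u x = Lim (at_right 0) (\<lambda>r. AMV_approx M d \<mu> r u x)"

definition SAMV_Laplacian ::
  "'a set \<Rightarrow> ('a \<Rightarrow> 'a \<Rightarrow> real) \<Rightarrow> 'a measure \<Rightarrow> ('a \<Rightarrow> real) \<Rightarrow> 'a \<Rightarrow> real" where
  "SAMV_Laplacian M d \<mu> u x = Lim (at_right 0) (\<lambda>r. SAMV_approx M d \<mu> r u x)"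


section \<open>Smooth manifolds and Riemannian metrics\<close>

text \<open>\<open>C\<^sup>k\<close> regularity on an open set, through iterated directional derivatives; for a
  finite-dimensional domain this is the usual notion.\<close>

fun Ck_on :: "nat \<Rightarrow> ('a::euclidean_space \<Rightarrow> 'b::real_normed_vector) \<Rightarrow> 'a set \<Rightarrow> bool" where
  "Ck_on 0 f S \<longleftrightarrow> continuous_on S f"
| "Ck_on (Suc k) f S \<longleftrightarrow>
     (\<forall>x\<in>S. f differentiable (at x)) \<and>
     (\<forall>v. Ck_on k (\<lambda>x. frechet_derivative f (at x) v) S)"

definition smooth_on :: "('a::euclidean_space \<Rightarrow> 'b::real_normed_vector) \<Rightarrow> 'a set \<Rightarrow> bool" where
  "smooth_on f S \<longleftrightarrow> (\<forall>k. Ck_on k f S)"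

text \<open>A chart is a pair of its domain and its coordinate map; the values of the coordinate map
  outside the domain carry no information.\<close>

type_synonym ('a, 'n) chart = "'a set \<times> ('a \<Rightarrow> real ^ 'n)"

definition is_chart :: "'a topology \<Rightarrow> ('a, 'n::finite) chart \<Rightarrow> bool" where
  "is_chart X c \<longleftrightarrow> (case c of (U, \<phi>) \<Rightarrow>
     openin X U \<and> open (\<phi> ` U) \<and>
     homeomorphic_map (subtopology X U) (top_of_set (\<phi> ` U)) \<phi>)"

definition transition :: "('a, 'n::finite) chart \<Rightarrow> ('a, 'n) chart \<Rightarrow> real ^ 'n \<Rightarrow> real ^ 'n" where
  "transition c c' = snd c' \<circ> inv_into (fst c) (snd c)"

text \<open>The atlas need not be maximal.\<close>

definition smooth_manifold :: "'a topology \<Rightarrow> ('a, 'n::finite) chart set \<Rightarrow> bool" where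
  "smooth_manifold X \<A> \<longleftrightarrow>
     Hausdorff_space X \<and> second_countable X \<and> connected_space X \<and>
     (\<forall>c\<in>\<A>. is_chart X c) \<and>
     topspace X = (\<Union>c\<in>\<A>. fst c) \<and>
     (\<forall>c\<in>\<A>. \<forall>c'\<in>\<A>. smooth_on (transition c c') (snd c ` (fst c \<inter> fst c')))"

text \<open>A metric tensor is given by its coefficient matrices \<open>g c x\<close> in every chart \<open>c\<close> of the
  atlas, as functions of the coordinates \<open>x\<close>; on overlaps they are related by the
  transformation law of a covariant 2-tensor.\<close>

type_synonym ('a, 'n) metric_tensor = "('a, 'n) chart \<Rightarrow> real ^ 'n \<Rightarrow> real ^ 'n ^ 'n"

definition C2_Riemannian_metric ::
  "('a, 'n::finite) chart set \<Rightarrow> ('a, 'n) metric_tensor \<Rightarrow> bool" where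
  "C2_Riemannian_metric \<A> g \<longleftrightarrow>
     (\<forall>c\<in>\<A>. Ck_on 2 (g c) (snd c ` fst c)) \<and>
     (\<forall>c\<in>\<A>. \<forall>x \<in> snd c ` fst c.
        transpose (g c x) = g c x \<and> (\<forall>v. v \<noteq> 0 \<longrightarrow> v \<bullet> (g c x *v v) > 0)) \<and>
     (\<forall>c\<in>\<A>. \<forall>c'\<in>\<A>. \<forall>p \<in> fst c \<inter> fst c'.
        let J = frechet_derivative (transition c c') (at (snd c p))
        in \<forall>v w. v \<bullet> (g c (snd c p) *v w) = J v \<bullet> (g c' (snd c' p) *v J w))"


section \<open>Riemannian distance and volume\<close>

definition C1_curve_on ::
  "('a, 'n::finite) chart set \<Rightarrow> real set \<Rightarrow> (real \<Rightarrow> 'a) \<Rightarrow> bool" where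
  "C1_curve_on \<A> I \<gamma> \<longleftrightarrow>
     (\<forall>(U, \<phi>)\<in>\<A>. \<exists>D. continuous_on {t \<in> I. \<gamma> t \<in> U} D \<and>
        (\<forall>t\<in>I. \<gamma> t \<in> U \<longrightarrow> (\<phi> \<circ> \<gamma> has_vector_derivative D t) (at t within I)))"

definition piecewise_C1_curve ::
  "'a topology \<Rightarrow> ('a, 'n::finite) chart set \<Rightarrow> (real \<Rightarrow> 'a) \<Rightarrow> bool" where
  "piecewise_C1_curve X \<A> \<gamma> \<longleftrightarrow>
     continuous_map (top_of_set {0..1}) X \<gamma> \<and>
     (\<exists>(n::nat) s. s 0 = 0 \<and> s n = 1 \<and>
        (\<forall>i<n. s i < s (Suc i) \<and> C1_curve_on \<A> {s i..s (Suc i)} \<gamma>))"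

text \<open>By the transformation law the speed does not depend on the chart selected. It is
  unspecified at the finitely many break points, which do not contribute to the length.\<close>

definition speed ::
  "('a, 'n::finite) chart set \<Rightarrow> ('a, 'n) metric_tensor \<Rightarrow> (real \<Rightarrow> 'a) \<Rightarrow> real \<Rightarrow> real" where
  "speed \<A> g \<gamma> t =
     (let c = (SOME c. c \<in> \<A> \<and> \<gamma> t \<in> fst c);
          v = vector_derivative (snd c \<circ> \<gamma>) (at t within {0..1})
      in sqrt (v \<bullet> (g c (snd c (\<gamma> t)) *v v)))"

definition curve_length ::
  "('a, 'n::finite) chart set \<Rightarrow> ('a, 'n) metric_tensor \<Rightarrow> (real \<Rightarrow> 'a) \<Rightarrow> real" where
  "curve_length \<A> g \<gamma> = integral {0..1} (speed \<A> g \<gamma>)"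

text \<open>The value \<open>0\<close> off the carrier is a convention: the locale \<open>Metric_space\<close> asks for
  nonnegativity and symmetry on the whole type.\<close>

definition Riemannian_dist ::
  "'a topology \<Rightarrow> ('a, 'n::finite) chart set \<Rightarrow> ('a, 'n) metric_tensor \<Rightarrow> 'a \<Rightarrow> 'a \<Rightarrow> real" where
  "Riemannian_dist X \<A> g p q =
     (if p \<in> topspace X \<and> q \<in> topspace X
      then Inf {curve_length \<A> g \<gamma> |\<gamma>. piecewise_C1_curve X \<A> \<gamma> \<and> \<gamma> 0 = p \<and> \<gamma> 1 = q}
      else 0)"

text \<open>The Riemannian volume is the Borel measure with density \<open>sqrt (det g)\<close> in every
  chart. Countably many charts cover the manifold, so this determines it uniquely.\<close>

definition is_Riemannian_volume ::
  "'a topology \<Rightarrow> ('a, 'n::finite) chart set \<Rightarrow> ('a, 'n) metric_tensor \<Rightarrow> 'a measure \<Rightarrow> bool" where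
  "is_Riemannian_volume X \<A> g \<mu> \<longleftrightarrow>
     space \<mu> = topspace X \<and> sets \<mu> = borel_sets_of X \<and>
     (\<forall>c\<in>\<A>. \<forall>B\<in>borel_sets_of X. B \<subseteq> fst c \<longrightarrow>
        emeasure \<mu> B = (\<integral>\<^sup>+ x \<in> snd c ` B. ennreal (sqrt (det (g c x))) \<partial>lborel))"

end

theory Submission
  imports Defs
begin

text \<open>
  The difference of the two approximants at \<open>x\<close> is
  \<open>1/(2r\<^sup>2)\<close> times the mean over \<open>B\<^sub>r(x)\<close> of \<open>(u(y) - u*(x)) (1 - \<mu>(B\<^sub>r(x))/\<mu>(B\<^sub>r(y)))\<close>, so at a Lebesgue point
  it suffices that the volume ratio is \<open>1 + O(r\<^sup>2)\<close>. For a \<open>C\<^sup>2\<close> metric this needs neither geodesics nor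
  curvature: around every point \<open>y\<close> the quadratic change of coordinates
  \<open>P(x) = S w + N(w, w)/2\<close>, \<open>w = x - y\<close>, built from the Christoffel symbols at \<open>y\<close>, removes the first derivatives
  of the metric, so that \<open>P\<close> distorts squared lengths by a factor \<open>1 + O(\<bar>w\<bar>\<^sup>2)\<close>, uniformly in \<open>y\<close>. Hence
  \<open>B\<^sub>r(y)\<close> lies between the \<open>P\<close>-preimages of two Euclidean balls of radius \<open>r (1 + O(r\<^sup>2))\<close>, and its volume is
  \<open>\<omega>\<^sub>n r\<^sup>n (1 + O(r\<^sup>2))\<close>. Almost every point is a Lebesgue point by the Vitali covering theorem in charts.
\<close>

text \<open>At a Lebesgue point the averages of \<open>\<bar>u y - a\<bar>\<close> tend to 0 at no
  known rate, so the prefactor 1/r^2 must be absorbed entirely by the volume ratio. A fixed chart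
  compares lengths only up to a factor 1 + O(r), which would leave an uncontrolled 1/r; hence the
  linear term of the metric is removed at every centre. The constants must be shared by all centres
  near a given point, because the ratio involves balls around x and around every y in the ball; they
  come from bounds on a compact coordinate ball. The correction uses only the value and the first
  derivative of the metric at the centre, so it is a quadratic polynomial in x with explicit
  derivative, even though the Christoffel symbols are merely C^1 in the centre. The two inclusions
  between balls differ in nature: the inner one needs a single curve, the preimage of a segment,
  whereas the outer one concerns every curve shorter than r, and such a curve must first be shown to
  stay in the chart.\<close>

section \<open>Change of variables over an arbitrary finite index type\<close>

typedef 'n idx = "UNIV :: 'n set" ..

lemma bij_Rep_idx: "bij Rep_idx"
  by (metis Abs_idx_inverse Rep_idx_inverse UNIV_I bijI')

instance idx :: (finite) finite
  by standard (metis bij_Rep_idx bij_betw_finite finite)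

instantiation idx :: (finite) wellorder
begin

definition less_eq_idx :: "'a idx \<Rightarrow> 'a idx \<Rightarrow> bool"
  where "less_eq_idx x y \<longleftrightarrow> to_nat (Rep_idx x) \<le> to_nat (Rep_idx y)"

definition less_idx :: "'a idx \<Rightarrow> 'a idx \<Rightarrow> bool"
  where "less_idx x y \<longleftrightarrow> to_nat (Rep_idx x) < to_nat (Rep_idx y)"

instance
proof
  fix P :: "'a idx \<Rightarrow> bool" and a
  assume *: "\<And>x. (\<And>y. y < x \<Longrightarrow> P y) \<Longrightarrow> P x"
  show "P a"
    by (induction a rule: measure_induct_rule[where f = "\<lambda>x. to_nat (Rep_idx x)"])
       (auto intro: * simp: less_idx_def)
qed (auto simp: less_eq_idx_def less_idx_def Rep_idx_inject)

end

definition reindex :: "real ^ 'n::finite \<Rightarrow> real ^ 'n idx"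
  where "reindex x = (\<chi> i. x $ Rep_idx i)"

definition unindex :: "real ^ 'n idx \<Rightarrow> real ^ 'n::finite"
  where "unindex x = (\<chi> i. x $ Abs_idx i)"

lemma unindex_reindex [simp]: "unindex (reindex x) = x"
  and reindex_unindex [simp]: "reindex (unindex y) = y"
  by (simp_all add: unindex_def reindex_def vec_eq_iff Abs_idx_inverse Rep_idx_inverse)

lemma bounded_linear_reindex: "bounded_linear reindex"
  and bounded_linear_unindex: "bounded_linear unindex"
  unfolding linear_conv_bounded_linear[symmetric]
  by (auto intro!: linearI simp: reindex_def unindex_def vec_eq_iff)

lemma continuous_on_reindex: "continuous_on S reindex"
  and continuous_on_unindex: "continuous_on T unindex"
  by (simp_all add: bounded_linear_reindex bounded_linear_unindex linear_continuous_on)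

lemma measurable_reindex [measurable]: "reindex \<in> borel \<rightarrow>\<^sub>M borel"
  and measurable_unindex [measurable]: "unindex \<in> borel \<rightarrow>\<^sub>M borel"
  by (simp_all add: borel_measurable_continuous_onI continuous_on_reindex continuous_on_unindex)

lemma reindex_image: "reindex ` S = unindex -` S"
  by (force simp: image_iff) 

lemma prod_Basis_cart:
  "(\<Prod>b\<in>(Basis :: (real ^ 'n::finite) set). h b) = (\<Prod>i\<in>UNIV. h (axis i 1))"
proof -
  have B: "(Basis :: (real ^ 'n) set) = range (\<lambda>i. axis i 1)"
    by (auto simp: Basis_vec_def)
  show ?thesis
    unfolding B by (subst prod.reindex) (auto intro!: injI simp: axis_eq_axis)
qed

text \<open>Lebesgue measure is determined by its values on boxes, and renaming the coordinates
  sends a box to a box with the same side lengths.\<close>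

lemma distr_reindex: "distr lborel borel (reindex :: real ^ 'n::finite \<Rightarrow> _) = lborel"
proof (rule lborel_eqI[symmetric])
  fix l u :: "real ^ 'n idx"
  assume le: "\<And>b. b \<in> Basis \<Longrightarrow> l \<bullet> b \<le> u \<bullet> b"
  have le': "l $ i \<le> u $ i" for i
    using le[of "axis i 1"] by (simp add: inner_axis axis_in_Basis_iff)
  have "reindex -` box l u = box (unindex l) (unindex u :: real ^ 'n)"
    by (auto simp: mem_box_cart reindex_def unindex_def)
       (metis Abs_idx_inverse UNIV_I, metis Abs_idx_inverse UNIV_I, metis Rep_idx_inverse, metis Rep_idx_inverse)
  moreover have "(\<Prod>b\<in>Basis. (unindex u - unindex l :: real ^ 'n) \<bullet> b) = (\<Prod>b\<in>Basis. (u - l) \<bullet> b)"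
    unfolding prod_Basis_cart
    by (rule prod.reindex_bij_witness[of _ Rep_idx Abs_idx])
       (auto simp: inner_axis unindex_def Abs_idx_inverse Rep_idx_inverse)
  moreover have "unindex l \<bullet> b \<le> unindex u \<bullet> b" if "b \<in> (Basis :: (real ^ 'n) set)" for b
    using that le' by (auto simp: Basis_vec_def inner_axis unindex_def)
  ultimately show "emeasure (distr lborel borel (reindex :: real ^ 'n \<Rightarrow> _)) (box l u)
      = ennreal (\<Prod>b\<in>Basis. (u - l) \<bullet> b)"
    by (simp add: emeasure_distr emeasure_lborel_box)
qed simp

text \<open>Leibniz formula: conjugation with the bijection of indices permutes the summands and
  preserves the sign of each permutation.\<close>

lemma det_reindex:
  fixes A :: "real ^ 'n::finite ^ 'n"
  shows "det (\<chi> i j. A $ Rep_idx i $ Rep_idx j) = det A"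
proof -
  let ?m = "map_permutation UNIV Rep_idx :: ('n idx \<Rightarrow> 'n idx) \<Rightarrow> 'n \<Rightarrow> 'n"
  have bij: "bij_betw ?m {p. p permutes UNIV} {p. p permutes UNIV}"
  proof (rule bij_betw_cong[THEN iffD1, OF _ bij_betw_permutations[OF bij_Rep_idx]])
    fix p :: "'n idx \<Rightarrow> 'n idx"
    show "(\<lambda>x. if x \<in> UNIV then Rep_idx (p (inv Rep_idx x)) else x) = ?m p"
      using bij_Rep_idx by (auto simp: map_permutation_def restrict_id_def fun_eq_iff bij_def)
  qed
  have inj: "inj_on (Rep_idx :: 'n idx \<Rightarrow> 'n) UNIV"
    using bij_Rep_idx bij_is_inj by auto
  have "det A = (\<Sum>p\<in>{p. p permutes UNIV}. of_int (sign (?m p)) * (\<Prod>i\<in>UNIV. A $ i $ ?m p i))"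
    unfolding det_def by (rule sum.reindex_bij_betw[OF bij, symmetric])
  also have "\<dots> = (\<Sum>p\<in>{p. p permutes UNIV}. of_int (sign p) *
      (\<Prod>i\<in>UNIV. A $ Rep_idx i $ Rep_idx (p i)))"
  proof (rule sum.cong[OF refl])
    fix p :: "'n idx \<Rightarrow> 'n idx" assume p: "p \<in> {p. p permutes UNIV}"
    have "(\<Prod>i\<in>UNIV. A $ i $ ?m p i) = (\<Prod>i\<in>UNIV. A $ Rep_idx i $ ?m p (Rep_idx i))"
      by (rule prod.reindex_bij_betw[OF bij_Rep_idx, symmetric])
    also have "\<dots> = (\<Prod>i\<in>UNIV. A $ Rep_idx i $ Rep_idx (p i))"
      using inj by (simp add: map_permutation_apply[where f = Rep_idx])
    finally show "of_int (sign (?m p)) * (\<Prod>i\<in>UNIV. A $ i $ ?m p i) =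
        of_int (sign p) * (\<Prod>i\<in>UNIV. A $ Rep_idx i $ Rep_idx (p i))"
      using p inj by (simp add: sign_map_permutation)
  qed
  also have "\<dots> = det (\<chi> i j. A $ Rep_idx i $ Rep_idx j)"
    by (simp add: det_def)
  finally show ?thesis ..
qed

lemma reindex_axis: "unindex (axis i 1) = axis (Rep_idx i) 1"
  by (auto simp: unindex_def axis_def vec_eq_iff Rep_idx_inverse Abs_idx_inverse)

text \<open>The library states the change of variables only for index types with a well-order,
  hence the detour through \<open>reindex\<close>.\<close>

lemma nn_integral_abs_det_image:
  fixes f :: "real ^ 'n::finite \<Rightarrow> real ^ 'n"
  assumes "open S" and "open (f ` S)" and "bounded (f ` S)"
    and der: "\<And>x. x \<in> S \<Longrightarrow> (f has_derivative f' x) (at x)"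
    and inj: "inj_on f S"
    and cont: "continuous_on S (\<lambda>x. det (matrix (f' x)))"
  shows "(\<integral>\<^sup>+x\<in>S. ennreal \<bar>det (matrix (f' x))\<bar> \<partial>lborel) = emeasure lborel (f ` S)"
proof -
  define S' where "S' = reindex ` S"
  define F where "F = reindex \<circ> f \<circ> unindex"
  define F' where "F' y = reindex \<circ> f' (unindex y) \<circ> unindex" for y
  have S'_eq: "S' = unindex -` S"
    unfolding S'_def by (rule reindex_image)
  have "open S'"
    unfolding S'_eq using \<open>open S\<close> continuous_on_unindex open_vimage by blast
  have im: "F ` S' = reindex ` (f ` S)"
    by (simp add: F_def S'_def image_image)
  have "open (F ` S')"
    unfolding im reindex_image using assms(2) continuous_on_unindex open_vimage by blast
  moreover have "bounded (F ` S')"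
    unfolding im using assms(3) bounded_linear_image bounded_linear_reindex by blast
  \<comment> \<open>Boundedness enters here: the image has finite measure, so the real-valued gauge
    integral below can express it.\<close>
  ultimately have meas: "F ` S' \<in> lmeasurable"
    by (simp add: lmeasurable_open)
  have injF: "inj_on F S'"
    using inj by (auto simp: inj_on_def F_def S'_def) (metis unindex_reindex)
  have derF: "(F has_derivative F' y) (at y within S')" if "y \<in> S'" for y
  proof -
    have "(unindex has_derivative unindex) (at y within S')"
      using bounded_linear_unindex bounded_linear_imp_has_derivative by blast
    moreover have "(f has_derivative f' (unindex y)) (at (unindex y))"
      using that der by (auto simp: S'_def)
    ultimately have 1: "(f \<circ> unindex has_derivative f' (unindex y) \<circ> unindex) (at y within S')"
      using has_derivative_in_compose has_derivative_at_withinI unfolding o_def by blast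
    show ?thesis
      unfolding F_def F'_def
      using bounded_linear.has_derivative[OF bounded_linear_reindex 1] by (simp add: o_def)
  qed
  have det: "det (matrix (F' y)) = det (matrix (f' (unindex y)))" if "y \<in> S'" for y
  proof -
    have "matrix (F' y) = (\<chi> i j. matrix (f' (unindex y)) $ Rep_idx i $ Rep_idx j)"
      by (simp add: matrix_def F'_def vec_eq_iff reindex_def reindex_axis)
    then show ?thesis
      by (simp add: det_reindex)
  qed
  have "((\<lambda>x. \<bar>det (matrix (F' x))\<bar>) has_integral measure lebesgue (F ` S')) S'"
    using has_measure_differentiable_image[where m = "measure lebesgue (F ` S')", OF _ derF injF]
      meas \<open>open S'\<close> by auto
  then have "((\<lambda>x. \<bar>det (matrix (f' (unindex x)))\<bar>) has_integral measure lebesgue (F ` S')) S'"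
    by (rule has_integral_eq[rotated]) (simp add: det)
  then have "integral\<^sup>N lborel (\<lambda>x. indicator S' x * \<bar>det (matrix (f' (unindex x)))\<bar>)
      = ennreal (measure lebesgue (F ` S'))"
    by (intro nn_integral_has_integral_lebesgue) auto
  then have *: "integral\<^sup>N lborel (\<lambda>x. indicator S' x * ennreal \<bar>det (matrix (f' (unindex x)))\<bar>)
      = emeasure lebesgue (F ` S')"
    using meas by (simp add: emeasure_eq_measure2 ennreal_mult' ennreal_indicator)
  \<comment> \<open>The determinant is continuous only on \<open>S\<close>; times the indicator of
    an open set it becomes Borel on the whole space, as the change of measure below
    requires.\<close>
  have m1: "(\<lambda>x. indicator S x * ennreal \<bar>det (matrix (f' x))\<bar>) \<in> borel_measurable borel"
  proof -
    have "(\<lambda>x. indicator S x *\<^sub>R \<bar>det (matrix (f' x))\<bar>) \<in> borel_measurable borel"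
      using \<open>open S\<close> by (intro borel_measurable_continuous_on_indicator continuous_intros cont) auto
    then have "(\<lambda>x. ennreal (indicator S x *\<^sub>R \<bar>det (matrix (f' x))\<bar>)) \<in> borel_measurable borel"
      by measurable
    then show ?thesis
      by (rule measurable_cong[THEN iffD1, rotated]) (auto simp: indicator_def)
  qed
  have eq: "indicator S' x * ennreal \<bar>det (matrix (f' (unindex x)))\<bar>
      = (\<lambda>x. indicator S x * ennreal \<bar>det (matrix (f' x))\<bar>) (unindex x)" for x
    by (auto simp: S'_eq indicator_def)
  have m2: "(\<lambda>x. indicator S' x * ennreal \<bar>det (matrix (f' (unindex x)))\<bar>) \<in> borel_measurable borel"
    unfolding eq by (rule measurable_compose[OF measurable_unindex m1])
  have "emeasure lebesgue (F ` S') = emeasure lborel (F ` S')"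
    using \<open>open (F ` S')\<close> by simp
  also have "\<dots> = emeasure (distr lborel borel reindex) (F ` S')"
    by (simp add: distr_reindex)
  also have "\<dots> = emeasure lborel (reindex -` F ` S')"
    using \<open>open (F ` S')\<close> by (subst emeasure_distr) auto
  also have "reindex -` F ` S' = f ` S"
    unfolding im by (auto simp: image_iff) (metis unindex_reindex)
  finally have 1: "emeasure lebesgue (F ` S') = emeasure lborel (f ` S)" .
  have "integral\<^sup>N lborel (\<lambda>x. indicator S' x * ennreal \<bar>det (matrix (f' (unindex x)))\<bar>)
      = integral\<^sup>N (distr lborel borel reindex)
      (\<lambda>x. indicator S' x * ennreal \<bar>det (matrix (f' (unindex x)))\<bar>)"
    by (simp add: distr_reindex)
  also have "\<dots> = integral\<^sup>N lborel (\<lambda>x. indicator S x * ennreal \<bar>det (matrix (f' x))\<bar>)"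
    using m2 by (subst nn_integral_distr) (auto simp: S'_eq indicator_def)
  finally show ?thesis
    using * 1 by (simp add: mult.commute)
qed

section \<open>Lebesgue differentiation\<close>

text \<open>Vitali argument. Balls with large average are chosen inside an open set that exceeds
  \<open>{x. f x \<le> \<alpha>}\<close> by little \<open>f\<close>-mass, disjointly and so that
  they cover almost all of \<open>E\<close>. Their union \<open>D\<close> satisfies
  \<open>\<beta> |D| \<le> \<nu> D \<le> \<alpha> |D| + \<eta>\<close>, which forces
  \<open>|D|\<close> to be small.\<close>

lemma negligible_density_gap:
  fixes f :: "'a::euclidean_space \<Rightarrow> ennreal" and \<alpha> \<beta> :: real
  assumes f[measurable]: "f \<in> borel_measurable borel"
    and fin: "(\<integral>\<^sup>+x. f x \<partial>lborel) < \<infinity>"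
    and \<alpha>: "0 \<le> \<alpha>" "\<alpha> < \<beta>"
    and small: "\<And>x. x \<in> E \<Longrightarrow> f x \<le> \<alpha>"
    and large: "\<And>x \<delta>. x \<in> E \<Longrightarrow> 0 < \<delta> \<Longrightarrow> \<exists>r. 0 < r \<and> r < \<delta> \<and>
      \<beta> * emeasure lborel (ball x r) \<le> (\<integral>\<^sup>+y\<in>ball x r. f y \<partial>lborel)"
  shows "negligible E"
  unfolding negligible_outer_le
proof (intro allI impI)
  fix e :: real assume "e > 0"
  define \<nu> where "\<nu> = density lborel f"
  define S where "S = {x. f x \<le> \<alpha>}"
  have [measurable]: "S \<in> sets borel"
    unfolding S_def by measurable
  have sets_\<nu> [measurable_cong, simp]: "sets \<nu> = sets borel"
    by (simp add: \<nu>_def)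
  have \<nu>_eq: "emeasure \<nu> A = (\<integral>\<^sup>+x\<in>A. f x \<partial>lborel)" if "A \<in> sets borel" for A
    using that by (simp add: \<nu>_def emeasure_density)
  have fin_UNIV: "emeasure \<nu> UNIV < \<infinity>"
    using fin by (simp add: \<nu>_eq)
  have fin\<nu>: "emeasure \<nu> A < \<infinity>" for A
    by (rule le_less_trans[OF emeasure_space]) (use fin_UNIV in \<open>simp add: \<nu>_def\<close>)
  \<comment> \<open>The mass allowed outside \<open>S\<close>: division by
    \<open>\<beta> - \<alpha>\<close> at the end leaves exactly \<open>e\<close>.\<close>
  define \<eta> where "\<eta> = e * (\<beta> - \<alpha>)"
  have "\<eta> > 0"
    using \<open>e > 0\<close> \<alpha> by (simp add: \<eta>_def)
  have "emeasure \<nu> S < emeasure \<nu> S + \<eta>"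
    using fin\<nu>[of S] \<open>\<eta> > 0\<close> by (simp add: ennreal_add_left_cancel_less[of _ 0, simplified] top.not_eq_extremum)
  \<comment> \<open>Outer regularity is taken for \<open>\<nu>\<close> rather than for Lebesgue
    measure, since the excess has to be small in \<open>f\<close>-mass.\<close>
  moreover have "emeasure \<nu> S = (INF U\<in>{U. S \<subseteq> U \<and> open U}. emeasure \<nu> U)"
    by (rule outer_regular) (use fin_UNIV in \<open>auto simp: \<nu>_def\<close>)
  ultimately obtain T where T: "S \<subseteq> T" "open T" "emeasure \<nu> T < emeasure \<nu> S + \<eta>"
    by (auto simp: Inf_less_iff)
  have "emeasure \<nu> (T - S) \<le> \<eta>"
  proof -
    have "emeasure \<nu> (T - S) = emeasure \<nu> T - emeasure \<nu> S"
      using T fin\<nu>[of S] by (intro emeasure_Diff) auto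
    also have "\<dots> \<le> \<eta>"
      using T(3) fin\<nu>[of S] by (auto simp: ennreal_minus_le_iff)
    finally show ?thesis .
  qed
  define K where "K = {i. 0 < snd i \<and> ball (fst i) (snd i) \<subseteq> T \<and>
      \<beta> * emeasure lborel (ball (fst i) (snd i)) \<le> emeasure \<nu> (ball (fst i) (snd i))}"
  have "\<exists>i. i \<in> K \<and> x \<in> ball (fst i) (snd i) \<and> snd i < d" if "x \<in> E" "0 < d" for x d
  proof -
    have "x \<in> T"
      using small[OF \<open>x \<in> E\<close>] T(1) by (auto simp: S_def)
    then obtain \<rho> where "\<rho> > 0" "ball x \<rho> \<subseteq> T"
      using \<open>open T\<close> openE by blast
    then obtain r where "0 < r" "r < min d \<rho>"
        "\<beta> * emeasure lborel (ball x r) \<le> (\<integral>\<^sup>+y\<in>ball x r. f y \<partial>lborel)"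
      using large[OF \<open>x \<in> E\<close>, of "min d \<rho>"] \<open>0 < d\<close> by auto
    moreover have "ball x r \<subseteq> ball x \<rho>"
      using \<open>r < min d \<rho>\<close> by (simp add: subset_ball)
    ultimately show ?thesis
      using \<open>ball x \<rho> \<subseteq> T\<close> by (intro exI[of _ "(x, r)"]) (auto simp: K_def \<nu>_eq)
  qed
  then obtain C where C: "countable C" "C \<subseteq> K"
      "pairwise (\<lambda>i j. disjnt (ball (fst i) (snd i)) (ball (fst j) (snd j))) C"
      "negligible (E - (\<Union>i\<in>C. ball (fst i) (snd i)))"
    using Vitali_covering_theorem_balls[of E K fst snd] by blast
  define D where "D = (\<Union>i\<in>C. ball (fst i) (snd i))"
  have "open D"
    by (auto simp: D_def)
  have "D \<subseteq> T"
  proof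
    fix x assume "x \<in> D"
    then obtain i where "i \<in> C" "x \<in> ball (fst i) (snd i)"
      by (auto simp: D_def)
    moreover have "ball (fst i) (snd i) \<subseteq> T"
      using \<open>i \<in> C\<close> C(2) by (auto simp: K_def)
    ultimately show "x \<in> T"
      by blast
  qed
  have disj: "disjoint_family_on (\<lambda>i. ball (fst i) (snd i)) C"
    using C(3) by (auto simp: disjoint_family_on_def pairwise_def disjnt_def)
  have "\<beta> * emeasure lborel D = (\<integral>\<^sup>+i. \<beta> * emeasure lborel (ball (fst i) (snd i)) \<partial>count_space C)"
    unfolding D_def using C(1) disj by (simp add: emeasure_UN_countable nn_integral_cmult)
  also have "\<dots> \<le> (\<integral>\<^sup>+i. emeasure \<nu> (ball (fst i) (snd i)) \<partial>count_space C)"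
    using C(2) by (intro nn_integral_mono) (auto simp: K_def)
  also have "\<dots> = emeasure \<nu> D"
    unfolding D_def using C(1) disj by (simp add: emeasure_UN_countable)
  finally have lower: "\<beta> * emeasure lborel D \<le> emeasure \<nu> D" .
  have "emeasure \<nu> D = emeasure \<nu> (D \<inter> S) + emeasure \<nu> (D - S)"
    using \<open>open D\<close> by (subst plus_emeasure) (auto intro!: arg_cong[where f = "emeasure \<nu>"])
  also have "emeasure \<nu> (D - S) \<le> \<eta>"
  proof (rule order_trans[OF emeasure_mono \<open>emeasure \<nu> (T - S) \<le> \<eta>\<close>])
    show "T - S \<in> sets \<nu>"
      using \<open>open T\<close> by simp
  qed (use \<open>D \<subseteq> T\<close> in auto)
  also have "emeasure \<nu> (D \<inter> S) \<le> (\<integral>\<^sup>+x\<in>D. \<alpha> \<partial>lborel)"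
    using \<open>open D\<close> by (subst \<nu>_eq) (auto intro!: nn_integral_mono simp: S_def indicator_def)
  also have "\<dots> = \<alpha> * emeasure lborel D"
    using \<open>open D\<close> by (simp add: nn_integral_cmult_indicator)
  finally have upper: "emeasure \<nu> D \<le> \<alpha> * emeasure lborel D + \<eta>"
    by (simp add: add_mono)
  \<comment> \<open>Finiteness of \<open>|D|\<close> comes first, since in \<open>ennreal\<close>
    the term \<open>\<alpha> |D|\<close> can be cancelled only when finite.\<close>
  have "\<beta> * emeasure lborel D < \<infinity>"
    using lower fin\<nu>[of D] by (rule le_less_trans)
  then have "emeasure lborel D < \<infinity>"
    using \<alpha> by (auto simp: ennreal_mult_less_top)
  then obtain m where m: "emeasure lborel D = ennreal m" "m \<ge> 0"
    by (cases "emeasure lborel D") auto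
  have "ennreal \<beta> * ennreal m \<le> ennreal \<alpha> * ennreal m + ennreal \<eta>"
    using order_trans[OF lower upper] m by simp
  then have "ennreal (\<beta> * m) \<le> ennreal (\<alpha> * m + \<eta>)"
    using \<alpha> m \<open>\<eta> > 0\<close> by (simp add: ennreal_mult)
  then have "\<beta> * m \<le> \<alpha> * m + \<eta>"
    using \<alpha> m \<open>\<eta> > 0\<close> by (subst (asm) ennreal_le_iff) auto
  then have "(\<beta> - \<alpha>) * m \<le> (\<beta> - \<alpha>) * e"
    by (simp add: \<eta>_def algebra_simps)
  then have "m \<le> e"
    using \<alpha> by simp
  let ?T = "D \<union> (E - D)"
  have N: "E - D \<in> null_sets lebesgue"
    using C(4) by (simp add: D_def negligible_iff_null_sets)
  have "emeasure lebesgue ?T = ennreal m"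
    using N m \<open>open D\<close> by (subst emeasure_Un_null_set) auto
  then have eT: "emeasure lebesgue ?T = ennreal m" .
  moreover have "?T \<in> sets lebesgue"
    by (rule sets.Un) (use N \<open>open D\<close> in auto)
  ultimately have "?T \<in> lmeasurable"
    using eT by (intro fmeasurableI) (simp_all only: ennreal_less_top infinity_ennreal_def)
  moreover have "measure lebesgue ?T \<le> e"
    unfolding measure_def eT using \<open>m \<le> e\<close> m by simp
  ultimately show "\<exists>T. E \<subseteq> T \<and> T \<in> lmeasurable \<and> measure lebesgue T \<le> e"
    by (intro exI[of _ ?T]) auto
qed

text \<open>The exceptional set may depend neither on \<epsilon> nor on the value
  \<open>u x\<close>, so failures are indexed by countably many pairs: a rational \<open>q\<close>
  near the value and a rational level \<open>\<alpha>\<close>. For each pair,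
  \<open>\<bar>u - q\<bar>\<close> is at most \<open>\<alpha>\<close> at the point while its
  averages reach \<open>2 * \<alpha>\<close> at arbitrarily small radii, which the density gap
  excludes almost everywhere.\<close>

lemma Lebesgue_differentiation:
  fixes u :: "'a::euclidean_space \<Rightarrow> real"
  assumes [measurable]: "u \<in> borel_measurable borel"
    and "open W" "emeasure lborel W < \<infinity>" and fin: "(\<integral>\<^sup>+x\<in>W. ennreal \<bar>u x\<bar> \<partial>lborel) < \<infinity>"
  obtains N where "negligible N"
    "\<And>x \<epsilon>. x \<in> W - N \<Longrightarrow> 0 < \<epsilon> \<Longrightarrow>
      \<forall>\<^sub>F r in at_right 0. (\<integral>\<^sup>+y\<in>ball x r. ennreal \<bar>u y - u x\<bar> \<partial>lborel) \<le> ennreal \<epsilon> * emeasure lborel (ball x r)"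
proof -
  have [measurable]: "W \<in> sets borel"
    using \<open>open W\<close> by simp
  have tri: "\<bar>u x - of_rat q\<bar> \<le> \<bar>u x\<bar> + of_rat \<bar>q\<bar>" for x q
    using abs_triangle_ineq4[of "u x" "of_rat q"] by simp
  \<comment> \<open>The cut-off to \<open>W\<close> makes the integral over the whole space
    finite.\<close>
  define f where "f q x = indicator W x * ennreal \<bar>u x - of_rat q\<bar>" for q x
  define E where "E q \<alpha> = {x \<in> W. f q x \<le> of_rat \<alpha> \<and> (\<forall>\<delta>>0. \<exists>r. 0 < r \<and> r < \<delta> \<and>
      ennreal (2 * of_rat \<alpha>) * emeasure lborel (ball x r) \<le> (\<integral>\<^sup>+y\<in>ball x r. f q y \<partial>lborel))}"
    for q \<alpha>
  define N where "N = (\<Union>q. \<Union>\<alpha>\<in>{0<..}. E q \<alpha>)"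
  have "negligible (E q \<alpha>)" if "\<alpha> > 0" for q \<alpha>
  proof (rule negligible_density_gap[of "f q" "of_rat \<alpha>" "2 * of_rat \<alpha>"])
    show "f q \<in> borel_measurable borel"
      unfolding f_def by measurable
    have "(\<integral>\<^sup>+x. f q x \<partial>lborel) \<le> (\<integral>\<^sup>+x. ennreal \<bar>u x\<bar> * indicator W x + ennreal \<bar>of_rat q\<bar> * indicator W x \<partial>lborel)"
      by (intro nn_integral_mono)
         (auto simp: f_def indicator_def ennreal_plus[symmetric] simp del: ennreal_plus intro!: ennreal_leI tri)
    also have "\<dots> = (\<integral>\<^sup>+x\<in>W. ennreal \<bar>u x\<bar> \<partial>lborel) + ennreal \<bar>of_rat q\<bar> * emeasure lborel W"
      by (simp add: nn_integral_add nn_integral_cmult_indicator)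
    also have "\<dots> < \<infinity>"
      using fin assms(3) by (simp add: ennreal_mult_less_top)
    finally show "(\<integral>\<^sup>+x. f q x \<partial>lborel) < \<infinity>" .
  qed (use that in \<open>auto simp: E_def\<close>)
  moreover have "N = \<Union>(case_prod E ` (UNIV \<times> {0<..}))"
    by (auto simp: N_def)
  ultimately have "negligible N"
    by (auto intro!: negligible_countable_Union)
  moreover have "\<forall>\<^sub>F r in at_right 0. (\<integral>\<^sup>+y\<in>ball x r. ennreal \<bar>u y - u x\<bar> \<partial>lborel) \<le> ennreal \<epsilon> * emeasure lborel (ball x r)"
    if x: "x \<in> W - N" and "0 < \<epsilon>" for x \<epsilon>
  proof -
    obtain q where q: "\<bar>u x - of_rat q\<bar> < \<epsilon> / 6"
    proof -
      obtain q where "u x - \<epsilon> / 6 < of_rat q" "of_rat q < u x"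
        using of_rat_dense[of "u x - \<epsilon> / 6" "u x"] \<open>0 < \<epsilon>\<close> by auto
      then show ?thesis
        using that[of q] by auto
    qed
    \<comment> \<open>The window puts \<open>\<alpha>\<close> above
      \<open>\<bar>u x - q\<bar>\<close> and keeps the final sum
      \<open>2 * \<alpha> + \<epsilon> / 6\<close> below \<epsilon>.\<close>
    obtain \<alpha> where \<alpha>: "\<epsilon> / 6 < of_rat \<alpha>" "of_rat \<alpha> < \<epsilon> / 3"
      using of_rat_dense[of "\<epsilon> / 6" "\<epsilon> / 3"] \<open>0 < \<epsilon>\<close> by auto
    have "\<alpha> > 0"
      using \<alpha>(1) \<open>0 < \<epsilon>\<close> by (metis divide_pos_pos of_rat_0 of_rat_less order_less_trans zero_less_numeral)
    then have "x \<notin> E q \<alpha>"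
      using x by (auto simp: N_def)
    moreover have "f q x \<le> of_rat \<alpha>"
      using q \<alpha> x by (auto simp: f_def intro!: ennreal_leI)
    ultimately obtain \<delta> where \<delta>: "\<delta> > 0" "\<And>r. 0 < r \<Longrightarrow> r < \<delta> \<Longrightarrow>
        (\<integral>\<^sup>+y\<in>ball x r. f q y \<partial>lborel) < ennreal (2 * of_rat \<alpha>) * emeasure lborel (ball x r)"
      using x by (auto simp: E_def not_le)
    obtain \<rho> where \<rho>: "\<rho> > 0" "ball x \<rho> \<subseteq> W"
      using x \<open>open W\<close> openE by blast
    have "(\<integral>\<^sup>+y\<in>ball x r. ennreal \<bar>u y - u x\<bar> \<partial>lborel) \<le> ennreal \<epsilon> * emeasure lborel (ball x r)"
      if "0 < r" "r < min \<delta> \<rho>" for r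
    proof -
      have W: "y \<in> W" if "y \<in> ball x r" for y
        using that \<rho> \<open>r < min \<delta> \<rho>\<close> by auto
      have "(\<integral>\<^sup>+y\<in>ball x r. ennreal \<bar>u y - u x\<bar> \<partial>lborel)
          \<le> (\<integral>\<^sup>+y. f q y * indicator (ball x r) y + ennreal (\<epsilon> / 6) * indicator (ball x r) y \<partial>lborel)"
      proof (rule nn_integral_mono)
        fix y
        have "ennreal \<bar>u y - u x\<bar> \<le> ennreal (\<bar>u y - of_rat q\<bar> + \<epsilon> / 6)"
          using q by (intro ennreal_leI) linarith
        also have "\<dots> = ennreal \<bar>u y - of_rat q\<bar> + ennreal (\<epsilon> / 6)"
          using \<open>0 < \<epsilon>\<close> by (intro ennreal_plus) auto
        finally show "ennreal \<bar>u y - u x\<bar> * indicator (ball x r) y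
            \<le> f q y * indicator (ball x r) y + ennreal (\<epsilon> / 6) * indicator (ball x r) y"
          using W[of y] by (simp add: f_def indicator_def)
      qed
      also have "\<dots> = (\<integral>\<^sup>+y\<in>ball x r. f q y \<partial>lborel) + ennreal (\<epsilon> / 6) * emeasure lborel (ball x r)"
      proof (subst nn_integral_add)
        have [measurable]: "ball x r \<in> sets borel"
          by simp
        show "(\<lambda>y. f q y * indicator (ball x r) y) \<in> borel_measurable lborel"
          unfolding f_def by measurable
        show "(\<lambda>y. ennreal (\<epsilon> / 6) * indicator (ball x r) y) \<in> borel_measurable lborel"
          by measurable
      qed (simp add: nn_integral_cmult_indicator)
      also have "\<dots> \<le> ennreal (2 * of_rat \<alpha>) * emeasure lborel (ball x r) + ennreal (\<epsilon> / 6) * emeasure lborel (ball x r)"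
        using \<delta>(2)[of r] that by (intro add_mono) auto
      also have "\<dots> = ennreal (2 * of_rat \<alpha> + \<epsilon> / 6) * emeasure lborel (ball x r)"
        using \<open>0 < \<epsilon>\<close> \<open>\<alpha> > 0\<close> by (simp add: distrib_right)
      also have "\<dots> \<le> ennreal \<epsilon> * emeasure lborel (ball x r)"
        using \<alpha> \<open>0 < \<epsilon>\<close> by (intro mult_right_mono ennreal_leI) auto
      finally show ?thesis .
    qed
    then show ?thesis
      using \<delta>(1) \<rho>(1) by (intro eventually_at_rightI[of 0 "min \<delta> \<rho>"]) auto
  qed
  ultimately show ?thesis
    using that by blast
qed

section \<open>Quadratic forms and the Taylor estimate\<close>

text \<open>The norm on matrices is the Frobenius norm, so Cauchy-Schwarz row by row gives the
  bound.\<close>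

lemma norm_matrix_vector_mult_le:
  fixes A :: "real ^ 'n ^ 'm"
  shows "norm (A *v x) \<le> norm A * norm x"
proof -
  have "norm (A *v x) = L2_set (\<lambda>i. \<bar>A $ i \<bullet> x\<bar>) UNIV"
    by (simp add: norm_vec_def matrix_vector_mul_component)
  also have "\<dots> \<le> L2_set (\<lambda>i. norm (A $ i) * norm x) UNIV"
    by (intro L2_set_mono) (auto simp: Cauchy_Schwarz_ineq2)
  also have "\<dots> = norm A * norm x"
    by (simp add: norm_vec_def[of A] L2_set_left_distrib)
  finally show ?thesis .
qed

lemma bilinear_form_symmetric:
  fixes A :: "real ^ 'n ^ 'n"
  assumes "transpose A = A"
  shows "v \<bullet> (A *v w) = w \<bullet> (A *v v)"
  by (metis assms dot_lmul_matrix inner_commute transpose_matrix_vector)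

lemma abs_bilinear_form_le:
  fixes A :: "real ^ 'n ^ 'n"
  shows "\<bar>v \<bullet> (A *v w)\<bar> \<le> norm A * norm v * norm w"
proof -
  have "\<bar>v \<bullet> (A *v w)\<bar> \<le> norm v * norm (A *v w)"
    by (rule Cauchy_Schwarz_ineq2)
  also have "\<dots> \<le> norm v * (norm A * norm w)"
    by (intro mult_left_mono norm_matrix_vector_mult_le) auto
  finally show ?thesis
    by (simp add: mult_ac)
qed

lemma continuous_on_det:
  fixes A :: "'a::topological_space \<Rightarrow> real ^ 'n ^ 'n"
  assumes "continuous_on S A"
  shows "continuous_on S (\<lambda>x. det (A x))"
  unfolding det_def by (intro continuous_intros assms)

text \<open>Gram-Schmidt for the form \<open>G\<close>: if the columns of \<open>A\<close> form a
  \<open>G\<close>-orthonormal basis, then \<open>S = transpose A ** G\<close> is a left inverse of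
  \<open>A\<close>, hence a right inverse, and
  \<open>transpose S ** S = G ** (A ** S) = G\<close>.\<close>

lemma posdef_imp_Gram:
  fixes G :: "real ^ 'n ^ 'n"
  assumes sym: "transpose G = G" and pos: "\<And>v. v \<noteq> 0 \<Longrightarrow> 0 < v \<bullet> (G *v v)"
  obtains S :: "real ^ 'n ^ 'n" where "transpose S ** S = G"
proof -
  define orth where "orth B \<longleftrightarrow> finite B \<and>
    (\<forall>b\<in>B. \<forall>c\<in>B. b \<bullet> (G *v c) = (if b = c then 1 else 0))" for B
  have "\<exists>B. orth B \<and> card B = k" if "k \<le> CARD('n)" for k
    using that
  proof (induction k)
    case 0
    show ?case by (rule exI[of _ "{}"]) (simp add: orth_def)
  next
    case (Suc k)
    then obtain B where B: "orth B" "card B = k"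
      by auto
    have "dim ((*v) G ` B) \<le> card ((*v) G ` B)"
      using B by (intro dim_le_card') (simp add: orth_def)
    also have "\<dots> \<le> card B"
      using B by (intro card_image_le) (simp add: orth_def)
    finally have "dim ((*v) G ` B) < DIM(real ^ 'n)"
      using B Suc.prems by simp
    \<comment> \<open>Euclidean orthogonality to the vectors \<open>G *v b\<close> is orthogonality
      to the \<open>b\<close> for the form \<open>G\<close>.\<close>
    then obtain x where x: "x \<noteq> 0" "\<And>y. y \<in> span ((*v) G ` B) \<Longrightarrow> orthogonal x y"
      using orthogonal_to_subspace_exists by blast
    define n where "n = x \<bullet> (G *v x)"
    have "n > 0"
      using pos x(1) by (simp add: n_def)
    define e where "e = x /\<^sub>R sqrt n"
    have eb: "e \<bullet> (G *v b) = 0" if "b \<in> B" for b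
      using x(2)[OF span_base, of "G *v b"] that by (simp add: e_def orthogonal_def)
    then have be: "b \<bullet> (G *v e) = 0" if "b \<in> B" for b
      using that bilinear_form_symmetric[OF sym] by metis
    have ee: "e \<bullet> (G *v e) = 1"
      using \<open>n > 0\<close> by (simp add: e_def n_def[symmetric] matrix_vector_mult_scaleR field_simps)
    have "e \<notin> B"
      using eb ee by force
    have "orth (insert e B)"
      using B(1) ee eb be \<open>e \<notin> B\<close> by (auto simp: orth_def)
    moreover have "card (insert e B) = Suc k"
      using B \<open>e \<notin> B\<close> by (simp add: orth_def)
    ultimately show ?case
      by blast
  qed
  then obtain B where B: "orth B" "card B = CARD('n)"
    by blast
  then obtain f where f: "bij_betw f (UNIV :: 'n set) B"
    using bij_betw_iff_card[of "UNIV :: 'n set" B] by (auto simp: orth_def)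
  define A :: "real ^ 'n ^ 'n" where "A = (\<chi> i j. f j $ i)"
  define S where "S = transpose A ** G"
  have "f i \<bullet> (G *v f j) = (if i = j then 1 else 0)" for i j
    using B(1) f by (auto simp: orth_def bij_betw_def inj_on_eq_iff)
  moreover have "(S ** A) $ i $ j = f i \<bullet> (G *v f j)" for i j
    unfolding S_def matrix_mul_assoc[symmetric]
    by (simp add: A_def matrix_matrix_mult_def matrix_vector_mult_def transpose_def inner_vec_def)
  ultimately have "S ** A = mat 1"
    by (simp add: vec_eq_iff mat_def)
  then have "A ** S = mat 1"
    by (rule matrix_left_right_inverse[THEN iffD1])
  then have "transpose S ** S = G"
    by (simp add: S_def matrix_transpose_mul sym matrix_mul_assoc[symmetric])
  then show ?thesis
    using that by blast
qed

lemma norm_Gram: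
  fixes S :: "real ^ 'n ^ 'm"
  shows "(norm (S *v v))\<^sup>2 = v \<bullet> ((transpose S ** S) *v v)"
proof -
  have "v \<bullet> (transpose S *v (S *v v)) = (S *v v) \<bullet> (S *v v)"
    by (metis dot_lmul_matrix inner_commute transpose_matrix_vector transpose_transpose)
  then show ?thesis
    by (simp add: matrix_vector_mul_assoc power2_norm_eq_inner)
qed

text \<open>Change of variables for a constant derivative; it lets determinants be compared through
  inclusions of balls.\<close>

lemma abs_det_times_unit_ball:
  fixes L :: "real ^ 'n ^ 'n"
  assumes "inj ((*v) L)"
  shows "ennreal \<bar>det L\<bar> * emeasure lborel (ball (0::real ^ 'n) 1) = emeasure lborel ((*v) L ` ball 0 1)"
proof -
  have "open ((*v) L ` ball 0 1)"
    using assms by (intro open_surjective_linear_image) (auto simp: linear_injective_imp_surjective)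
  moreover have "bounded ((*v) L ` ball 0 1)"
    by (intro bounded_linear_image) (auto simp: matrix_vector_mul_bounded_linear)
  moreover have "((*v) L has_derivative (*v) L) (at x)" for x
    by (intro bounded_linear_imp_has_derivative) (simp add: matrix_vector_mul_bounded_linear)
  ultimately have "(\<integral>\<^sup>+x\<in>ball (0 :: real ^ 'n) 1. ennreal \<bar>det (matrix ((*v) L))\<bar> \<partial>lborel) = emeasure lborel ((*v) L ` ball 0 1)"
    using nn_integral_abs_det_image[of "ball 0 1" "(*v) L" "\<lambda>_. (*v) L"]
      inj_on_subset[OF assms subset_UNIV, of "ball 0 1"] by simp
  then show ?thesis
    by (simp add: nn_integral_cmult_indicator)
qed

text \<open>Write \<open>T = L ** S\<close> with \<open>transpose S ** S = G\<close>, so that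
  \<open>\<bar>det S\<bar> = sqrt (det G)\<close>. Then \<open>L\<close> distorts Euclidean length
  by factors between \<open>sqrt lo\<close> and \<open>sqrt hi\<close>, the image of the unit ball
  lies between balls of these radii, and comparing volumes bounds
  \<open>\<bar>det L\<bar>\<close>.\<close>

lemma sqrt_det_comparison:
  fixes G T :: "real ^ 'n::finite ^ 'n"
  assumes sym: "transpose G = G" and pos: "\<And>v. v \<noteq> 0 \<Longrightarrow> 0 < v \<bullet> (G *v v)"
    and "0 < lo"
    and lo: "\<And>v. lo * (v \<bullet> (G *v v)) \<le> (norm (T *v v))\<^sup>2"
    and hi: "\<And>v. (norm (T *v v))\<^sup>2 \<le> hi * (v \<bullet> (G *v v))"
  shows "sqrt lo ^ CARD('n) * sqrt (det G) \<le> \<bar>det T\<bar>"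
    and "\<bar>det T\<bar> \<le> sqrt hi ^ CARD('n) * sqrt (det G)"
    and "0 < det G"
proof -
  obtain S :: "real ^ 'n ^ 'n" where S: "transpose S ** S = G"
    by (rule posdef_imp_Gram[OF sym pos])
  have detG: "det G = (det S)\<^sup>2"
    unfolding S[symmetric] by (simp add: det_mul power2_eq_square)
  have "S *v v \<noteq> 0" if "v \<noteq> 0" for v
    using pos[OF that] norm_Gram[of S v] by (auto simp: S)
  then have "inj ((*v) S)"
    using linear_injective_0[of "(*v) S"] by auto
  then obtain R where R: "R ** S = mat 1"
    using matrix_left_invertible_injective[of S] by auto
  then have R': "S ** R = mat 1"
    by (rule matrix_left_right_inverse[THEN iffD1])
  have "det S \<noteq> 0"
    using R by (metis det_I det_mul mult_zero_right zero_neq_one)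
  then show "0 < det G"
    by (simp add: detG)
  define L where "L = T ** R"
  have Lv: "lo * (norm v)\<^sup>2 \<le> (norm (L *v v))\<^sup>2" "(norm (L *v v))\<^sup>2 \<le> hi * (norm v)\<^sup>2" for v
  proof -
    have "(R *v v) \<bullet> (G *v (R *v v)) = (norm v)\<^sup>2"
      using norm_Gram[of S "R *v v"] R' by (simp add: S matrix_vector_mul_assoc)
    then show "lo * (norm v)\<^sup>2 \<le> (norm (L *v v))\<^sup>2" "(norm (L *v v))\<^sup>2 \<le> hi * (norm v)\<^sup>2"
      using lo[of "R *v v"] hi[of "R *v v"] by (simp_all add: L_def matrix_vector_mul_assoc[symmetric])
  qed
  \<comment> \<open>Positivity passes from \<open>lo\<close> to \<open>hi\<close> by testing both
    bounds on one unit vector.\<close>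
  have "hi > 0"
  proof -
    have "lo * (norm (axis undefined 1 :: real ^ 'n))\<^sup>2 \<le> hi * (norm (axis undefined 1 :: real ^ 'n))\<^sup>2"
      using Lv by (rule order_trans)
    then show ?thesis
      using \<open>0 < lo\<close> by simp
  qed
  have lower: "sqrt lo * norm v \<le> norm (L *v v)" and upper: "norm (L *v v) \<le> sqrt hi * norm v" for v
  proof -
    have eq: "(sqrt c * norm v)\<^sup>2 = c * (norm v)\<^sup>2" if "0 < c" for c
      using that by (simp add: power_mult_distrib)
    show "sqrt lo * norm v \<le> norm (L *v v)"
      by (rule power2_le_imp_le) (use Lv(1)[of v] eq[OF \<open>0 < lo\<close>] in auto)
    show "norm (L *v v) \<le> sqrt hi * norm v"
      by (rule power2_le_imp_le) (use Lv(2)[of v] eq[OF \<open>0 < hi\<close>] \<open>0 < hi\<close> in auto)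
  qed
  have injL: "inj ((*v) L)"
  proof -
    have "v = 0" if "L *v v = 0" for v
      using lower[of v] that \<open>0 < lo\<close> by (auto simp: mult_le_0_iff)
    then show ?thesis
      using linear_injective_0[of "(*v) L"] by auto
  qed
  let ?\<omega> = "emeasure lborel (ball (0::real ^ 'n) 1)"
  have \<omega>: "0 < ?\<omega>" "?\<omega> < \<infinity>"
    using emeasure_lborel_ball_finite[of "0::real ^ 'n" 1] by (auto simp: emeasure_ball)
  have ball: "emeasure lborel (ball (0::real ^ 'n) s) = ennreal (s ^ CARD('n)) * ?\<omega>" if "0 \<le> s" for s
    using emeasure_lebesgue_ball_conv_unit_ball[of s "0::real ^ 'n"] that by simp
  have "open ((*v) L ` ball 0 1)"
    using injL by (intro open_surjective_linear_image) (auto simp: linear_injective_imp_surjective)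
  then have meas: "(*v) L ` ball 0 1 \<in> sets lborel"
    by simp
  have "(*v) L ` ball 0 1 \<subseteq> ball 0 (sqrt hi)"
  proof clarify
    fix v :: "real ^ 'n" assume "v \<in> ball 0 1"
    then have "norm v < 1" by simp
    then have "sqrt hi * norm v < sqrt hi"
      using \<open>0 < hi\<close> mult_strict_left_mono[of "norm v" 1 "sqrt hi"] by simp
    then show "L *v v \<in> ball 0 (sqrt hi)"
      using upper[of v] by simp
  qed
  then have "emeasure lborel ((*v) L ` ball 0 1) \<le> emeasure lborel (ball (0::real ^ 'n) (sqrt hi))"
    by (rule emeasure_mono) simp
  then have "ennreal \<bar>det L\<bar> * ?\<omega> \<le> ennreal (sqrt hi ^ CARD('n)) * ?\<omega>"
    using abs_det_times_unit_ball[OF injL] ball[of "sqrt hi"] \<open>0 < hi\<close> by simp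
  then have detL_hi: "\<bar>det L\<bar> \<le> sqrt hi ^ CARD('n)"
    using \<omega> \<open>0 < hi\<close> by (simp add: ennreal_mult_le_mult_iff mult.commute[of _ ?\<omega>] ennreal_le_iff)
  have "ball 0 (sqrt lo) \<subseteq> (*v) L ` ball 0 1"
  proof
    fix w :: "real ^ 'n" assume w: "w \<in> ball 0 (sqrt lo)"
    obtain v where v: "w = L *v v"
      using injL linear_injective_imp_surjective[of "(*v) L"] by (auto simp: surj_def)
    have "sqrt lo * norm v < sqrt lo"
      using w lower[of v] v by simp
    then have "norm v < 1"
      using \<open>0 < lo\<close> by simp
    then show "w \<in> (*v) L ` ball 0 1"
      using v by auto
  qed
  then have "emeasure lborel (ball (0::real ^ 'n) (sqrt lo)) \<le> emeasure lborel ((*v) L ` ball 0 1)"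
    using meas by (rule emeasure_mono)
  then have "ennreal (sqrt lo ^ CARD('n)) * ?\<omega> \<le> ennreal \<bar>det L\<bar> * ?\<omega>"
    using abs_det_times_unit_ball[OF injL] ball[of "sqrt lo"] \<open>0 < lo\<close> by simp
  then have detL_lo: "sqrt lo ^ CARD('n) \<le> \<bar>det L\<bar>"
    using \<omega> \<open>0 < lo\<close> by (simp add: ennreal_mult_le_mult_iff mult.commute[of _ ?\<omega>] ennreal_le_iff)
  have "T = L ** S"
    by (simp add: L_def R matrix_mul_assoc[symmetric])
  then have detT: "\<bar>det T\<bar> = \<bar>det L\<bar> * sqrt (det G)"
    by (simp add: det_mul abs_mult detG)
  show "sqrt lo ^ CARD('n) * sqrt (det G) \<le> \<bar>det T\<bar>" "\<bar>det T\<bar> \<le> sqrt hi ^ CARD('n) * sqrt (det G)"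
    unfolding detT using detL_hi detL_lo by (simp_all add: detG mult_right_mono)
qed

lemma linear_bound_Basis:
  fixes f :: "'a::euclidean_space \<Rightarrow> 'b::real_normed_vector"
  assumes "linear f" "\<And>b. b \<in> Basis \<Longrightarrow> norm (f b) \<le> M"
  shows "norm (f x) \<le> real DIM('a) * M * norm x"
proof -
  have "f x = (\<Sum>b\<in>Basis. (x \<bullet> b) *\<^sub>R f b)"
    using linear_sum[OF assms(1), of "\<lambda>b. (x \<bullet> b) *\<^sub>R b" Basis]
    by (simp add: linear_cmul[OF assms(1)] euclidean_representation)
  also have "norm \<dots> \<le> (\<Sum>b\<in>(Basis :: 'a set). norm x * M)"
    by (intro sum_norm_le) (simp, intro mult_mono assms Basis_le_norm, auto)
  finally show ?thesis
    by (simp add: mult_ac)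
qed

text \<open>\<open>Ck_on\<close> gives continuity of second derivatives one pair of directions at a
  time, so compactness yields bounds on basis vectors and linearity extends them at the cost of
  dimension factors. The derivative is then Lipschitz on \<open>K\<close>, and the mean value
  inequality along a segment gives the quadratic remainder, with one constant for all
  \<open>x\<close> and \<open>y\<close>.\<close>

lemma C2_Taylor:
  fixes g :: "'a::euclidean_space \<Rightarrow> 'b::real_normed_vector"
  assumes C2: "Ck_on 2 g \<Omega>" and "open \<Omega>" and K: "compact K" "convex K" "K \<subseteq> \<Omega>"
  obtains C where "C \<ge> 0"
    "\<And>x y. x \<in> K \<Longrightarrow> y \<in> K \<Longrightarrow>
       norm (g x - g y - frechet_derivative g (at y) (x - y)) \<le> C * (norm (x - y))\<^sup>2"
    "\<And>y v. y \<in> K \<Longrightarrow> norm (frechet_derivative g (at y) v) \<le> C * norm v"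
proof -
  define D where "D v x = frechet_derivative g (at x) v" for v x
  define E where "E v w x = frechet_derivative (D v) (at x) w" for v w x
  have g: "(g has_derivative (\<lambda>v. D v x)) (at x)" if "x \<in> \<Omega>" for x
    using C2 that by (auto simp: numeral_2_eq_2 D_def frechet_derivative_works[symmetric])
  have D: "(D v has_derivative (\<lambda>w. E v w x)) (at x)" if "x \<in> \<Omega>" for v x
    using C2 that by (auto simp: numeral_2_eq_2 E_def D_def[abs_def] frechet_derivative_works[symmetric])
  have E: "continuous_on \<Omega> (E v w)" for v w
    using C2 by (auto simp: numeral_2_eq_2 E_def[abs_def] D_def[abs_def])
  have bound: "\<exists>M\<ge>0. \<forall>i\<in>I. \<forall>x\<in>K. norm (f i x) \<le> M"
    if "finite I" "\<And>i. i \<in> I \<Longrightarrow> continuous_on K (f i)" for I :: "'c set" and f :: "_ \<Rightarrow> 'a \<Rightarrow> 'b"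
  proof -
    have "compact (\<Union>i\<in>I. f i ` K)"
      using that K by (intro compact_UN compact_continuous_image) auto
    then obtain M where "\<forall>z\<in>(\<Union>i\<in>I. f i ` K). norm z \<le> M"
      using compact_imp_bounded bounded_iff by blast
    then show ?thesis
      by (intro exI[of _ "max M 0"]) fastforce
  qed
  obtain M1 where M1: "M1 \<ge> 0" "\<And>v x. v \<in> Basis \<Longrightarrow> x \<in> K \<Longrightarrow> norm (D v x) \<le> M1"
  proof -
    have "continuous_on K (D v)" for v
      using D K(3) by (meson continuous_at_imp_continuous_on has_derivative_continuous subsetD)
    then show ?thesis
      using bound[of Basis D] that by auto
  qed
  obtain M2 where M2: "M2 \<ge> 0" "\<And>v w x. v \<in> Basis \<Longrightarrow> w \<in> Basis \<Longrightarrow> x \<in> K \<Longrightarrow> norm (E v w x) \<le> M2"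
  proof -
    have "continuous_on K (E v w)" for v w
      using E K(3) continuous_on_subset by blast
    then show ?thesis
      using bound[of "Basis \<times> Basis" "\<lambda>(v, w). E v w"] that by auto
  qed
  define n where "n = real DIM('a)"
  have linD: "linear (\<lambda>v. D v x)" if "x \<in> \<Omega>" for x
    using g[OF that] has_derivative_linear by blast
  have Lip: "norm (D h x - D h y) \<le> n * (n * M2 * norm (x - y)) * norm h"
    if "x \<in> K" "y \<in> K" for h x y
    unfolding n_def
  proof (rule linear_bound_Basis)
    show "linear (\<lambda>h. D h x - D h y)"
      using linD[of x] linD[of y] that K(3) by (intro linear_compose_sub) auto
    fix b :: 'a assume b: "b \<in> Basis"
    show "norm (D b x - D b y) \<le> real DIM('a) * M2 * norm (x - y)"
    proof (rule differentiable_bound[OF K(2) _ _ that])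
      show "(D b has_derivative (\<lambda>w. E b w z)) (at z within K)" if "z \<in> K" for z
        using D that K(3) has_derivative_at_withinI by blast
      show "onorm (\<lambda>w. E b w z) \<le> real DIM('a) * M2" if "z \<in> K" for z
      proof (rule onorm_le)
        have "linear (\<lambda>w. E b w z)"
          using D[of z b] that K(3) has_derivative_linear by blast
        then show "norm (E b w z) \<le> real DIM('a) * M2 * norm w" for w
          using linear_bound_Basis[of "\<lambda>w. E b w z" M2] M2(2) b that by auto
      qed
    qed
  qed
  \<comment> \<open>The first entry serves the bound on the derivative, the second the
    remainder.\<close>
  define C where "C = max (n * M1) (n * n * M2)"
  show ?thesis
  proof
    show "C \<ge> 0"
      using M1(1) by (simp add: C_def n_def le_max_iff_disj)
    show "norm (frechet_derivative g (at y) v) \<le> C * norm v" if "y \<in> K" for y v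
    proof -
      have "norm (D v y) \<le> n * M1 * norm v"
        unfolding n_def using linD M1(2) that K(3) by (intro linear_bound_Basis) auto
      also have "\<dots> \<le> C * norm v"
        by (intro mult_right_mono) (auto simp: C_def)
      finally show ?thesis
        by (simp add: D_def)
    qed
    fix x y assume xy: "x \<in> K" "y \<in> K"
    have seg: "y + t *\<^sub>R (x - y) \<in> K" if "t \<in> {0..1}" for t
    proof -
      have "(1 - t) *\<^sub>R y + t *\<^sub>R x \<in> K"
        using that xy K(2) by (intro convexD) auto
      then show ?thesis
        by (simp add: algebra_simps)
    qed
    have "norm (g x - g y - D (x - y) y) \<le> norm (x - y) * (n * n * M2 * norm (x - y))"
    proof (rule differentiable_bound_linearization[where S = "closed_segment y x" and f' = "\<lambda>z v. D v z"])
      show "y + t *\<^sub>R (x - y) \<in> closed_segment y x" if "t \<in> {0..1}" for t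
        using that by (auto simp: in_segment algebra_simps intro!: exI[of _ t])
      have sub: "closed_segment y x \<subseteq> K"
        using xy K(2) closed_segment_subset by blast
      then show "(g has_derivative (\<lambda>v. D v z)) (at z within closed_segment y x)" if "z \<in> closed_segment y x" for z
        using g that K(3) has_derivative_at_withinI by blast
      show "onorm ((\<lambda>v. D v z) - (\<lambda>v. D v y)) \<le> n * n * M2 * norm (x - y)" if "z \<in> closed_segment y x" for z
      proof (rule onorm_le)
        fix h
        have "norm (D h z - D h y) \<le> n * (n * M2 * norm (z - y)) * norm h"
          using Lip sub that xy by auto
        also have "\<dots> \<le> n * (n * M2 * norm (x - y)) * norm h"
          using segment_bound1[OF that] M2(1) by (intro mult_mono mult_left_mono) (auto simp: n_def)
        finally show "norm (((\<lambda>v. D v z) - (\<lambda>v. D v y)) h) \<le> n * n * M2 * norm (x - y) * norm h"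
          by (simp add: mult_ac)
      qed
    qed auto
    also have "\<dots> \<le> C * (norm (x - y))\<^sup>2"
    proof -
      have "n * n * M2 * (norm (x - y))\<^sup>2 \<le> C * (norm (x - y))\<^sup>2"
        by (intro mult_right_mono) (auto simp: C_def)
      then show ?thesis
        by (simp add: power2_eq_square mult_ac)
    qed
    finally show "norm (g x - g y - frechet_derivative g (at y) (x - y)) \<le> C * (norm (x - y))\<^sup>2"
      by (simp add: D_def)
  qed
qed

text \<open>The form attains a positive minimum on the compact set of pairs of a point of
  \<open>K\<close> and a unit vector; homogeneity of degree two does the rest.\<close>

lemma posdef_lower_bound:
  fixes g :: "real ^ 'n \<Rightarrow> real ^ 'n ^ 'n"
  assumes "compact K" "continuous_on K g"
    and pos: "\<And>x v. x \<in> K \<Longrightarrow> v \<noteq> 0 \<Longrightarrow> 0 < v \<bullet> (g x *v v)"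
  obtains a where "0 < a"
    "\<And>x v. x \<in> K \<Longrightarrow> a * (norm v)\<^sup>2 \<le> v \<bullet> (g x *v v)"
proof (cases "K = {}")
  case True
  then show ?thesis using that[of 1] by auto
next
  case False
  define q where "q = (\<lambda>(x, v). v \<bullet> (g x *v v))"
  define Z where "Z = K \<times> sphere (0 :: real ^ 'n) 1"
  have "compact Z"
    unfolding Z_def using assms(1) by (intro compact_Times) auto
  have "axis undefined 1 \<in> sphere (0 :: real ^ 'n) 1"
    by simp
  then have "Z \<noteq> {}"
    using False by (auto simp: Z_def)
  have "continuous_on Z q"
  proof -
    have "continuous_on Z (\<lambda>z. g (fst z))"
      by (rule continuous_on_compose2[OF assms(2)]) (auto simp: Z_def intro!: continuous_intros)
    then show ?thesis
      unfolding q_def split_beta inner_vec_def matrix_vector_mult_def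
      by (auto intro!: continuous_intros)
  qed
  then obtain zmin where z: "zmin \<in> Z" "\<And>z. z \<in> Z \<Longrightarrow> q zmin \<le> q z"
    using continuous_attains_inf[OF \<open>compact Z\<close> \<open>Z \<noteq> {}\<close>] by metis
  have "q z > 0" if "z \<in> Z" for z
    using that pos[of "fst z" "snd z"] by (fastforce simp: q_def Z_def)
  then have "q zmin > 0"
    using z by auto
  moreover have "q zmin * (norm v)\<^sup>2 \<le> v \<bullet> (g x *v v)"
    if "x \<in> K" for x v
  proof (cases "v = 0")
    case False
    have "(x, v /\<^sub>R norm v) \<in> Z"
      using that False by (simp add: Z_def)
    then have "q zmin \<le> q (x, v /\<^sub>R norm v)"
      using z by auto
    moreover have "q (x, v /\<^sub>R norm v) = (v \<bullet> (g x *v v)) / (norm v)\<^sup>2"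
      by (simp add: q_def matrix_vector_mult_scaleR power2_eq_square divide_inverse)
    ultimately show ?thesis
      using False by (simp add: pos_le_divide_eq)
  qed simp
  ultimately show ?thesis
    using that by blast
qed

section \<open>Almost isometric coordinates\<close>

text \<open>\<open>\<Gamma>\<close> below is the Christoffel form of the first kind; all that matters is
  \<open>2 v \<bullet> \<Gamma> w v = v \<bullet> (D w *v v)\<close>, which cancels the first order variation of the metric.\<close>

lemma normal_coordinates_algebra:
  fixes G :: "real ^ 'n ^ 'n" and D :: "real ^ 'n \<Rightarrow> real ^ 'n ^ 'n" and a C :: real
  assumes sym: "transpose G = G" and "0 < a" and a: "\<And>v. a * (norm v)\<^sup>2 \<le> v \<bullet> (G *v v)"
    and D: "linear D" "\<And>v. transpose (D v) = D v" "\<And>v. norm (D v) \<le> C * norm v"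
  obtains S R :: "real ^ 'n ^ 'n" and N :: "real ^ 'n \<Rightarrow> real ^ 'n \<Rightarrow> real ^ 'n"
  where "R ** S = mat 1" "S ** R = mat 1" "bounded_bilinear N" "\<And>w v. N w v = N v w"
    "\<And>w v. norm (N w v) \<le> 2 * real CARD('n) * C / sqrt a * norm w * norm v"
    "\<And>w v. (norm (S *v v + N w v))\<^sup>2 = v \<bullet> (G *v v) + v \<bullet> (D w *v v) + (norm (N w v))\<^sup>2"
    "\<And>u. sqrt a * norm u \<le> norm (S *v u)" "\<And>u. sqrt a * norm (R *v u) \<le> norm u"
proof -
  have pos: "0 < v \<bullet> (G *v v)" if "v \<noteq> 0" for v
    using a[of v] that \<open>0 < a\<close> by (smt (verit) mult_pos_pos zero_less_norm_iff zero_less_power)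
  obtain S :: "real ^ 'n ^ 'n" where S: "transpose S ** S = G"
    by (rule posdef_imp_Gram[OF sym pos])
  have Sv: "(norm (S *v v))\<^sup>2 = v \<bullet> (G *v v)" for v
    using norm_Gram[of S v] by (simp add: S)
  have lower: "sqrt a * norm u \<le> norm (S *v u)" for u
  proof (rule power2_le_imp_le)
    show "(sqrt a * norm u)\<^sup>2 \<le> (norm (S *v u))\<^sup>2"
      unfolding Sv power_mult_distrib using a[of u] \<open>0 < a\<close> by simp
  qed simp
  have "u = 0" if "S *v u = 0" for u
    using lower[of u] that \<open>0 < a\<close> by (simp add: mult_le_0_iff)
  then have "inj ((*v) S)"
    using linear_injective_0[of "(*v) S"] by auto
  then obtain R where R: "R ** S = mat 1"
    using matrix_left_invertible_injective[of S] by auto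
  then have R': "S ** R = mat 1"
    by (rule matrix_left_right_inverse[THEN iffD1])
  have Ru: "sqrt a * norm (R *v u) \<le> norm u" for u
    using lower[of "R *v u"] by (simp add: matrix_vector_mul_assoc R')
  \<comment> \<open>The adjoint inherits the bound on \<open>R\<close>: write
    \<open>(norm ?t)^2\<close> as \<open>u \<bullet> (R *v ?t)\<close> and cancel one factor
    \<open>norm ?t\<close>.\<close>
  have RTu: "sqrt a * norm (transpose R *v u) \<le> norm u" for u
  proof -
    let ?t = "transpose R *v u"
    have "(norm ?t)\<^sup>2 = u \<bullet> (R *v ?t)"
      by (metis dot_lmul_matrix power2_norm_eq_inner transpose_matrix_vector)
    also have "\<dots> \<le> norm u * norm (R *v ?t)"
      by (rule norm_cauchy_schwarz)
    finally have "sqrt a * (norm ?t)\<^sup>2 \<le> sqrt a * (norm u * norm (R *v ?t))"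
      using \<open>0 < a\<close> by (intro mult_left_mono) auto
    also have "\<dots> = norm u * (sqrt a * norm (R *v ?t))"
      by simp
    also have "\<dots> \<le> norm u * norm ?t"
      using Ru by (intro mult_left_mono) auto
    finally have "(sqrt a * norm ?t) * norm ?t \<le> norm u * norm ?t"
      by (simp add: power2_eq_square mult_ac)
    then show ?thesis
      by (cases "?t = 0") (auto dest: mult_right_le_imp_le)
  qed
  note D_simps = linear_add[OF D(1)] linear_cmul[OF D(1)]
  define \<Gamma> :: "real ^ 'n \<Rightarrow> real ^ 'n \<Rightarrow> real ^ 'n" where "\<Gamma> w v = (\<chi> k. (v \<bullet> (D w *v axis k 1) + w \<bullet> (D v *v axis k 1)
      - v \<bullet> (D (axis k 1) *v w)) / 2)" for w v
  have "C \<ge> 0"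
    using order_trans[OF norm_ge_zero D(3)[of "axis undefined 1"]] by simp
  have \<Gamma>_sym: "\<Gamma> w v = \<Gamma> v w" for w v
    unfolding \<Gamma>_def vec_eq_iff
    using bilinear_form_symmetric[OF D(2)] by (simp add: add.commute)
  have \<Gamma>_lin: "linear (\<Gamma> w)" for w
    by (rule linearI) (simp_all add: \<Gamma>_def vec_eq_iff D_simps inner_add_left inner_add_right
        matrix_vector_mult_add_rdistrib scaleR_matrix_vector_assoc[symmetric] field_simps)
  have \<Gamma>_lin': "linear (\<lambda>w. \<Gamma> w v)" for v
    using \<Gamma>_lin[of v] by (subst \<Gamma>_sym)
  \<comment> \<open>The factor \<open>transpose R\<close> is chosen because
    \<open>R ** S = mat 1\<close> makes the inner product of \<open>S *v v\<close> with
    \<open>N w v\<close> equal to \<open>v \<bullet> \<Gamma> w v\<close>.\<close>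
  define N where "N w v = transpose R *v \<Gamma> w v" for w v
  have "bilinear N"
    unfolding bilinear_def N_def
    using linear_compose[OF \<Gamma>_lin matrix_vector_mul_linear[of "transpose R"]]
      linear_compose[OF \<Gamma>_lin' matrix_vector_mul_linear[of "transpose R"]]
    by (simp add: o_def)
  then have "bounded_bilinear N"
    by (simp add: bilinear_conv_bounded_bilinear)
  \<comment> \<open>When \<open>\<Gamma> w v\<close> is paired with \<open>v\<close> itself, the
    last two of the three Christoffel terms cancel, because \<open>D v\<close> is symmetric.\<close>
  have \<Gamma>_diag: "2 * (v \<bullet> \<Gamma> w v) = v \<bullet> (D w *v v)" for v w
  proof -
    have e: "u = (\<Sum>k\<in>UNIV. u $ k *\<^sub>R axis k 1)" for u :: "real ^ 'n"
      using basis_expansion[of u] by (simp add: scalar_mult_eq_scaleR)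
    have s1: "x \<bullet> (B *v v) = (\<Sum>k\<in>UNIV. v $ k * (x \<bullet> (B *v axis k 1)))" for x :: "real ^ 'n" and B :: "real ^ 'n ^ 'n"
    proof -
      have "B *v v = (\<Sum>k\<in>UNIV. v $ k *\<^sub>R (B *v axis k 1))"
        by (subst e) (simp add: linear_sum[OF matrix_vector_mul_linear] matrix_vector_mult_scaleR)
      then show ?thesis
        by (simp add: inner_sum_right)
    qed
    have s2: "v \<bullet> (D v *v w) = (\<Sum>k\<in>UNIV. v $ k * (v \<bullet> (D (axis k 1) *v w)))"
    proof -
      have lin: "linear (\<lambda>u. v \<bullet> (D u *v w))"
        by (rule linearI) (simp_all add: D_simps inner_add_right matrix_vector_mult_add_rdistrib
            scaleR_matrix_vector_assoc[symmetric])
      then have "v \<bullet> (D (\<Sum>k\<in>UNIV. v $ k *\<^sub>R axis k 1) *v w) = (\<Sum>k\<in>UNIV. v $ k *\<^sub>R (v \<bullet> (D (axis k 1) *v w)))"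
        by (subst linear_sum[OF lin]) (simp add: linear_cmul[OF lin])
      then show ?thesis
        using e[of v] by simp
    qed
    have "2 * (v \<bullet> \<Gamma> w v) = (\<Sum>k\<in>UNIV. v $ k * (v \<bullet> (D w *v axis k 1)) + v $ k * (w \<bullet> (D v *v axis k 1))
        - v $ k * (v \<bullet> (D (axis k 1) *v w)))"
      unfolding \<Gamma>_def inner_vec_def[of v "vec_lambda _"] sum_distrib_left
      by (intro sum.cong) (auto simp: field_simps)
    also have "\<dots> = v \<bullet> (D w *v v) + w \<bullet> (D v *v v) - v \<bullet> (D v *v w)"
      by (simp add: sum.distrib sum_subtractf s1[symmetric] s2[symmetric])
    also have "w \<bullet> (D v *v v) = v \<bullet> (D v *v w)"
      by (rule bilinear_form_symmetric[OF D(2)])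
    finally show ?thesis
      by simp
  qed
  have \<Gamma>_bound: "norm (\<Gamma> w v) \<le> 2 * real CARD('n) * C * norm w * norm v" for w v
  proof -
    have b: "\<bar>x \<bullet> (D y *v z)\<bar> \<le> C * norm x * norm y * norm z" for x y z
    proof -
      have "\<bar>x \<bullet> (D y *v z)\<bar> \<le> norm (D y) * norm x * norm z"
        by (rule abs_bilinear_form_le)
      also have "\<dots> \<le> C * norm y * norm x * norm z"
        using D(3) by (intro mult_right_mono) auto
      finally show ?thesis
        by (simp add: mult_ac)
    qed
    have "\<bar>\<Gamma> w v $ k\<bar> \<le> 2 * C * norm w * norm v" for k
    proof -
      have "\<bar>v \<bullet> (D w *v axis k 1) + w \<bullet> (D v *v axis k 1) - v \<bullet> (D (axis k 1) *v w)\<bar>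
          \<le> \<bar>v \<bullet> (D w *v axis k 1)\<bar> + \<bar>w \<bullet> (D v *v axis k 1)\<bar> + \<bar>v \<bullet> (D (axis k 1) *v w)\<bar>"
        by arith
      also have "\<dots> \<le> C * norm w * norm v + C * norm w * norm v + C * norm w * norm v"
        using b[of v w "axis k 1"] b[of w v "axis k 1"] b[of v "axis k 1" w] by (simp add: mult_ac)
      \<comment> \<open>Three terms, halved in \<open>\<Gamma>\<close>, give 3/2, which is rounded
        up to 2.\<close>
      also have "\<dots> \<le> 2 * (2 * C * norm w * norm v)"
        using \<open>C \<ge> 0\<close> by simp
      finally show ?thesis
        by (simp add: \<Gamma>_def)
    qed
    then have "(\<Sum>k\<in>UNIV. \<bar>\<Gamma> w v $ k\<bar>) \<le> (\<Sum>k\<in>(UNIV :: 'n set). 2 * C * norm w * norm v)"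
      by (intro sum_mono)
    then show ?thesis
      using norm_le_l1_cart[of "\<Gamma> w v"] by (simp add: mult_ac)
  qed
  have "norm (N w v) \<le> 2 * real CARD('n) * C / sqrt a * norm w * norm v" for w v
  proof -
    have "sqrt a * norm (N w v) \<le> 2 * real CARD('n) * C * norm w * norm v"
      using RTu[of "\<Gamma> w v"] \<Gamma>_bound[of w v] by (simp add: N_def)
    then show ?thesis
      using \<open>0 < a\<close> by (simp add: field_simps)
  qed
  note N_bound = this
  have N_sum: "(norm (S *v v + N w v))\<^sup>2 = v \<bullet> (G *v v) + v \<bullet> (D w *v v) + (norm (N w v))\<^sup>2" for w v
  proof -
    have "(S *v v) \<bullet> N w v = (R *v (S *v v)) \<bullet> \<Gamma> w v"
      unfolding N_def by (metis dot_lmul_matrix inner_commute transpose_matrix_vector)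
    also have "\<dots> = v \<bullet> \<Gamma> w v"
      by (simp add: matrix_vector_mul_assoc R)
    finally show ?thesis
      using \<Gamma>_diag[of v w] by (simp add: power2_norm_eq_inner inner_add_left inner_add_right
          inner_commute[of "N w v" "S *v v"] Sv[unfolded power2_norm_eq_inner])
  qed
  have N_sym: "N w v = N v w" for w v
    by (simp add: N_def \<Gamma>_sym[of w v])
  show ?thesis
    by (rule that[OF R R' \<open>bounded_bilinear N\<close> N_sym N_bound N_sum lower Ru])
qed

text \<open>Infinitesimally \<open>P\<close> is an isometry from \<open>g\<close> to the Euclidean
  metric up to a relative error \<open>\<kappa> * (norm (x - y))^2\<close>, with no linear term. The
  constants are arguments because all centres \<open>y\<close> have to share them. The last two
  clauses are injectivity and surjectivity in quantitative form.\<close>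

definition almost_isometric_chart ::
  "(real ^ 'n \<Rightarrow> real ^ 'n ^ 'n) \<Rightarrow> real ^ 'n \<Rightarrow> real \<Rightarrow> real \<Rightarrow> real \<Rightarrow>
    (real ^ 'n \<Rightarrow> real ^ 'n) \<Rightarrow> (real ^ 'n \<Rightarrow> real ^ 'n \<Rightarrow> real ^ 'n) \<Rightarrow> bool"
where
  "almost_isometric_chart g y \<rho> \<kappa> \<sigma> P P' \<longleftrightarrow>
     P y = 0 \<and>
     (\<forall>x\<in>ball y \<rho>. (P has_derivative P' x) (at x)) \<and>
     (\<forall>v. continuous_on (ball y \<rho>) (\<lambda>x. P' x v)) \<and>
     (\<forall>x\<in>ball y \<rho>. \<forall>v. (1 - \<kappa> * (norm (x - y))\<^sup>2) * (v \<bullet> (g x *v v)) \<le> (norm (P' x v))\<^sup>2 \<and>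
        (norm (P' x v))\<^sup>2 \<le> (1 + \<kappa> * (norm (x - y))\<^sup>2) * (v \<bullet> (g x *v v))) \<and>
     (\<forall>x\<in>ball y \<rho>. \<forall>z\<in>ball y \<rho>. \<sigma> * norm (x - z) \<le> norm (P x - P z)) \<and>
     ball 0 (\<sigma> * \<rho> / 2) \<subseteq> P ` ball y \<rho>"

lemma bounded_linear_transpose: "bounded_linear (transpose :: real ^ 'n ^ 'm \<Rightarrow> _)"
  unfolding linear_conv_bounded_linear[symmetric]
  by (rule linearI) (simp_all add: transpose_def vec_eq_iff)

text \<open>The first-order term cancels exactly: \<open>(norm (P' x v))^2\<close> differs from
  \<open>v \<bullet> (g x *v v)\<close> only by the Taylor remainder of \<open>g\<close> and by
  \<open>(norm (N w v))^2\<close>, both quadratic in \<open>w = x - y\<close>. The bounds on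
  \<open>K\<close> do not depend on \<open>y\<close>, so one radius and one set of constants serve
  all centres.\<close>

lemma almost_isometric_charts:
  fixes g :: "real ^ 'n \<Rightarrow> real ^ 'n ^ 'n"
  assumes C2: "Ck_on 2 g \<Omega>" and "open \<Omega>" "x0 \<in> \<Omega>"
    and sym: "\<And>x. x \<in> \<Omega> \<Longrightarrow> transpose (g x) = g x"
    and pos: "\<And>x v. x \<in> \<Omega> \<Longrightarrow> v \<noteq> 0 \<Longrightarrow> 0 < v \<bullet> (g x *v v)"
  obtains \<rho> \<kappa> a where "0 < \<rho>" "0 \<le> \<kappa>" "0 < a" "cball x0 (2 * \<rho>) \<subseteq> \<Omega>" "\<kappa> * \<rho>\<^sup>2 \<le> 1 / 2"
    "\<And>x v. x \<in> cball x0 (2 * \<rho>) \<Longrightarrow> a * (norm v)\<^sup>2 \<le> v \<bullet> (g x *v v)"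
    "\<And>y. y \<in> cball x0 \<rho> \<Longrightarrow> \<exists>P P'. almost_isometric_chart g y \<rho> \<kappa> (sqrt a / 2) P P'"
proof -
  obtain e where "e > 0" "cball x0 e \<subseteq> \<Omega>"
    using \<open>open \<Omega>\<close> \<open>x0 \<in> \<Omega>\<close> open_contains_cball by blast
  define K where "K = cball x0 e"
  have K: "compact K" "convex K" "K \<subseteq> \<Omega>"
    using \<open>cball x0 e \<subseteq> \<Omega>\<close> by (auto simp: K_def)
  have der: "(g has_derivative frechet_derivative g (at x)) (at x)" if "x \<in> \<Omega>" for x
    using C2 that by (auto simp: numeral_2_eq_2 frechet_derivative_works[symmetric])
  have "continuous_on K g"
    using der K(3) by (meson continuous_at_imp_continuous_on has_derivative_continuous subsetD)
  have posK: "0 < v \<bullet> (g x *v v)" if "x \<in> K" "v \<noteq> 0" for x v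
    using that K(3) pos by blast
  obtain a where ab: "0 < a" "\<And>x v. x \<in> K \<Longrightarrow> a * (norm v)\<^sup>2 \<le> v \<bullet> (g x *v v)"
    by (rule posdef_lower_bound[OF K(1) \<open>continuous_on K g\<close>]) (rule posK, assumption+, rule that)
  obtain C where C: "C \<ge> 0"
      "\<And>x y. x \<in> K \<Longrightarrow> y \<in> K \<Longrightarrow>
         norm (g x - g y - frechet_derivative g (at y) (x - y)) \<le> C * (norm (x - y))\<^sup>2"
      "\<And>y v. y \<in> K \<Longrightarrow> norm (frechet_derivative g (at y) v) \<le> C * norm v"
    by (rule C2_Taylor[OF C2 \<open>open \<Omega>\<close> K]) (rule that)
  \<comment> \<open>\<open>m\<close> bounds the bilinear map \<open>N\<close>. In
    \<open>\<kappa>\<close> the Taylor constant and \<open>m^2\<close>, from the square of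
    \<open>N\<close>, are divided by \<open>a\<close> to turn an absolute error in
    \<open>(norm v)^2\<close> into one relative to the metric.\<close>
  define m where "m = 2 * real CARD('n) * C / sqrt a"
  define \<kappa> where "\<kappa> = (C + m\<^sup>2) / a"
  have "m \<ge> 0" "\<kappa> \<ge> 0"
    using C(1) ab(1) by (auto simp: m_def \<kappa>_def)
  \<comment> \<open>\<open>e / 2\<close> keeps balls around shifted centres inside \<open>K\<close>;
    the bound with \<open>m\<close> makes the quadratic part of \<open>P\<close> at most half as
    strong as its linear part; the bound with \<open>\<kappa>\<close>, together with
    \<open>\<rho> \<le> 1\<close>, gives \<open>\<kappa> * \<rho>^2 \<le> 1 / 2\<close>.\<close>
  define \<rho> where "\<rho> = min (min (e / 2) 1) (min (sqrt a / (2 * (m + 1))) (1 / (2 * (\<kappa> + 1))))"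
  have \<rho>: "\<rho> > 0" "\<rho> \<le> e / 2" "\<rho> \<le> 1"
  proof -
    show "\<rho> > 0"
      using \<open>e > 0\<close> \<open>m \<ge> 0\<close> \<open>\<kappa> \<ge> 0\<close> ab(1) by (simp add: \<rho>_def)
    show "\<rho> \<le> e / 2" "\<rho> \<le> 1"
      unfolding \<rho>_def by linarith+
  qed
  have m\<rho>: "m * \<rho> \<le> sqrt a / 2"
  proof -
    have "m * \<rho> \<le> (m + 1) * (sqrt a / (2 * (m + 1)))"
      using \<open>m \<ge> 0\<close> \<rho>(1) by (intro mult_mono) (auto simp: \<rho>_def)
    also have "\<dots> = sqrt a / 2"
      using \<open>m \<ge> 0\<close> by (simp add: field_simps)
    finally show ?thesis .
  qed
  have "\<kappa> * \<rho>\<^sup>2 \<le> 1 / 2"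
  proof -
    have "\<kappa> * \<rho>\<^sup>2 \<le> \<kappa> * \<rho>"
      using \<rho> \<open>\<kappa> \<ge> 0\<close> by (intro mult_left_mono) (auto simp: power2_eq_square mult_left_le)
    also have "\<dots> \<le> (\<kappa> + 1) * (1 / (2 * (\<kappa> + 1)))"
      using \<open>\<kappa> \<ge> 0\<close> \<rho>(1) by (intro mult_mono) (auto simp: \<rho>_def)
    also have "\<dots> = 1 / 2"
      using \<open>\<kappa> \<ge> 0\<close> by (simp add: field_simps)
    finally show ?thesis .
  qed
  have sub: "cball x0 (2 * \<rho>) \<subseteq> K"
    using \<rho> by (auto simp: K_def)
  have "\<exists>P P'. almost_isometric_chart g y \<rho> \<kappa> (sqrt a / 2) P P'" if y: "y \<in> cball x0 \<rho>" for y
  proof -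
    have ballK: "ball y \<rho> \<subseteq> K"
    proof
      fix x assume "x \<in> ball y \<rho>"
      then have "dist x0 x \<le> 2 * \<rho>"
        using y dist_triangle[of x0 x y] by simp
      then show "x \<in> K"
        using sub by auto
    qed
    then have "y \<in> K"
      using \<rho>(1) by auto
    define D where "D = frechet_derivative g (at y)"
    have "y \<in> \<Omega>"
      using \<open>y \<in> K\<close> K by auto
    have linD: "linear D"
      using der[OF \<open>y \<in> \<Omega>\<close>] has_derivative_linear by (auto simp: D_def)
    \<comment> \<open>Differentiate \<open>transpose (g x) = g x\<close> near \<open>y\<close> and
      use uniqueness of the derivative.\<close>
    have symD: "transpose (D v) = D v" for v
    proof -
      have "((\<lambda>x. transpose (g x)) has_derivative (\<lambda>v. transpose (D v))) (at y)"
        unfolding D_def by (rule bounded_linear.has_derivative[OF bounded_linear_transpose der[OF \<open>y \<in> \<Omega>\<close>]])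
      then have "(g has_derivative (\<lambda>v. transpose (D v))) (at y)"
        by (rule has_derivative_transform_within_open[OF _ \<open>open \<Omega>\<close> \<open>y \<in> \<Omega>\<close>]) (simp add: sym)
      then have "(\<lambda>v. transpose (D v)) = D"
        using der[OF \<open>y \<in> \<Omega>\<close>] has_derivative_unique unfolding D_def by blast
      then show ?thesis
        by (rule fun_cong)
    qed
    have boundD: "norm (D v) \<le> C * norm v" for v
      using C(3)[OF \<open>y \<in> K\<close>] by (simp add: D_def)
    obtain S R :: "real ^ 'n ^ 'n" and N where SRN: "R ** S = mat 1" "S ** R = mat 1" "bounded_bilinear N"
      "\<And>w v. N w v = N v w"
      "\<And>w v. norm (N w v) \<le> 2 * real CARD('n) * C / sqrt a * norm w * norm v"
      "\<And>w v. (norm (S *v v + N w v))\<^sup>2 = v \<bullet> (g y *v v) + v \<bullet> (D w *v v) + (norm (N w v))\<^sup>2"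
      "\<And>u. sqrt a * norm u \<le> norm (S *v u)" "\<And>u. sqrt a * norm (R *v u) \<le> norm u"
      by (rule normal_coordinates_algebra[OF sym[OF \<open>y \<in> \<Omega>\<close>] ab(1) ab(2)[OF \<open>y \<in> K\<close>] linD symD boundD]) (rule that)
    interpret N: bounded_bilinear N by (rule SRN(3))
    have N_le: "norm (N w v) \<le> m * norm w * norm v" for w v
      using SRN(5) by (simp add: m_def)
    define P where "P x = S *v (x - y) + (1 / 2) *\<^sub>R N (x - y) (x - y)" for x
    define P' where "P' x v = S *v v + N (x - y) v" for x v
    have derP: "(P has_derivative P' x) (at x)" for x
    proof -
      have 1: "((\<lambda>x. S *v (x - y)) has_derivative (\<lambda>v. S *v v)) (at x)"
        by (rule bounded_linear.has_derivative[OF matrix_vector_mul_bounded_linear]) (auto intro!: derivative_eq_intros)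
      have 2: "((\<lambda>x. N (x - y) (x - y)) has_derivative (\<lambda>v. N (x - y) v + N v (x - y))) (at x)"
        by (rule N.FDERIV) (auto intro!: derivative_eq_intros)
      have "(P has_derivative (\<lambda>v. S *v v + (1 / 2) *\<^sub>R (N (x - y) v + N v (x - y)))) (at x)"
        unfolding P_def by (intro has_derivative_add has_derivative_scaleR_right 1 2)
      \<comment> \<open>The two terms of the product rule agree by the symmetry of \<open>N\<close>;
        this is why \<open>P\<close> carries the factor 1/2.\<close>
      moreover have "S *v v + (1 / 2) *\<^sub>R (N (x - y) v + N v (x - y)) = P' x v" for v
        using SRN(4)[of v "x - y"] by (simp add: P'_def flip: scaleR_2)
      ultimately show ?thesis
        by simp
    qed
    have contP': "continuous_on (ball y \<rho>) (\<lambda>x. P' x v)" for v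
      unfolding P'_def by (intro continuous_intros N.continuous_on)
    have iso: "\<bar>(norm (P' x v))\<^sup>2 - v \<bullet> (g x *v v)\<bar> \<le> \<kappa> * (norm (x - y))\<^sup>2 * (v \<bullet> (g x *v v))"
      if "x \<in> ball y \<rho>" for x v
    proof -
      have "x \<in> K"
        using that ballK by blast
      define E where "E = g x - g y - D (x - y)"
      have "g x = E + (g y + D (x - y))"
        by (simp add: E_def)
      then have "v \<bullet> (g x *v v) = v \<bullet> (E *v v) + (v \<bullet> (g y *v v) + v \<bullet> (D (x - y) *v v))"
        by (simp only: matrix_vector_mult_add_rdistrib inner_add_right)
      then have "\<bar>(norm (P' x v))\<^sup>2 - v \<bullet> (g x *v v)\<bar> = \<bar>(norm (N (x - y) v))\<^sup>2 - v \<bullet> (E *v v)\<bar>"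
        using SRN(6)[of v "x - y"] by (simp add: P'_def)
      also have "\<dots> \<le> (norm (N (x - y) v))\<^sup>2 + \<bar>v \<bullet> (E *v v)\<bar>"
        using abs_triangle_ineq4[of "(norm (N (x - y) v))\<^sup>2"] by simp
      also have "\<dots> \<le> (m * norm (x - y) * norm v)\<^sup>2 + C * (norm (x - y))\<^sup>2 * norm v * norm v"
      proof (rule add_mono)
        show "(norm (N (x - y) v))\<^sup>2 \<le> (m * norm (x - y) * norm v)\<^sup>2"
          using N_le by (intro power_mono) auto
        have "\<bar>v \<bullet> (E *v v)\<bar> \<le> norm E * norm v * norm v"
          by (rule abs_bilinear_form_le)
        also have "\<dots> \<le> C * (norm (x - y))\<^sup>2 * norm v * norm v"
          using C(2)[OF \<open>x \<in> K\<close> \<open>y \<in> K\<close>] by (intro mult_right_mono) (auto simp: E_def D_def)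
        finally show "\<bar>v \<bullet> (E *v v)\<bar> \<le> C * (norm (x - y))\<^sup>2 * norm v * norm v" .
      qed
      also have "\<dots> = \<kappa> * (norm (x - y))\<^sup>2 * (a * (norm v)\<^sup>2)"
        using ab(1) by (simp add: \<kappa>_def power2_eq_square field_simps)
      also have "\<dots> \<le> \<kappa> * (norm (x - y))\<^sup>2 * (v \<bullet> (g x *v v))"
        using ab(2)[OF \<open>x \<in> K\<close>] \<open>\<kappa> \<ge> 0\<close> by (intro mult_left_mono) auto
      finally show ?thesis .
    qed
    \<comment> \<open>The linear part expands by at least \<open>sqrt a\<close>, and the quadratic
      part is \<open>m * \<rho>\<close>-Lipschitz on the ball, which takes away at most half of
      that.\<close>
    have lip: "sqrt a / 2 * norm (x - z) \<le> norm (P x - P z)" if "x \<in> ball y \<rho>" "z \<in> ball y \<rho>" for x z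
    proof -
      have "P x - P z = S *v (x - z) + (1 / 2) *\<^sub>R (N (x - z) (x - y) + N (z - y) (x - z))"
      proof -
        have "N (x - y) (x - y) - N (z - y) (z - y) = N (x - z) (x - y) + N (z - y) (x - z)"
          by (simp add: N.diff_left N.diff_right)
        moreover have "S *v (x - y) - S *v (z - y) = S *v (x - z)"
          by (simp flip: matrix_vector_mult_diff_distrib)
        ultimately show ?thesis
          by (simp add: P_def algebra_simps flip: scaleR_diff_right)
      qed
      moreover have "norm ((1 / 2) *\<^sub>R (N (x - z) (x - y) + N (z - y) (x - z))) \<le> m * \<rho> * norm (x - z)"
      proof -
        have "norm (N (x - z) (x - y) + N (z - y) (x - z)) \<le> m * norm (x - z) * norm (x - y) + m * norm (z - y) * norm (x - z)"
          by (rule norm_triangle_le[OF add_mono[OF N_le N_le]])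
        also have "\<dots> \<le> m * norm (x - z) * \<rho> + m * \<rho> * norm (x - z)"
          using that \<open>m \<ge> 0\<close> by (intro add_mono mult_left_mono mult_right_mono)
            (auto simp: dist_norm norm_minus_commute)
        finally show ?thesis
          by (simp add: mult_ac)
      qed
      moreover have "m * \<rho> * norm (x - z) \<le> sqrt a / 2 * norm (x - z)"
        using m\<rho> by (intro mult_right_mono) auto
      ultimately have "norm (P x - P z) \<ge> norm (S *v (x - z)) - sqrt a / 2 * norm (x - z)"
        using norm_diff_ineq[of "S *v (x - z)"] by (smt (verit))
      then show ?thesis
        using SRN(7)[of "x - z"] by (simp add: field_simps)
    qed
    have "ball 0 (sqrt a / 2 * \<rho> / 2) \<subseteq> P ` ball y \<rho>"
    proof
      fix z :: "real ^ 'n" assume "z \<in> ball 0 (sqrt a / 2 * \<rho> / 2)"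
      then have z: "norm z \<le> sqrt a * (\<rho> / 4)"
        by simp
      \<comment> \<open>\<open>f w\<close> is \<open>R *v P (y + w)\<close>, a small perturbation of
        the identity, so Brouwer's theorem solves \<open>f w = R *v z\<close>.\<close>
      define f :: "real ^ 'n \<Rightarrow> real ^ 'n" where "f w = w + (1 / 2) *\<^sub>R (R *v N w w)" for w
      have "\<exists>w\<in>cball (0 :: real ^ 'n) (\<rho> / 2). f w = R *v z"
      proof (rule brouwer_surjective_cball[where S = "{R *v z}"])
        show "continuous_on (cball (0 :: real ^ 'n) (\<rho> / 2)) f"
          unfolding f_def
          by (intro continuous_intros bounded_linear.continuous_on[OF matrix_vector_mul_bounded_linear] N.continuous_on)
        fix x w :: "real ^ 'n" assume "x \<in> {R *v z}" and w: "w \<in> cball 0 (\<rho> / 2)"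
        have "norm (x + (w - f w)) = norm (R *v (z - (1 / 2) *\<^sub>R N w w))"
          using \<open>x \<in> {R *v z}\<close> by (simp add: f_def matrix_vector_mult_diff_distrib matrix_vector_mult_scaleR)
        then have "sqrt a * norm (x + (w - f w)) \<le> norm (z - (1 / 2) *\<^sub>R N w w)"
          using SRN(8) by simp
        also have "\<dots> \<le> norm z + norm (N w w) / 2"
          using norm_triangle_ineq4[of z "(1 / 2) *\<^sub>R N w w"] by simp
        also have "norm (N w w) \<le> m * norm w * norm w"
          by (rule N_le)
        also have "\<dots> \<le> m * (\<rho> / 2) * (\<rho> / 2)"
          using w \<open>m \<ge> 0\<close> \<rho>(1) by (intro mult_mono) auto
        also have "\<dots> = m * \<rho> * (\<rho> / 4)"
          by simp
        also have "\<dots> \<le> sqrt a / 2 * (\<rho> / 4)"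
          using m\<rho> \<rho>(1) by (intro mult_right_mono) auto
        finally have "sqrt a * norm (x + (w - f w)) \<le> norm z + sqrt a / 2 * (\<rho> / 4) / 2"
          by simp
        moreover have "0 \<le> sqrt a * \<rho>"
          using ab(1) \<rho>(1) by simp
        ultimately have "sqrt a * norm (x + (w - f w)) \<le> sqrt a * (\<rho> / 2)"
          using z by argo
        then show "x + (w - f w) \<in> cball 0 (\<rho> / 2)"
          using ab(1) by simp
      qed (use \<rho>(1) in auto)
      then obtain w :: "real ^ 'n" where w: "w \<in> cball 0 (\<rho> / 2)" "f w = R *v z"
        by blast
      have "S *v (f w) = z"
        unfolding w(2) by (simp add: matrix_vector_mul_assoc SRN(2))
      moreover have "S *v (f w) = P (y + w)"
        unfolding f_def P_def
        by (simp add: matrix_vector_right_distrib matrix_vector_mult_scaleR matrix_vector_mul_assoc SRN(2))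
      moreover have "y + w \<in> ball y \<rho>"
        using w(1) \<rho>(1) by (simp add: dist_norm)
      ultimately show "z \<in> P ` ball y \<rho>"
        by force
    qed
    moreover have "P y = 0"
      by (simp add: P_def N.zero_left)
    moreover have "(1 - \<kappa> * (norm (x - y))\<^sup>2) * (v \<bullet> (g x *v v)) \<le> (norm (P' x v))\<^sup>2 \<and>
        (norm (P' x v))\<^sup>2 \<le> (1 + \<kappa> * (norm (x - y))\<^sup>2) * (v \<bullet> (g x *v v))" if "x \<in> ball y \<rho>" for x v
      using iso[OF that, of v] by (simp add: algebra_simps abs_le_iff)
    ultimately have "almost_isometric_chart g y \<rho> \<kappa> (sqrt a / 2) P P'"
      unfolding almost_isometric_chart_def using derP contP' lip by blast
    then show ?thesis
      by blast
  qed
  then show ?thesis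
    using that[of \<rho> \<kappa> a] \<rho>(1) \<open>\<kappa> \<ge> 0\<close> ab \<open>\<kappa> * \<rho>\<^sup>2 \<le> 1 / 2\<close> sub K(3) by blast
qed

section \<open>Volume and radial curves in an almost isometric chart\<close>

definition chart_ball :: "('a::metric_space \<Rightarrow> 'b::real_normed_vector) \<Rightarrow> 'a \<Rightarrow> real \<Rightarrow> real \<Rightarrow> 'a set"
  where "chart_ball P y \<rho> s = {x \<in> ball y \<rho>. norm (P x) < s}"

context
  fixes g :: "real ^ 'n \<Rightarrow> real ^ 'n ^ 'n" and y \<rho> \<kappa> \<sigma> P P'
  assumes chart: "almost_isometric_chart g y \<rho> \<kappa> \<sigma> P P'" and "0 < \<sigma>" "0 \<le> \<kappa>" "0 < \<rho>"
    and sym: "\<And>x. x \<in> ball y \<rho> \<Longrightarrow> transpose (g x) = g x"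
    and pos: "\<And>x v. x \<in> ball y \<rho> \<Longrightarrow> v \<noteq> 0 \<Longrightarrow> 0 < v \<bullet> (g x *v v)"
begin

lemma chart_centre: "P y = 0"
  and chart_derivative: "x \<in> ball y \<rho> \<Longrightarrow> (P has_derivative P' x) (at x)"
  and chart_cont: "continuous_on (ball y \<rho>) (\<lambda>x. P' x v)"
  and chart_expanding: "x \<in> ball y \<rho> \<Longrightarrow> z \<in> ball y \<rho> \<Longrightarrow> \<sigma> * norm (x - z) \<le> norm (P x - P z)"
  and chart_onto: "ball 0 (\<sigma> * \<rho> / 2) \<subseteq> P ` ball y \<rho>"
  using chart by (auto simp: almost_isometric_chart_def)

lemma chart_inj: "inj_on P (ball y \<rho>)"
proof (rule inj_onI)
  fix x z assume *: "x \<in> ball y \<rho>" "z \<in> ball y \<rho>" "P x = P z"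
  show "x = z"
    using chart_expanding[OF *(1,2)] *(3) \<open>0 < \<sigma>\<close> by (simp add: mult_le_0_iff)
qed

lemma chart_quasi_isometry:
  assumes x: "x \<in> ball y \<rho>" and \<epsilon>: "\<kappa> * (norm (x - y))\<^sup>2 \<le> \<epsilon>"
  shows "(1 - \<epsilon>) * (v \<bullet> (g x *v v)) \<le> (norm (P' x v))\<^sup>2"
    and "(norm (P' x v))\<^sup>2 \<le> (1 + \<epsilon>) * (v \<bullet> (g x *v v))"
proof -
  have q: "0 \<le> v \<bullet> (g x *v v)"
    using pos[OF x, of v] by (cases "v = 0") auto
  have *: "(1 - \<kappa> * (norm (x - y))\<^sup>2) * (v \<bullet> (g x *v v)) \<le> (norm (P' x v))\<^sup>2"
    "(norm (P' x v))\<^sup>2 \<le> (1 + \<kappa> * (norm (x - y))\<^sup>2) * (v \<bullet> (g x *v v))"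
    using chart x by (auto simp: almost_isometric_chart_def)
  have "(1 - \<epsilon>) * (v \<bullet> (g x *v v)) \<le> (1 - \<kappa> * (norm (x - y))\<^sup>2) * (v \<bullet> (g x *v v))"
    using \<epsilon> q by (intro mult_right_mono) auto
  then show "(1 - \<epsilon>) * (v \<bullet> (g x *v v)) \<le> (norm (P' x v))\<^sup>2"
    using *(1) by simp
  have "(1 + \<kappa> * (norm (x - y))\<^sup>2) * (v \<bullet> (g x *v v)) \<le> (1 + \<epsilon>) * (v \<bullet> (g x *v v))"
    using \<epsilon> q by (intro mult_right_mono) auto
  then show "(norm (P' x v))\<^sup>2 \<le> (1 + \<epsilon>) * (v \<bullet> (g x *v v))"
    using *(2) by simp
qed

lemma open_chart_ball: "open (chart_ball P y \<rho> s)"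
proof -
  have "continuous_on (ball y \<rho>) (\<lambda>x. norm (P x))"
    using chart_derivative
    by (intro continuous_on_norm continuous_at_imp_continuous_on ballI has_derivative_continuous) blast
  then have "open (ball y \<rho> \<inter> (\<lambda>x. norm (P x)) -` {..<s})"
    by (intro continuous_open_preimage) auto
  moreover have "ball y \<rho> \<inter> (\<lambda>x. norm (P x)) -` {..<s} = chart_ball P y \<rho> s"
    by (auto simp: chart_ball_def)
  ultimately show ?thesis
    by simp
qed

lemma chart_ball_norm:
  assumes "x \<in> chart_ball P y \<rho> s"
  shows "norm (x - y) < s / \<sigma>"
proof -
  have "\<sigma> * norm (x - y) \<le> norm (P x)"
    using chart_expanding[of x y] assms \<open>0 < \<rho>\<close> by (simp add: chart_ball_def chart_centre)
  also have "\<dots> < s"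
    using assms by (simp add: chart_ball_def)
  finally show ?thesis
    using \<open>0 < \<sigma>\<close> by (simp add: field_simps)
qed

text \<open>\<open>P\<close> maps the chart ball bijectively onto a Euclidean ball, whose volume is
  therefore the integral of the absolute determinant of \<open>P'\<close>;
  \<open>sqrt_det_comparison\<close> compares this integrand with \<open>sqrt (det (g x))\<close>.
  The estimates are kept free of quotients because the integrals are extended reals.\<close>

lemma chart_ball_volume:
  assumes s: "0 < s" "s \<le> \<sigma> * \<rho> / 2" and \<epsilon>: "\<kappa> * (s / \<sigma>)\<^sup>2 \<le> \<epsilon>" "\<epsilon> < 1"
    and contg: "continuous_on (ball y \<rho>) g"
  shows "ennreal (sqrt (1 - \<epsilon>) ^ CARD('n)) * (\<integral>\<^sup>+x\<in>chart_ball P y \<rho> s. ennreal (sqrt (det (g x))) \<partial>lborel)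
      \<le> emeasure lborel (ball (0 :: real ^ 'n) s)"
    and "emeasure lborel (ball (0 :: real ^ 'n) s)
      \<le> ennreal (sqrt (1 + \<epsilon>) ^ CARD('n)) * (\<integral>\<^sup>+x\<in>chart_ball P y \<rho> s. ennreal (sqrt (det (g x))) \<partial>lborel)"
proof -
  let ?E = "chart_ball P y \<rho> s"
  have E: "?E \<subseteq> ball y \<rho>"
    by (auto simp: chart_ball_def)
  \<comment> \<open>The covering clause of the chart reaches the whole ball because
    \<open>s \<le> \<sigma> * \<rho> / 2\<close>.\<close>
  have imE: "P ` ?E = ball 0 s"
  proof
    show "ball 0 s \<subseteq> P ` ?E"
    proof
      fix z :: "real ^ 'n" assume z: "z \<in> ball 0 s"
      then have "z \<in> ball 0 (\<sigma> * \<rho> / 2)"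
        using s by simp
      then obtain x where "x \<in> ball y \<rho>" "z = P x"
        using chart_onto by blast
      then show "z \<in> P ` ?E"
        using z by (auto simp: chart_ball_def)
    qed
  qed (auto simp: chart_ball_def)
  have lin: "linear (P' x)" if "x \<in> ball y \<rho>" for x
    using chart_derivative[OF that] has_derivative_linear by blast
  have contdet: "continuous_on ?E (\<lambda>x. det (matrix (P' x)))"
  proof (rule continuous_on_det)
    have "continuous_on ?E (\<lambda>x. P' x v)" for v
      using chart_cont E continuous_on_subset by blast
    then show "continuous_on ?E (\<lambda>x. matrix (P' x))"
      unfolding matrix_def by (intro continuous_on_vec_lambda continuous_on_component)
  qed
  have vol: "(\<integral>\<^sup>+x\<in>?E. ennreal \<bar>det (matrix (P' x))\<bar> \<partial>lborel) = emeasure lborel (ball (0 :: real ^ 'n) s)"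
    unfolding imE[symmetric]
  proof (rule nn_integral_abs_det_image)
    show "inj_on P ?E"
      using chart_inj E inj_on_subset by blast
  qed (use open_chart_ball imE E chart_derivative contdet in auto)
  have comp: "sqrt (1 - \<epsilon>) ^ CARD('n) * sqrt (det (g x)) \<le> \<bar>det (matrix (P' x))\<bar>"
    "\<bar>det (matrix (P' x))\<bar> \<le> sqrt (1 + \<epsilon>) ^ CARD('n) * sqrt (det (g x))" if "x \<in> ?E" for x
  proof -
    have x: "x \<in> ball y \<rho>"
      using that E by blast
    have "(norm (x - y))\<^sup>2 \<le> (s / \<sigma>)\<^sup>2"
      using chart_ball_norm[OF that] by (intro power_mono) auto
    then have k: "\<kappa> * (norm (x - y))\<^sup>2 \<le> \<epsilon>"
      using \<epsilon>(1) \<open>0 \<le> \<kappa>\<close> mult_left_mono order_trans by blast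
    have eq: "matrix (P' x) *v v = P' x v" for v
      using lin[OF x] by (simp add: matrix_works)
    have lo: "0 < 1 - \<epsilon>"
      using \<epsilon> by simp
    show "sqrt (1 - \<epsilon>) ^ CARD('n) * sqrt (det (g x)) \<le> \<bar>det (matrix (P' x))\<bar>"
      "\<bar>det (matrix (P' x))\<bar> \<le> sqrt (1 + \<epsilon>) ^ CARD('n) * sqrt (det (g x))"
      using sqrt_det_comparison(1,2)[OF sym[OF x] pos[OF x] lo, of "matrix (P' x)" "1 + \<epsilon>"]
        chart_quasi_isometry[OF x k] unfolding eq by auto
  qed
  have [measurable]: "?E \<in> sets borel"
    using open_chart_ball by simp
  have meas: "(\<lambda>x. ennreal (sqrt (det (g x))) * indicator ?E x) \<in> borel_measurable lborel"
  proof -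
    have "(\<lambda>x. indicator ?E x *\<^sub>R sqrt (det (g x))) \<in> borel_measurable borel"
      using contg E
      by (intro borel_measurable_continuous_on_indicator continuous_on_real_sqrt continuous_on_det)
        (auto intro: continuous_on_subset)
    then have "(\<lambda>x. ennreal (indicator ?E x *\<^sub>R sqrt (det (g x)))) \<in> borel_measurable lborel"
      by simp
    then show ?thesis
      by (rule measurable_cong[THEN iffD1, rotated]) (auto simp: indicator_def)
  qed
  have "ennreal (sqrt (1 - \<epsilon>) ^ CARD('n)) * (\<integral>\<^sup>+x\<in>?E. ennreal (sqrt (det (g x))) \<partial>lborel)
      = (\<integral>\<^sup>+x. ennreal (sqrt (1 - \<epsilon>) ^ CARD('n)) * (ennreal (sqrt (det (g x))) * indicator ?E x) \<partial>lborel)"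
    by (rule nn_integral_cmult[OF meas, symmetric])
  also have "\<dots> \<le> (\<integral>\<^sup>+x\<in>?E. ennreal \<bar>det (matrix (P' x))\<bar> \<partial>lborel)"
    using comp(1) \<epsilon>
    by (intro nn_integral_mono) (auto simp: indicator_def ennreal_mult'[symmetric] intro!: ennreal_leI)
  finally show "ennreal (sqrt (1 - \<epsilon>) ^ CARD('n)) * (\<integral>\<^sup>+x\<in>?E. ennreal (sqrt (det (g x))) \<partial>lborel)
      \<le> emeasure lborel (ball (0 :: real ^ 'n) s)"
    unfolding vol .
  have "0 \<le> \<epsilon>"
    using \<epsilon>(1) \<open>0 \<le> \<kappa>\<close> by (meson mult_nonneg_nonneg order_trans zero_le_power2)
  have "(\<integral>\<^sup>+x\<in>?E. ennreal \<bar>det (matrix (P' x))\<bar> \<partial>lborel)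
      \<le> (\<integral>\<^sup>+x. ennreal (sqrt (1 + \<epsilon>) ^ CARD('n)) * (ennreal (sqrt (det (g x))) * indicator ?E x) \<partial>lborel)"
    using comp(2) \<open>0 \<le> \<epsilon>\<close>
    by (intro nn_integral_mono) (auto simp: indicator_def ennreal_mult'[symmetric] intro!: ennreal_leI)
  also have "\<dots> = ennreal (sqrt (1 + \<epsilon>) ^ CARD('n)) * (\<integral>\<^sup>+x\<in>?E. ennreal (sqrt (det (g x))) \<partial>lborel)"
    by (rule nn_integral_cmult[OF meas])
  finally show "emeasure lborel (ball (0 :: real ^ 'n) s)
      \<le> ennreal (sqrt (1 + \<epsilon>) ^ CARD('n)) * (\<integral>\<^sup>+x\<in>?E. ennreal (sqrt (det (g x))) \<partial>lborel)"
    unfolding vol .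
qed

text \<open>The curve is the \<open>P\<close>-preimage of the segment from 0 to \<open>P x\<close>.
  The segment has constant speed \<open>norm (P x)\<close>, and \<open>P'\<close> shrinks metric
  length by a factor no smaller than \<open>sqrt (1 - \<epsilon>)\<close>, hence the bound on the
  speed.\<close>

lemma radial_curve:
  assumes z: "norm (P x) < \<sigma> * \<rho> / 2" and x: "x \<in> ball y \<rho>"
    and \<epsilon>: "\<kappa> * (norm (P x) / \<sigma>)\<^sup>2 \<le> \<epsilon>" "\<epsilon> < 1"
    and "0 < a" and a: "\<And>x v. x \<in> ball y \<rho> \<Longrightarrow> a * (norm v)\<^sup>2 \<le> v \<bullet> (g x *v v)"
  obtains p D where "p 0 = y" "p 1 = x" "\<And>t. t \<in> {0..1} \<Longrightarrow> p t \<in> ball y \<rho>"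
    "\<And>t. t \<in> {0..1} \<Longrightarrow> (p has_vector_derivative D t) (at t within {0..1})"
    "continuous_on {0..1} D"
    "\<And>t. t \<in> {0..1} \<Longrightarrow> sqrt (D t \<bullet> (g (p t) *v D t)) \<le> norm (P x) / sqrt (1 - \<epsilon>)"
proof -
  define z where "z = P x"
  define Q where "Q = inv_into (ball y \<rho>) P"
  have QP: "Q (P w) = w" if "w \<in> ball y \<rho>" for w
    unfolding Q_def using that chart_inj by simp
  define p where "p t = Q (t *\<^sub>R z)" for t
  have in_ball: "t *\<^sub>R z \<in> P ` ball y \<rho>" if "t \<in> {0..1}" for t
  proof -
    have "norm (t *\<^sub>R z) \<le> norm z"
      using that by (simp add: mult_left_le_one_le)
    then show ?thesis
      using chart_onto z by (force simp: z_def)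
  qed
  have p_ball: "p t \<in> ball y \<rho>" and Pp: "P (p t) = t *\<^sub>R z" if "t \<in> {0..1}" for t
    using inv_into_into[OF in_ball[OF that]] f_inv_into_f[OF in_ball[OF that]]
    by (simp_all only: p_def Q_def)
  have k: "\<kappa> * (norm (p t - y))\<^sup>2 \<le> \<epsilon>" if "t \<in> {0..1}" for t
  proof -
    have "\<sigma> * norm (p t - y) \<le> norm (P (p t) - P y)"
      using chart_expanding[OF p_ball[OF that], of y] \<open>0 < \<rho>\<close> by simp
    also have "\<dots> \<le> norm z"
      using Pp[OF that] that by (simp add: chart_centre mult_left_le_one_le)
    finally have "norm (p t - y) \<le> norm z / \<sigma>"
      using \<open>0 < \<sigma>\<close> by (simp add: field_simps)
    then have "(norm (p t - y))\<^sup>2 \<le> (norm z / \<sigma>)\<^sup>2"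
      by (intro power_mono) auto
    then show ?thesis
      using \<epsilon>(1) \<open>0 \<le> \<kappa>\<close> mult_left_mono order_trans unfolding z_def by blast
  qed
  have "0 < 1 - \<epsilon>"
    using \<epsilon> by simp
  \<comment> \<open>This bound makes \<open>P'\<close> invertible along the curve and later controls
    the variation of the velocity.\<close>
  have lower: "sqrt ((1 - \<epsilon>) * a) * norm v \<le> norm (P' (p t) v)" if "t \<in> {0..1}" for t v
  proof (rule power2_le_imp_le)
    have "(sqrt ((1 - \<epsilon>) * a) * norm v)\<^sup>2 = (1 - \<epsilon>) * (a * (norm v)\<^sup>2)"
      using \<open>0 < 1 - \<epsilon>\<close> \<open>0 < a\<close> by (simp add: power_mult_distrib)
    also have "\<dots> \<le> (1 - \<epsilon>) * (v \<bullet> (g (p t) *v v))"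
      using a[OF p_ball[OF that]] \<open>0 < 1 - \<epsilon>\<close> by (intro mult_left_mono) auto
    also have "\<dots> \<le> (norm (P' (p t) v))\<^sup>2"
      by (rule chart_quasi_isometry(1)[OF p_ball[OF that] k[OF that]])
    finally show "(sqrt ((1 - \<epsilon>) * a) * norm v)\<^sup>2 \<le> (norm (P' (p t) v))\<^sup>2" .
  qed simp
  define c where "c = sqrt ((1 - \<epsilon>) * a)"
  have "c > 0"
    using \<open>0 < 1 - \<epsilon>\<close> \<open>0 < a\<close> by (simp add: c_def)
  have lin: "linear (P' w)" if "w \<in> ball y \<rho>" for w
    using chart_derivative[OF that] has_derivative_linear by blast
  have surj: "surj (P' (p t))" if "t \<in> {0..1}" for t
  proof -
    have "v = 0" if "P' (p t) v = 0" for v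
      using lower[OF \<open>t \<in> {0..1}\<close>, of v] that \<open>c > 0\<close> by (simp add: c_def[symmetric] mult_le_0_iff)
    then have "inj (P' (p t))"
      using linear_injective_0[OF lin[OF p_ball[OF that]]] by blast
    then show ?thesis
      using linear_injective_imp_surjective[OF lin[OF p_ball[OF that]]] by blast
  qed
  define D where "D t = inv (P' (p t)) z" for t
  have PD: "P' (p t) (D t) = z" if "t \<in> {0..1}" for t
    unfolding D_def using surj[OF that] by (rule surj_f_inv_f)
  have der: "(p has_vector_derivative D t) (at t within {0..1})" if t: "t \<in> {0..1}" for t
  proof -
    have "(Q has_derivative inv (P' (p t))) (at (P (p t)))"
    proof (rule has_derivative_inverse_on[where S = "ball y \<rho>" and f' = P' and g' = "\<lambda>w. inv (P' w)"])
      show "P' (p t) \<circ> inv (P' (p t)) = id"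
        using surj[OF t] by (simp add: surj_iff)
    qed (use chart_derivative QP p_ball[OF t] in auto)
    then have Q: "(Q has_derivative inv (P' (p t))) (at (t *\<^sub>R z))"
      by (simp add: Pp[OF t])
    have "((\<lambda>t. t *\<^sub>R z) has_derivative (\<lambda>h. h *\<^sub>R z)) (at t within {0..1})"
      by (auto intro!: derivative_eq_intros)
    then have "(Q \<circ> (\<lambda>t. t *\<^sub>R z) has_derivative inv (P' (p t)) \<circ> (\<lambda>h. h *\<^sub>R z)) (at t within {0..1})"
      using Q by (intro diff_chain_within) (auto intro: has_derivative_at_withinI)
    moreover have "inv (P' (p t)) \<circ> (\<lambda>h. h *\<^sub>R z) = (\<lambda>h. h *\<^sub>R D t)"
      using has_derivative_linear[OF Q] by (auto simp: D_def linear_cmul)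
    ultimately show ?thesis
      by (simp add: has_vector_derivative_def p_def[abs_def] o_def)
  qed
  have contp: "continuous_on {0..1} p"
    unfolding continuous_on_eq_continuous_within
    by (rule ballI, rule has_vector_derivative_continuous, rule der)
  \<comment> \<open>\<open>P' (p t)\<close> sends \<open>D t - D s\<close> to
    \<open>z - P' (p t) (D s)\<close>, which tends to 0 as \<open>t\<close> tends to
    \<open>s\<close>; by \<open>lower\<close> the difference itself tends to 0.\<close>
  have "continuous_on {0..1} D"
    unfolding continuous_on_def
  proof
    fix s :: real assume s: "s \<in> {0..1}"
    have "continuous_on {0..1} (\<lambda>t. P' (p t) (D s))"
      by (rule continuous_on_compose2[OF chart_cont contp]) (use p_ball in auto)
    then have "((\<lambda>t. P' (p t) (D s)) \<longlongrightarrow> z) (at s within {0..1})"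
      using s PD[OF s] by (auto simp: continuous_on_def)
    then have "((\<lambda>t. norm (z - P' (p t) (D s)) / c) \<longlongrightarrow> norm (z - z) / c) (at s within {0..1})"
      using \<open>c > 0\<close> by (intro tendsto_intros) auto
    then have lim: "((\<lambda>t. norm (z - P' (p t) (D s)) / c) \<longlongrightarrow> 0) (at s within {0..1})"
      by simp
    have "((\<lambda>t. D t - D s) \<longlongrightarrow> 0) (at s within {0..1})"
    proof (rule Lim_null_comparison[OF _ lim])
      have "norm (D t - D s) \<le> norm (z - P' (p t) (D s)) / c" if t: "t \<in> {0..1}" for t
      proof -
        have "c * norm (D t - D s) \<le> norm (P' (p t) (D t - D s))"
          using lower[OF t] by (simp add: c_def)
        also have "P' (p t) (D t - D s) = z - P' (p t) (D s)"
          using linear_diff[OF lin[OF p_ball[OF t]]] PD[OF t] by simp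
        finally show ?thesis
          using \<open>c > 0\<close> by (simp add: field_simps)
      qed
      then show "\<forall>\<^sub>F t in at s within {0..1}. norm (D t - D s) \<le> norm (z - P' (p t) (D s)) / c"
        by (simp add: eventually_at_filter)
    qed
    then show "(D \<longlongrightarrow> D s) (at s within {0..1})"
      by (rule Lim_null[THEN iffD2])
  qed
  moreover have "sqrt (D t \<bullet> (g (p t) *v D t)) \<le> norm (P x) / sqrt (1 - \<epsilon>)" if t: "t \<in> {0..1}" for t
  proof -
    have "(1 - \<epsilon>) * (D t \<bullet> (g (p t) *v D t)) \<le> (norm z)\<^sup>2"
      using chart_quasi_isometry(1)[OF p_ball[OF t] k[OF t], of "D t"] PD[OF t] by simp
    then have "sqrt ((1 - \<epsilon>) * (D t \<bullet> (g (p t) *v D t))) \<le> norm z"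
      by (intro real_le_lsqrt) auto
    then have "sqrt (D t \<bullet> (g (p t) *v D t)) * sqrt (1 - \<epsilon>) \<le> norm z"
      by (simp only: real_sqrt_mult mult.commute)
    then show ?thesis
      using \<open>0 < 1 - \<epsilon>\<close> by (simp add: pos_le_divide_eq z_def)
  qed
  moreover have "p 0 = y"
    using QP[of y] \<open>0 < \<rho>\<close> by (simp add: p_def chart_centre)
  moreover have "p 1 = x"
    using QP[OF x] by (simp add: p_def z_def)
  ultimately show ?thesis
    using that[of p D] p_ball der by blast
qed

end

section \<open>Curves in a Riemannian manifold\<close>

lemma continuous_on_quadratic_form:
  fixes A :: "'b::topological_space \<Rightarrow> real ^ 'n ^ 'n"
  assumes "continuous_on S A" "continuous_on S v"
  shows "continuous_on S (\<lambda>x. v x \<bullet> (A x *v v x))"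
  unfolding inner_vec_def matrix_vector_mult_def using assms by (auto intro!: continuous_intros)

locale riemannian_manifold =
  fixes X :: "'a topology" and \<A> :: "('a, 'n::finite) chart set" and g :: "('a, 'n) metric_tensor"
  assumes manifold: "smooth_manifold X \<A>" and metric: "C2_Riemannian_metric \<A> g"
begin

abbreviation coord :: "('a, 'n) chart \<Rightarrow> 'a \<Rightarrow> real ^ 'n"
  where "coord c \<equiv> snd c"

abbreviation dist_g :: "'a \<Rightarrow> 'a \<Rightarrow> real"
  where "dist_g \<equiv> Riemannian_dist X \<A> g"

abbreviation pw_C1 :: "(real \<Rightarrow> 'a) \<Rightarrow> bool"
  where "pw_C1 \<equiv> piecewise_C1_curve X \<A>"

abbreviation speed_g :: "(real \<Rightarrow> 'a) \<Rightarrow> real \<Rightarrow> real"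
  where "speed_g \<equiv> speed \<A> g"

abbreviation length_g :: "(real \<Rightarrow> 'a) \<Rightarrow> real"
  where "length_g \<equiv> curve_length \<A> g"

definition param :: "('a, 'n) chart \<Rightarrow> real ^ 'n \<Rightarrow> 'a"
  where "param c = inv_into (fst c) (coord c)"

abbreviation codom :: "('a, 'n) chart \<Rightarrow> (real ^ 'n) set"
  where "codom c \<equiv> coord c ` fst c"

lemma chart_open: "c \<in> \<A> \<Longrightarrow> openin X (fst c)"
  and open_codom: "c \<in> \<A> \<Longrightarrow> open (codom c)"
  and homeo: "c \<in> \<A> \<Longrightarrow> homeomorphic_map (subtopology X (fst c)) (top_of_set (codom c)) (coord c)"
  using manifold by (auto simp: smooth_manifold_def is_chart_def split_beta)

lemma chart_subset: "c \<in> \<A> \<Longrightarrow> fst c \<subseteq> topspace X"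
  using chart_open openin_subset by blast

lemma coord_inj: "c \<in> \<A> \<Longrightarrow> inj_on (coord c) (fst c)"
  using homeomorphic_imp_injective_map[OF homeo] chart_subset by (simp add: Int_absorb1)

lemma param_coord [simp]: "c \<in> \<A> \<Longrightarrow> p \<in> fst c \<Longrightarrow> param c (coord c p) = p"
  by (simp add: param_def coord_inj)

lemma coord_param [simp]: "x \<in> codom c \<Longrightarrow> coord c (param c x) = x"
  by (simp add: param_def f_inv_into_f)

lemma param_in: "x \<in> codom c \<Longrightarrow> param c x \<in> fst c"
  by (simp add: param_def inv_into_into)

lemma continuous_map_coord: "c \<in> \<A> \<Longrightarrow> continuous_map (subtopology X (fst c)) euclidean (coord c)"
  using homeomorphic_imp_continuous_map[OF homeo] continuous_map_in_subtopology by blast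

lemma continuous_map_param:
  assumes c: "c \<in> \<A>"
  shows "continuous_map (top_of_set (codom c)) X (param c)"
proof -
  obtain h where h: "homeomorphic_maps (subtopology X (fst c)) (top_of_set (codom c)) (coord c) h"
    using homeo[OF c] homeomorphic_map_maps by blast
  then have "continuous_map (top_of_set (codom c)) X h"
    by (simp add: homeomorphic_maps_def continuous_map_in_subtopology)
  moreover have "h x = param c x" if "x \<in> topspace (top_of_set (codom c))" for x
  proof -
    from that obtain p where p: "p \<in> fst c" "x = coord c p"
      by auto
    then show ?thesis
      using h chart_subset[OF c] c by (auto simp: homeomorphic_maps_def)
  qed
  ultimately show ?thesis
    using continuous_map_eq by blast
qed

lemma openin_coord_preimage:
  assumes c: "c \<in> \<A>" and "open W"
  shows "openin X {p \<in> fst c. coord c p \<in> W}"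
proof -
  have "openin (subtopology X (fst c)) {p \<in> topspace (subtopology X (fst c)). coord c p \<in> W}"
    using continuous_map_coord[OF c] \<open>open W\<close> by (intro openin_continuous_map_preimage) auto
  then have "openin X {p \<in> topspace (subtopology X (fst c)). coord c p \<in> W}"
    using openin_trans_full chart_open[OF c] by blast
  moreover have "{p \<in> topspace (subtopology X (fst c)). coord c p \<in> W} = {p \<in> fst c. coord c p \<in> W}"
    using chart_subset[OF c] by auto
  ultimately show ?thesis
    by simp
qed

lemma metric_sym: "c \<in> \<A> \<Longrightarrow> x \<in> codom c \<Longrightarrow> transpose (g c x) = g c x"
  and metric_pos: "c \<in> \<A> \<Longrightarrow> x \<in> codom c \<Longrightarrow> v \<noteq> 0 \<Longrightarrow> 0 < v \<bullet> (g c x *v v)"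
  and metric_C2: "c \<in> \<A> \<Longrightarrow> Ck_on 2 (g c) (codom c)"
  using metric by (auto simp: C2_Riemannian_metric_def)

lemma metric_nonneg: "c \<in> \<A> \<Longrightarrow> x \<in> codom c \<Longrightarrow> 0 \<le> v \<bullet> (g c x *v v)"
  using metric_pos[of c x v] by (cases "v = 0") auto

lemma metric_transform:
  assumes "c \<in> \<A>" "c' \<in> \<A>" "p \<in> fst c" "p \<in> fst c'"
  shows "v \<bullet> (g c (coord c p) *v w) =
    frechet_derivative (transition c c') (at (coord c p)) v \<bullet>
      (g c' (coord c' p) *v frechet_derivative (transition c c') (at (coord c p)) w)"
proof -
  have "\<forall>c\<in>\<A>. \<forall>c'\<in>\<A>. \<forall>p \<in> fst c \<inter> fst c'. \<forall>v w. v \<bullet> (g c (coord c p) *v w) =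
      frechet_derivative (transition c c') (at (coord c p)) v \<bullet>
      (g c' (coord c' p) *v frechet_derivative (transition c c') (at (coord c p)) w)"
    using metric unfolding C2_Riemannian_metric_def Let_def by (elim conjE)
  from this[rule_format, OF assms(1,2)] assms(3,4) show ?thesis
    by simp
qed

lemma continuous_on_metric: "c \<in> \<A> \<Longrightarrow> continuous_on (codom c) (g c)"
  using metric_C2[of c]
  by (auto simp: numeral_2_eq_2 intro!: continuous_at_imp_continuous_on differentiable_imp_continuous_within)

lemma transition_eq: "c \<in> \<A> \<Longrightarrow> transition c c' x = coord c' (param c x)"
  by (simp add: transition_def param_def)

lemma transition_C1:
  assumes "c \<in> \<A>" "c' \<in> \<A>"
  shows "x \<in> coord c ` (fst c \<inter> fst c') \<Longrightarrow>
      (transition c c' has_derivative frechet_derivative (transition c c') (at x)) (at x)"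
    and "continuous_on (coord c ` (fst c \<inter> fst c')) (\<lambda>x. frechet_derivative (transition c c') (at x) v)"
proof -
  have "Ck_on (Suc 0) (transition c c') (coord c ` (fst c \<inter> fst c'))"
    using manifold assms unfolding smooth_manifold_def smooth_on_def by blast
  then show "x \<in> coord c ` (fst c \<inter> fst c') \<Longrightarrow>
      (transition c c' has_derivative frechet_derivative (transition c c') (at x)) (at x)"
    and "continuous_on (coord c ` (fst c \<inter> fst c')) (\<lambda>x. frechet_derivative (transition c c') (at x) v)"
    by (auto simp: frechet_derivative_works[symmetric])
qed

text \<open>The derivative is taken within the piece \<open>I\<close>, so that at an end point of a
  \<open>C^1\<close> piece it is the one-sided derivative.\<close>

definition vel :: "('a, 'n) chart \<Rightarrow> (real \<Rightarrow> 'a) \<Rightarrow> real set \<Rightarrow> real \<Rightarrow> real ^ 'n"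
  where "vel c \<gamma> I t = vector_derivative (coord c \<circ> \<gamma>) (at t within I)"

definition local_speed :: "('a, 'n) chart \<Rightarrow> (real \<Rightarrow> 'a) \<Rightarrow> real set \<Rightarrow> real \<Rightarrow> real"
  where "local_speed c \<gamma> I t = sqrt (vel c \<gamma> I t \<bullet> (g c (coord c (\<gamma> t)) *v vel c \<gamma> I t))"

context
  fixes a b :: real and \<gamma> :: "real \<Rightarrow> 'a"
  assumes ab: "a < b" and cont: "continuous_map (top_of_set {a..b}) X \<gamma>" and C1: "C1_curve_on \<A> {a..b} \<gamma>"
begin

lemma vel_ex:
  assumes "c \<in> \<A>"
  obtains D where "continuous_on {t \<in> {a..b}. \<gamma> t \<in> fst c} D"
    "\<And>t. t \<in> {a..b} \<Longrightarrow> \<gamma> t \<in> fst c \<Longrightarrow> (coord c \<circ> \<gamma> has_vector_derivative D t) (at t within {a..b})"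
  using bspec[OF C1[unfolded C1_curve_on_def split_beta] assms] by metis

lemma vel_works:
  assumes "c \<in> \<A>" "t \<in> {a..b}" "\<gamma> t \<in> fst c"
  shows "(coord c \<circ> \<gamma> has_vector_derivative vel c \<gamma> {a..b} t) (at t within {a..b})"
proof -
  obtain D where D: "(coord c \<circ> \<gamma> has_vector_derivative D) (at t within {a..b})"
    using vel_ex[OF assms(1)] assms(2,3) by metis
  have "vel c \<gamma> {a..b} t = D"
    unfolding vel_def by (rule vector_derivative_within_closed_interval[OF ab assms(2) D])
  then show ?thesis
    using D by simp
qed

lemma vel_continuous:
  assumes "c \<in> \<A>"
  shows "continuous_on {t \<in> {a..b}. \<gamma> t \<in> fst c} (vel c \<gamma> {a..b})"
proof -
  obtain D where D: "continuous_on {t \<in> {a..b}. \<gamma> t \<in> fst c} D"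
    "\<And>t. t \<in> {a..b} \<Longrightarrow> \<gamma> t \<in> fst c \<Longrightarrow> (coord c \<circ> \<gamma> has_vector_derivative D t) (at t within {a..b})"
    by (rule vel_ex[OF assms]) (rule that)
  have "vel c \<gamma> {a..b} t = D t" if "t \<in> {t \<in> {a..b}. \<gamma> t \<in> fst c}" for t
    unfolding vel_def using D(2)[of t] that ab
    by (intro vector_derivative_within_closed_interval) auto
  then show ?thesis
    by (intro continuous_on_eq[OF D(1)]) simp
qed

lemma openin_curve_preimage:
  assumes "openin X V"
  shows "openin (top_of_set {a..b}) {t \<in> {a..b}. \<gamma> t \<in> V}"
  using openin_continuous_map_preimage[OF cont assms] by simp

text \<open>Near \<open>t\<close> the curve lies in both domains, so the chain rule through the
  transition map turns one velocity into the other by \<open>J\<close>; the transformation law of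
  the metric absorbs \<open>J\<close>.\<close>

lemma local_speed_indep:
  assumes c: "c \<in> \<A>" "c' \<in> \<A>" and t: "t \<in> {a..b}" "\<gamma> t \<in> fst c" "\<gamma> t \<in> fst c'"
  shows "local_speed c \<gamma> {a..b} t = local_speed c' \<gamma> {a..b} t"
proof -
  define J where "J = frechet_derivative (transition c c') (at (coord c (\<gamma> t)))"
  have "coord c (\<gamma> t) \<in> coord c ` (fst c \<inter> fst c')"
    using t by blast
  then have J: "(transition c c' has_derivative J) (at (coord c (\<gamma> t)))"
    unfolding J_def using transition_C1(1)[OF c] by blast
  have v: "(coord c \<circ> \<gamma> has_derivative (\<lambda>h. h *\<^sub>R vel c \<gamma> {a..b} t)) (at t within {a..b})"
    using vel_works[OF c(1) t(1,2)] by (simp add: has_vector_derivative_def)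
  have "(transition c c' \<circ> (coord c \<circ> \<gamma>) has_derivative J \<circ> (\<lambda>h. h *\<^sub>R vel c \<gamma> {a..b} t)) (at t within {a..b})"
    using J by (intro diff_chain_within[OF v]) (simp add: has_derivative_at_withinI)
  then have "(transition c c' \<circ> (coord c \<circ> \<gamma>) has_vector_derivative J (vel c \<gamma> {a..b} t)) (at t within {a..b})"
    using has_derivative_linear[OF J] by (simp add: has_vector_derivative_def o_def linear_cmul)
  moreover have "openin (top_of_set {a..b}) {s \<in> {a..b}. \<gamma> s \<in> fst c \<inter> fst c'}"
    using c chart_open by (intro openin_curve_preimage) blast
  then obtain e where "e > 0" and e: "\<And>s. s \<in> {a..b} \<Longrightarrow> dist s t < e \<Longrightarrow> \<gamma> s \<in> fst c \<inter> fst c'"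
    unfolding openin_euclidean_subtopology_iff using t by blast
  ultimately have "(coord c' \<circ> \<gamma> has_vector_derivative J (vel c \<gamma> {a..b} t)) (at t within {a..b})"
    using t(1) c by (auto elim!: has_vector_derivative_transform_within simp: transition_eq)
  then have "vel c' \<gamma> {a..b} t = J (vel c \<gamma> {a..b} t)"
    unfolding vel_def[of c'] using t(1) ab by (intro vector_derivative_within_closed_interval) auto
  then show ?thesis
    unfolding local_speed_def J_def using metric_transform[OF c t(2,3)] by simp
qed

text \<open>The chart domains pull back to a relatively open cover of the interval, on which the
  local speeds are continuous and agree on overlaps; they paste to one continuous function.\<close>

lemma local_speed_continuous:
  obtains q where "continuous_on {a..b} q"
    "\<And>c t. c \<in> \<A> \<Longrightarrow> t \<in> {a..b} \<Longrightarrow> \<gamma> t \<in> fst c \<Longrightarrow> q t = local_speed c \<gamma> {a..b} t"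
proof
  define ch where "ch t = (SOME c. c \<in> \<A> \<and> \<gamma> t \<in> fst c)" for t
  have ch: "ch t \<in> \<A> \<and> \<gamma> t \<in> fst (ch t)" if "t \<in> {a..b}" for t
  proof -
    have "\<gamma> t \<in> topspace X"
      using cont that by (auto simp: continuous_map_def)
    then have "\<exists>c. c \<in> \<A> \<and> \<gamma> t \<in> fst c"
      using manifold by (auto simp: smooth_manifold_def)
    then show ?thesis
      unfolding ch_def by (rule someI_ex)
  qed
  define q where "q t = local_speed (ch t) \<gamma> {a..b} t" for t
  show eq: "q t = local_speed c \<gamma> {a..b} t" if "c \<in> \<A>" "t \<in> {a..b}" "\<gamma> t \<in> fst c" for c t
    unfolding q_def using ch that by (intro local_speed_indep) auto
  have "continuous_map (top_of_set {a..b}) euclidean q"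
  proof (rule pasting_lemma[where I = \<A> and T = "\<lambda>c. {t \<in> {a..b}. \<gamma> t \<in> fst c}" and f = "\<lambda>c. local_speed c \<gamma> {a..b}"])
    fix c assume c: "c \<in> \<A>"
    let ?T = "{t \<in> {a..b}. \<gamma> t \<in> fst c}"
    show "openin (top_of_set {a..b}) ?T"
      using chart_open[OF c] by (rule openin_curve_preimage)
    have "continuous_map (top_of_set ?T) X \<gamma>"
      by (rule continuous_map_from_subtopology_mono[OF cont]) auto
    then have "continuous_map (top_of_set ?T) (subtopology X (fst c)) \<gamma>"
      by (simp add: continuous_map_in_subtopology)
    then have "continuous_map (top_of_set ?T) euclidean (coord c \<circ> \<gamma>)"
      using continuous_map_coord[OF c] continuous_map_compose by blast
    then have "continuous_on ?T (\<lambda>t. coord c (\<gamma> t))"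
      by (simp add: o_def)
    then have "continuous_on ?T (\<lambda>t. g c (coord c (\<gamma> t)))"
      by (rule continuous_on_compose2[OF continuous_on_metric[OF c]]) auto
    then have "continuous_on ?T (local_speed c \<gamma> {a..b})"
      unfolding local_speed_def using vel_continuous[OF c]
      by (intro continuous_on_real_sqrt continuous_on_quadratic_form)
    moreover have "{a..b} \<inter> ?T = ?T" by auto
    ultimately show "continuous_map (subtopology (top_of_set {a..b}) ?T) euclideanreal (local_speed c \<gamma> {a..b})"
      by (simp add: subtopology_subtopology)
  next
    show "local_speed c \<gamma> {a..b} t = local_speed c' \<gamma> {a..b} t"
      if "c \<in> \<A>" "c' \<in> \<A>" "t \<in> topspace (top_of_set {a..b}) \<inter> {t \<in> {a..b}. \<gamma> t \<in> fst c} \<inter> {t \<in> {a..b}. \<gamma> t \<in> fst c'}"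
      for c c' t
      using that by (intro local_speed_indep) auto
    show "\<exists>c. c \<in> \<A> \<and> t \<in> {t \<in> {a..b}. \<gamma> t \<in> fst c} \<and> q t = local_speed c \<gamma> {a..b} t"
      if "t \<in> topspace (top_of_set {a..b})" for t
      using ch[of t] that by (intro exI[of _ "ch t"]) (auto simp: q_def)
  qed
  then show "continuous_on {a..b} q"
    by simp
qed

end

text \<open>At an interior point the derivatives within \<open>{a..b}\<close>, within
  \<open>{0..1}\<close> and at \<open>t\<close> coincide, so the chart selected in
  \<open>speed\<close> can be exchanged for \<open>c\<close>.\<close>

lemma speed_eq_local:
  assumes c: "c \<in> \<A>" and "0 \<le> a" "b \<le> 1" and t: "a < t" "t < b"
    and cont: "continuous_map (top_of_set {a..b}) X \<gamma>" and C1: "C1_curve_on \<A> {a..b} \<gamma>" and "\<gamma> t \<in> fst c"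
  shows "speed_g \<gamma> t = local_speed c \<gamma> {a..b} t"
    and "(coord c \<circ> \<gamma> has_vector_derivative vel c \<gamma> {a..b} t) (at t)"
proof -
  define c0 where "c0 = (SOME c. c \<in> \<A> \<and> \<gamma> t \<in> fst c)"
  have "\<exists>c. c \<in> \<A> \<and> \<gamma> t \<in> fst c"
    using c assms(8) by blast
  then have "c0 \<in> \<A> \<and> \<gamma> t \<in> fst c0"
    unfolding c0_def by (rule someI_ex)
  then have c0: "c0 \<in> \<A>" "\<gamma> t \<in> fst c0"
    by auto
  have ab: "a < b" "t \<in> {a..b}"
    using t by auto
  have at: "at t within {a..b} = at t" "at t within {0..1} = at t"
    using assms by (auto intro!: at_within_interior simp: interior_atLeastAtMost_real)
  have "speed_g \<gamma> t = local_speed c0 \<gamma> {a..b} t"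
    by (simp add: speed_def local_speed_def vel_def c0_def Let_def at)
  also have "\<dots> = local_speed c \<gamma> {a..b} t"
    by (rule local_speed_indep[OF ab(1) cont C1 c0(1) c ab(2) c0(2) assms(8)])
  finally show "speed_g \<gamma> t = local_speed c \<gamma> {a..b} t" .
  show "(coord c \<circ> \<gamma> has_vector_derivative vel c \<gamma> {a..b} t) (at t)"
    using vel_works[OF ab(1) cont C1 c ab(2) assms(8)] by (simp add: at)
qed

text \<open>This covers break points, where the velocity is an arbitrary vector. The sign has to
  come from the metric, since \<open>sqrt\<close> of a negative number is negative.\<close>

lemma speed_nonneg:
  assumes "\<gamma> t \<in> topspace X"
  shows "0 \<le> speed_g \<gamma> t"
proof -
  define c0 where "c0 = (SOME c. c \<in> \<A> \<and> \<gamma> t \<in> fst c)"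
  have "\<exists>c. c \<in> \<A> \<and> \<gamma> t \<in> fst c"
    using assms manifold by (auto simp: smooth_manifold_def)
  then have "c0 \<in> \<A> \<and> \<gamma> t \<in> fst c0"
    unfolding c0_def by (rule someI_ex)
  then show ?thesis
    by (simp add: speed_def Let_def c0_def[symmetric] metric_nonneg)
qed

lemma curve_in_space: "pw_C1 \<gamma> \<Longrightarrow> t \<in> {0..1} \<Longrightarrow> \<gamma> t \<in> topspace X"
  by (auto simp: piecewise_C1_curve_def continuous_map_def)

text \<open>On each piece the speed agrees with a continuous function except at the two end points,
  which gives integrability; the finite exceptional set consists of the break points.\<close>

lemma piecewise_speed:
  assumes \<gamma>: "pw_C1 \<gamma>"
  shows "speed_g \<gamma> integrable_on {0..1}"
    and "\<exists>S. finite S \<and> (\<forall>t\<in>{0<..<1} - S. \<forall>c\<in>\<A>. \<gamma> t \<in> fst c \<longrightarrow>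
      (\<exists>v. (coord c \<circ> \<gamma> has_vector_derivative v) (at t) \<and>
        speed_g \<gamma> t = sqrt (v \<bullet> (g c (coord c (\<gamma> t)) *v v))))"
proof -
  obtain n :: nat and s where s: "s 0 = 0" "s n = 1" "\<And>i. i < n \<Longrightarrow> s i < s (Suc i)"
      "\<And>i. i < n \<Longrightarrow> C1_curve_on \<A> {s i..s (Suc i)} \<gamma>"
    and cont: "continuous_map (top_of_set {0..1}) X \<gamma>"
    using \<gamma> by (auto simp: piecewise_C1_curve_def)
  have mono: "s i \<le> s j" if "i \<le> j" "j \<le> n" for i j
    using that
  proof (induction j rule: dec_induct)
    case (step k)
    then show ?case using s(3)[of k] by simp
  qed simp
  have sub: "0 \<le> s i" "s (Suc i) \<le> 1" if "i < n" for i
    using mono[of 0 i] mono[of "Suc i" n] that s by auto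
  have conti: "continuous_map (top_of_set {s i..s (Suc i)}) X \<gamma>" if "i < n" for i
    using cont sub[OF that] by (intro continuous_map_from_subtopology_mono[OF cont]) auto
  have piece: "speed_g \<gamma> integrable_on {s i..s (Suc i)}" if i: "i < n" for i
  proof -
    obtain q where q: "continuous_on {s i..s (Suc i)} q"
      "\<And>c t. c \<in> \<A> \<Longrightarrow> t \<in> {s i..s (Suc i)} \<Longrightarrow> \<gamma> t \<in> fst c \<Longrightarrow> q t = local_speed c \<gamma> {s i..s (Suc i)} t"
      by (rule local_speed_continuous[OF s(3)[OF i] conti[OF i] s(4)[OF i]]) (rule that)
    show ?thesis
    proof (rule integrable_spike_finite[of "{s i, s (Suc i)}" _ _ q])
      show "q integrable_on {s i..s (Suc i)}"
        using q(1) by (rule integrable_continuous_real)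
      fix t assume t: "t \<in> {s i..s (Suc i)} - {s i, s (Suc i)}"
      then have "\<gamma> t \<in> topspace X"
        using curve_in_space[OF \<gamma>, of t] sub[OF i] by auto
      then obtain c where "c \<in> \<A>" "\<gamma> t \<in> fst c"
        using manifold by (auto simp: smooth_manifold_def)
      then show "speed_g \<gamma> t = q t"
        using speed_eq_local(1)[OF \<open>c \<in> \<A>\<close> sub[OF i] _ _ conti[OF i] s(4)[OF i], of t] q(2)[of c t] t
        by auto
    qed simp
  qed
  have "speed_g \<gamma> integrable_on {0..s i}" if "i \<le> n" for i
    using that
  proof (induction i)
    case 0
    then show ?case
      using integrable_on_refl[of "speed_g \<gamma>" 0] by (simp add: s(1))
  next
    case (Suc i)
    then show ?case
      using sub(1)[of i] s(3)[of i] piece[of i]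
        Henstock_Kurzweil_Integration.integrable_combine[of 0 "s i" "s (Suc i)" "speed_g \<gamma>"]
      by simp
  qed
  then show "speed_g \<gamma> integrable_on {0..1}"
    using s(2) by fastforce
  have cover: "\<exists>i<n. s i < t \<and> t < s (Suc i)" if "0 < t" "t < 1" "t \<notin> s ` {..n}" for t
  proof -
    \<comment> \<open>The piece containing \<open>t\<close> ends at the first break point beyond
      \<open>t\<close>; minimality puts the preceding one before \<open>t\<close>.\<close>
    define i where "i = (LEAST i. t < s i)"
    have "t < s n" using that s by simp
    then have i: "t < s i" and least: "\<And>j. t < s j \<Longrightarrow> i \<le> j"
      unfolding i_def by (auto intro: LeastI Least_le)
    have "i \<le> n" using least \<open>t < s n\<close> by blast
    have "i \<noteq> 0" using i that s(1) by (metis less_asym)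
    then obtain j where j: "i = Suc j" using not0_implies_Suc by blast
    have "\<not> t < s j" using least[of j] j by auto
    moreover have "t \<noteq> s j" using that \<open>i \<le> n\<close> j by auto
    ultimately show ?thesis
      using i j \<open>i \<le> n\<close> by (intro exI[of _ j]) auto
  qed
  show "\<exists>S. finite S \<and> (\<forall>t\<in>{0<..<1} - S. \<forall>c\<in>\<A>. \<gamma> t \<in> fst c \<longrightarrow>
      (\<exists>v. (coord c \<circ> \<gamma> has_vector_derivative v) (at t) \<and>
        speed_g \<gamma> t = sqrt (v \<bullet> (g c (coord c (\<gamma> t)) *v v))))"
  proof (intro exI[of _ "s ` {..n}"] conjI ballI impI)
    fix t c assume t: "t \<in> {0<..<1} - s ` {..n}" and c: "c \<in> \<A>" "\<gamma> t \<in> fst c"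
    then obtain i where i: "i < n" "s i < t" "t < s (Suc i)"
      using cover[of t] by auto
    show "\<exists>v. (coord c \<circ> \<gamma> has_vector_derivative v) (at t) \<and>
        speed_g \<gamma> t = sqrt (v \<bullet> (g c (coord c (\<gamma> t)) *v v))"
      using speed_eq_local[OF c(1) sub[OF i(1)] i(2,3) conti[OF i(1)] s(4)[OF i(1)] c(2)]
      by (auto simp: local_speed_def)
  qed simp
qed

lemma curve_length_nonneg: "pw_C1 \<gamma> \<Longrightarrow> 0 \<le> length_g \<gamma>"
  unfolding curve_length_def
  by (intro integral_nonneg piecewise_speed(1) speed_nonneg curve_in_space) auto

text \<open>Fundamental theorem of calculus for \<open>F\<close> along the curve, whose derivative
  is dominated by the speed off finitely many points. It is applied to the identity, to confine a
  curve to a chart, and to an almost isometric \<open>P\<close>. The initial segment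
  \<open>{0..T}\<close> serves the first use, where nothing is known beyond
  \<open>T\<close>.\<close>

lemma curve_length_ge:
  fixes F :: "real ^ 'n \<Rightarrow> real ^ 'm"
  assumes \<gamma>: "pw_C1 \<gamma>" and c: "c \<in> \<A>" and "0 \<le> K" and T: "0 \<le> T" "T \<le> 1"
    and F: "\<And>x. x \<in> W \<Longrightarrow> (F has_derivative F' x) (at x)"
    and F': "\<And>x v. x \<in> W \<Longrightarrow> norm (F' x v) \<le> K * sqrt (v \<bullet> (g c x *v v))"
    and W: "\<And>t. t \<in> {0..T} \<Longrightarrow> \<gamma> t \<in> fst c \<and> coord c (\<gamma> t) \<in> W"
  shows "norm (F (coord c (\<gamma> T)) - F (coord c (\<gamma> 0))) \<le> K * length_g \<gamma>"
proof -
  obtain S where S: "finite S" "\<And>t c. t \<in> {0<..<1} - S \<Longrightarrow> c \<in> \<A> \<Longrightarrow> \<gamma> t \<in> fst c \<Longrightarrow>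
      (\<exists>v. (coord c \<circ> \<gamma> has_vector_derivative v) (at t) \<and>
        speed_g \<gamma> t = sqrt (v \<bullet> (g c (coord c (\<gamma> t)) *v v)))"
    using piecewise_speed(2)[OF \<gamma>] by blast
  define h where "h t = F (coord c (\<gamma> t))" for t
  \<comment> \<open>The default 0 keeps the bound by the nonnegative speed valid at the exceptional
    points.\<close>
  define h' where "h' t = (if t \<in> {0<..<T} - S then vector_derivative h (at t) else 0)" for t
  have sp0: "0 \<le> speed_g \<gamma> t" if "t \<in> {0..1}" for t
    using speed_nonneg curve_in_space[OF \<gamma> that] by blast
  have h': "(h has_vector_derivative h' t) (at t)" "norm (h' t) \<le> K * speed_g \<gamma> t"
    if t: "t \<in> {0<..<T} - S" for t
  proof -
    have t01: "t \<in> {0<..<1} - S"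
      using t T by auto
    have W': "\<gamma> t \<in> fst c" "coord c (\<gamma> t) \<in> W"
      using W[of t] t by auto
    obtain v where v: "(coord c \<circ> \<gamma> has_vector_derivative v) (at t)"
        "speed_g \<gamma> t = sqrt (v \<bullet> (g c (coord c (\<gamma> t)) *v v))"
      using S(2)[OF t01 c W'(1)] by blast
    let ?D = "F' (coord c (\<gamma> t))"
    have "(F \<circ> (coord c \<circ> \<gamma>) has_derivative ?D \<circ> (\<lambda>h. h *\<^sub>R v)) (at t)"
      using v(1) F[OF W'(2)] by (intro diff_chain_at) (auto simp: has_vector_derivative_def)
    then have d: "(h has_vector_derivative ?D v) (at t)"
      using has_derivative_linear[OF F[OF W'(2)]]
      by (simp add: has_vector_derivative_def o_def linear_cmul h_def[abs_def])
    then have "h' t = ?D v"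
      using t by (simp add: h'_def vector_derivative_at)
    then show "(h has_vector_derivative h' t) (at t)" "norm (h' t) \<le> K * speed_g \<gamma> t"
      using d F'[OF W'(2), of v] v(2) by auto
  qed
  have "continuous_on {0..T} h"
  proof -
    have "continuous_map (top_of_set {0..1}) X \<gamma>"
      using \<gamma> by (simp add: piecewise_C1_curve_def)
    then have "continuous_map (top_of_set {0..T}) X \<gamma>"
      by (rule continuous_map_from_subtopology_mono) (use T in auto)
    then have "continuous_map (top_of_set {0..T}) (subtopology X (fst c)) \<gamma>"
      using W by (auto simp: continuous_map_in_subtopology)
    then have "continuous_map (top_of_set {0..T}) euclidean (coord c \<circ> \<gamma>)"
      using continuous_map_coord[OF c] continuous_map_compose by blast
    then have 1: "continuous_on {0..T} (\<lambda>t. coord c (\<gamma> t))"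
      by (simp add: o_def)
    have "continuous_on W F"
      using F by (meson continuous_at_imp_continuous_on has_derivative_continuous)
    then show ?thesis
      unfolding h_def by (rule continuous_on_compose2[OF _ 1]) (use W in auto)
  qed
  note conth = this
  have int: "(h' has_integral h T - h 0) {0..T}"
    by (rule fundamental_theorem_of_calculus_interior_strong[OF S(1) T(1) _ conth]) (rule h'(1))
  have sp: "speed_g \<gamma> integrable_on {0..T}"
    by (rule integrable_on_subinterval[OF piecewise_speed(1)[OF \<gamma>]]) (use T in auto)
  have "norm (h T - h 0) = norm (integral {0..T} h')"
    using int by (simp add: integral_unique)
  also have "\<dots> \<le> integral {0..T} (\<lambda>t. K * speed_g \<gamma> t)"
  proof (rule Henstock_Kurzweil_Integration.integral_norm_bound_integral)
    show "h' integrable_on {0..T}"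
      using int by blast
    show "(\<lambda>t. K * speed_g \<gamma> t) integrable_on {0..T}"
      using sp by (rule integrable_on_mult_right)
    show "norm (h' t) \<le> K * speed_g \<gamma> t" if "t \<in> {0..T}" for t
      using h'(2)[of t] sp0[of t] that T \<open>0 \<le> K\<close> by (cases "t \<in> {0<..<T} - S") (auto simp: h'_def)
  qed
  also have "\<dots> = K * integral {0..T} (speed_g \<gamma>)"
    by simp
  also have "\<dots> \<le> K * length_g \<gamma>"
  proof (rule mult_left_mono[OF _ \<open>0 \<le> K\<close>])
    show "integral {0..T} (speed_g \<gamma>) \<le> length_g \<gamma>"
      unfolding curve_length_def
      by (rule integral_subset_le[OF _ sp piecewise_speed(1)[OF \<gamma>]]) (use T sp0 in auto)
  qed
  finally show ?thesis
    by (simp add: h_def)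
qed

lemma Riemannian_dist_le_curve:
  assumes "pw_C1 \<gamma>"
  shows "dist_g (\<gamma> 0) (\<gamma> 1) \<le> length_g \<gamma>"
proof -
  have "Inf {length_g \<gamma>' |\<gamma>'. pw_C1 \<gamma>' \<and> \<gamma>' 0 = \<gamma> 0 \<and> \<gamma>' 1 = \<gamma> 1} \<le> length_g \<gamma>"
  proof (rule cInf_lower)
    show "bdd_below {length_g \<gamma>' |\<gamma>'. pw_C1 \<gamma>' \<and> \<gamma>' 0 = \<gamma> 0 \<and> \<gamma>' 1 = \<gamma> 1}"
      using curve_length_nonneg by (intro bdd_belowI[of _ 0]) blast
  qed (use assms in blast)
  then show ?thesis
    using curve_in_space[OF assms, of 0] curve_in_space[OF assms, of 1] by (simp add: Riemannian_dist_def)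
qed

text \<open>A curve given in one chart must be certified \<open>C^1\<close> in every chart of the
  atlas before it competes in the infimum; the transition maps provide this.\<close>

lemma Riemannian_dist_le:
  assumes c: "c \<in> \<A>" and p: "\<And>t. t \<in> {0..1} \<Longrightarrow> p t \<in> codom c"
    and D: "\<And>t. t \<in> {0..1} \<Longrightarrow> (p has_vector_derivative D t) (at t within {0..1})"
    and contD: "continuous_on {0..1} D"
    and B: "\<And>t. t \<in> {0..1} \<Longrightarrow> sqrt (D t \<bullet> (g c (p t) *v D t)) \<le> B"
  shows "dist_g (param c (p 0)) (param c (p 1)) \<le> B"
proof -
  define \<gamma> where "\<gamma> t = param c (p t)" for t
  have contp: "continuous_on {0..1} p"
    unfolding continuous_on_eq_continuous_within
    by (rule ballI, rule has_vector_derivative_continuous, rule D)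
  have "continuous_map (top_of_set {0..1}) (top_of_set (codom c)) p"
    using contp p by (auto simp: continuous_map_in_subtopology)
  then have "continuous_map (top_of_set {0..1}) X (param c \<circ> p)"
    using continuous_map_param[OF c] continuous_map_compose by blast
  then have cont: "continuous_map (top_of_set {0..1}) X \<gamma>"
    by (simp add: \<gamma>_def[abs_def] o_def)
  have in_c: "\<gamma> t \<in> fst c" "coord c (\<gamma> t) = p t" if "t \<in> {0..1}" for t
    using p[OF that] by (simp_all add: \<gamma>_def param_in)
  have C1: "C1_curve_on \<A> {0..1} \<gamma>"
    unfolding C1_curve_on_def split_beta
  proof
    fix c' assume c': "c' \<in> \<A>"
    let ?T = "{t \<in> {0..1}. \<gamma> t \<in> fst c'}"
    let ?J = "\<lambda>x. frechet_derivative (transition c c') (at x)"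
    have pT: "p t \<in> coord c ` (fst c \<inter> fst c')" if "t \<in> ?T" for t
      using in_c[of t] that by (metis (no_types, lifting) IntI image_eqI mem_Collect_eq)
    have J: "(transition c c' has_derivative ?J (p t)) (at (p t))" if "t \<in> ?T" for t
      using transition_C1(1)[OF c c' pT[OF that]] .
    \<comment> \<open>The derivative of a transition is known to be continuous in each fixed
      direction, so the moving vector \<open>D t\<close> is expanded in the standard basis.\<close>
    have JD: "(\<Sum>i\<in>UNIV. D t $ i *\<^sub>R ?J (p t) (axis i 1)) = ?J (p t) (D t)" if "t \<in> ?T" for t
    proof -
      have lin: "linear (?J (p t))"
        using J[OF that] has_derivative_linear by blast
      have "D t = (\<Sum>i\<in>UNIV. D t $ i *\<^sub>R axis i 1)"
        using basis_expansion[of "D t"] by (simp add: scalar_mult_eq_scaleR)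
      then have "?J (p t) (D t) = ?J (p t) (\<Sum>i\<in>UNIV. D t $ i *\<^sub>R axis i 1)"
        by simp
      then show ?thesis
        by (simp add: linear_sum[OF lin] linear_cmul[OF lin])
    qed
    have contJ: "continuous_on ?T (\<lambda>t. \<Sum>i\<in>UNIV. D t $ i *\<^sub>R ?J (p t) (axis i 1))"
    proof (intro continuous_intros)
      show "continuous_on ?T D"
        using contD by (rule continuous_on_subset) auto
      have "continuous_on ?T p"
        using contp by (rule continuous_on_subset) auto
      then show "continuous_on ?T (\<lambda>t. ?J (p t) (axis i 1))" for i
        by (rule continuous_on_compose2[OF transition_C1(2)[OF c c']]) (use pT in auto)
    qed
    have "continuous_on ?T (\<lambda>t. ?J (p t) (D t))"
      by (rule continuous_on_eq[OF contJ JD])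
    moreover have "(coord c' \<circ> \<gamma> has_vector_derivative ?J (p t) (D t)) (at t within {0..1})" if t: "t \<in> ?T" for t
    proof -
      have t01: "t \<in> {0..1}" using t by simp
      have "(transition c c' \<circ> p has_derivative ?J (p t) \<circ> (\<lambda>h. h *\<^sub>R D t)) (at t within {0..1})"
        using D[OF t01] J[OF t] by (intro diff_chain_within) (auto simp: has_vector_derivative_def intro: has_derivative_at_withinI)
      moreover have "transition c c' \<circ> p = coord c' \<circ> \<gamma>"
        using c by (auto simp: fun_eq_iff transition_eq \<gamma>_def)
      ultimately show ?thesis
        using has_derivative_linear[OF J[OF t]]
        by (simp add: has_vector_derivative_def o_def linear_cmul)
    qed
    ultimately show "\<exists>D. continuous_on {t \<in> {0..1}. \<gamma> t \<in> fst c'} D \<and>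
        (\<forall>t\<in>{0..1}. \<gamma> t \<in> fst c' \<longrightarrow> (coord c' \<circ> \<gamma> has_vector_derivative D t) (at t within {0..1}))"
      by (intro exI[of _ "\<lambda>t. ?J (p t) (D t)"]) auto
  qed
  \<comment> \<open>A single piece: \<open>real\<close> sends the indices 0 and 1 to the end points
    of the interval.\<close>
  have \<gamma>: "pw_C1 \<gamma>"
    unfolding piecewise_C1_curve_def using cont C1
    by (intro conjI exI[of _ "1::nat"] exI[of _ "real"]) auto
  have vel: "vel c \<gamma> {0..1} t = D t" if "t \<in> {0..1}" for t
  proof -
    have "(coord c \<circ> \<gamma> has_vector_derivative D t) (at t within {0..1})"
      using D[OF that] in_c by (auto intro!: has_vector_derivative_transform[OF that _ D[OF that]])
    then show ?thesis
      unfolding vel_def using that by (intro vector_derivative_within_closed_interval) auto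
  qed
  obtain q where q: "continuous_on {0..1} q"
    "\<And>c t. c \<in> \<A> \<Longrightarrow> t \<in> {0..1} \<Longrightarrow> \<gamma> t \<in> fst c \<Longrightarrow> q t = local_speed c \<gamma> {0..1} t"
    by (rule local_speed_continuous[OF zero_less_one cont C1]) (rule that)
  have "length_g \<gamma> = integral {0..1} q"
    unfolding curve_length_def
  proof (rule integral_spike[of "{0, 1}"])
    show "q t = speed_g \<gamma> t" if "t \<in> {0..1} - {0, 1}" for t
      using that speed_eq_local(1)[OF c _ _ _ _ cont C1, of t] q(2)[OF c, of t] in_c(1)[of t] by auto
  qed simp
  also have "\<dots> \<le> integral {0..1} (\<lambda>t::real. B)"
    using q B vel in_c c
    by (intro integral_le integrable_continuous_real) (auto simp: local_speed_def)
  finally have "length_g \<gamma> \<le> B"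
    by simp
  then show ?thesis
    using Riemannian_dist_le_curve[OF \<gamma>] by (simp add: \<gamma>_def)
qed

text \<open>No gluing of curves is needed: were no curve to join \<open>p\<close> and \<open>q\<close>, their distance would be the
  junk value \<open>Inf {}\<close>, the same for all such pairs, hence positive in a metric space.\<close>

lemma short_curve:
  assumes "Metric_space (topspace X) dist_g"
  obtains r0 where "0 < r0"
    "\<And>p q r. p \<in> topspace X \<Longrightarrow> q \<in> topspace X \<Longrightarrow> p \<noteq> q \<Longrightarrow> dist_g p q < r \<Longrightarrow> r \<le> r0 \<Longrightarrow>
      \<exists>\<gamma>. pw_C1 \<gamma> \<and> \<gamma> 0 = p \<and> \<gamma> 1 = q \<and> length_g \<gamma> < r"
proof -
  interpret Metric_space "topspace X" dist_g
    by (rule assms)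
  define L where "L p q = {length_g \<gamma> |\<gamma>. pw_C1 \<gamma> \<and> \<gamma> 0 = p \<and> \<gamma> 1 = q}" for p q
  have dist: "dist_g p q = Inf (L p q)" if "p \<in> topspace X" "q \<in> topspace X" for p q
    using that by (simp add: Riemannian_dist_def L_def)
  \<comment> \<open>If \<open>Inf {}\<close> is positive, radii up to it exclude the absence of a
    curve; otherwise positivity of the distance already excludes it.\<close>
  define r0 :: real where "r0 = (if Inf {} > (0::real) then Inf {} else 1)"
  have "\<exists>\<gamma>. pw_C1 \<gamma> \<and> \<gamma> 0 = p \<and> \<gamma> 1 = q \<and> length_g \<gamma> < r"
    if pq: "p \<in> topspace X" "q \<in> topspace X" "p \<noteq> q" and r: "dist_g p q < r" "r \<le> r0" for p q r
  proof -
    have "L p q \<noteq> {}"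
    proof
      assume "L p q = {}"
      then have "dist_g p q = Inf {}"
        using dist pq by simp
      moreover have "dist_g p q > 0"
        using pq by (simp add: mdist_pos_less)
      ultimately show False
        using r by (simp add: r0_def)
    qed
    then obtain l where "l \<in> L p q" "l < r"
      using cInf_lessD[of "L p q" r] r dist pq by auto
    then show ?thesis
      by (auto simp: L_def)
  qed
  moreover have "r0 > 0"
    by (simp add: r0_def)
  ultimately show ?thesis
    using that by blast
qed

end

section \<open>Volume of small balls\<close>

locale riemannian_space = riemannian_manifold X \<A> g
  for X :: "'a topology" and \<A> :: "('a, 'n::finite) chart set" and g :: "('a, 'n) metric_tensor" +
  fixes \<mu> :: "'a measure"
  assumes volume: "is_Riemannian_volume X \<A> g \<mu>"
    and mms: "metric_measure_space (topspace X) dist_g \<mu>"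
begin

abbreviation lebesgue_value :: "('a \<Rightarrow> real) \<Rightarrow> 'a \<Rightarrow> real \<Rightarrow> bool"
  where "lebesgue_value \<equiv> has_lebesgue_value (topspace X) dist_g \<mu>"

abbreviation AMV :: "('a \<Rightarrow> real) \<Rightarrow> real \<Rightarrow> 'a \<Rightarrow> real"
  where "AMV u r \<equiv> AMV_approx (topspace X) dist_g \<mu> r u"

abbreviation SAMV :: "('a \<Rightarrow> real) \<Rightarrow> real \<Rightarrow> 'a \<Rightarrow> real"
  where "SAMV u r \<equiv> SAMV_approx (topspace X) dist_g \<mu> r u"

sublocale ms: Metric_space "topspace X" dist_g
  using mms by (simp add: metric_measure_space_def)

lemma space_\<mu>: "space \<mu> = topspace X"
  using volume by (simp add: is_Riemannian_volume_def)

text \<open>\<open>sets \<mu>\<close> is described by the open sets of \<open>X\<close> in the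
  volume hypothesis and by the metric topology in the metric measure space. Both descriptions are
  used, so coordinate sets and metric balls are measurable alike.\<close>

lemma openin_sets: "openin X V \<Longrightarrow> V \<in> sets \<mu>"
  using volume by (auto simp: is_Riemannian_volume_def borel_sets_of_def)

lemma mball_sets: "ms.mball p r \<in> sets \<mu>"
  using mms by (auto simp: metric_measure_space_def borel_sets_of_def)

lemma mball_finite: "emeasure \<mu> (ms.mball p r) < \<infinity>"
proof (cases "p \<in> topspace X \<and> r > 0")
  case True
  then show ?thesis
    using mms by (auto simp: metric_measure_space_def)
next
  case False
  then have "ms.mball p r = {}"
    using ms.mball_eq_empty by auto
  then show ?thesis
    by simp
qed

lemma mball_pos: "p \<in> topspace X \<Longrightarrow> 0 < r \<Longrightarrow> 0 < measure \<mu> (ms.mball p r)"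
  using mms mball_finite[of p r]
  by (auto simp: metric_measure_space_def measure_def enn2real_positive_iff)

lemma param_image_eq:
  assumes c: "c \<in> \<A>" and E: "E \<subseteq> codom c"
  shows "param c ` E = {q \<in> fst c. coord c q \<in> E}"
proof (intro equalityI subsetI)
  fix q assume "q \<in> param c ` E"
  then obtain x where x: "x \<in> E" "q = param c x"
    by blast
  then have "x \<in> codom c"
    using E by blast
  then show "q \<in> {q \<in> fst c. coord c q \<in> E}"
    using param_in[OF \<open>x \<in> codom c\<close>] x by simp
next
  fix q assume "q \<in> {q \<in> fst c. coord c q \<in> E}"
  then show "q \<in> param c ` E"
    using c by (intro image_eqI[of _ _ "coord c q"]) auto
qed

lemma openin_param_image:
  assumes "c \<in> \<A>" "open E" "E \<subseteq> codom c"
  shows "openin X (param c ` E)"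
  using openin_coord_preimage[OF assms(1,2)] param_image_eq[OF assms(1,3)] by simp

lemma emeasure_chart:
  assumes c: "c \<in> \<A>" and E: "open E" "E \<subseteq> codom c"
  shows "emeasure \<mu> (param c ` E) = (\<integral>\<^sup>+x\<in>E. ennreal (sqrt (det (g c x))) \<partial>lborel)"
proof -
  have "param c ` E \<in> borel_sets_of X"
    using openin_param_image[OF c E] by (auto simp: borel_sets_of_def)
  moreover have "param c ` E \<subseteq> fst c"
    using param_image_eq[OF c E(2)] by auto
  moreover have "coord c ` param c ` E = E"
    using E(2) by (force simp: image_image)
  ultimately show ?thesis
    using volume c by (auto simp: is_Riemannian_volume_def)
qed

text \<open>First exit argument. Up to the exit time the length bound keeps the coordinates in
  \<open>cball y \<beta>\<close> with \<open>\<beta> < \<rho>\<close>. The parametrised image of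
  this compact ball is closed in the Hausdorff space \<open>X\<close>, so the curve is still in it
  at the exit time, a contradiction. Closedness is taken in \<open>X\<close> because coordinates
  carry no information once the curve has left the chart.\<close>

lemma curve_stays_in_chart:
  assumes c: "c \<in> \<A>" and ball: "ball (coord c (\<gamma> 0)) \<rho> \<subseteq> codom c" and "\<gamma> 0 \<in> fst c"
    and "0 < a" and a: "\<And>x v. x \<in> ball (coord c (\<gamma> 0)) \<rho> \<Longrightarrow> a * (norm v)\<^sup>2 \<le> v \<bullet> (g c x *v v)"
    and \<gamma>: "pw_C1 \<gamma>" and len: "length_g \<gamma> < sqrt a * \<rho>"
    and t: "t \<in> {0..1}"
  shows "\<gamma> t \<in> fst c" "norm (coord c (\<gamma> t) - coord c (\<gamma> 0)) \<le> length_g \<gamma> / sqrt a"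
proof -
  define y where "y = coord c (\<gamma> 0)"
  define \<beta> where "\<beta> = length_g \<gamma> / sqrt a"
  have "\<beta> < \<rho>"
    using len \<open>0 < a\<close> by (simp add: \<beta>_def pos_divide_less_eq mult.commute)
  have "0 \<le> \<beta>"
    using curve_length_nonneg[OF \<gamma>] \<open>0 < a\<close> by (simp add: \<beta>_def)
  define V where "V = {q \<in> fst c. coord c q \<in> ball y \<rho>}"
  define N where "N = {t \<in> {0..1}. \<gamma> t \<notin> V}"
  have cont: "continuous_map (top_of_set {0..1}) X \<gamma>"
    using \<gamma> by (simp add: piecewise_C1_curve_def)
  have bound: "norm (coord c (\<gamma> s) - y) \<le> \<beta>" if s: "s \<in> {0..1}" "\<And>t. t \<in> {0..s} \<Longrightarrow> \<gamma> t \<in> V" for s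
  proof -
    have "norm (coord c (\<gamma> s) - coord c (\<gamma> 0)) \<le> 1 / sqrt a * length_g \<gamma>"
    proof (rule curve_length_ge[OF \<gamma> c, where F = "\<lambda>x. x" and F' = "\<lambda>x v. v" and W = "ball y \<rho>"])
      fix x v assume "x \<in> ball y \<rho>"
      have "sqrt (a * (norm v)\<^sup>2) \<le> sqrt (v \<bullet> (g c x *v v))"
        using a \<open>x \<in> ball y \<rho>\<close> by (simp add: y_def)
      then show "norm v \<le> 1 / sqrt a * sqrt (v \<bullet> (g c x *v v))"
        using \<open>0 < a\<close> by (simp add: real_sqrt_mult pos_le_divide_eq mult.commute)
    qed (use s \<open>0 < a\<close> in \<open>auto simp: V_def\<close>)
    then show ?thesis
      by (simp add: y_def \<beta>_def)
  qed
  have "N = {}"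
  proof (rule ccontr)
    assume "N \<noteq> {}"
    have "openin X V"
      unfolding V_def by (rule openin_coord_preimage[OF c open_ball])
    then have "closedin (top_of_set {0..1}) ({0..1} - {t \<in> {0..1}. \<gamma> t \<in> V})"
      using openin_continuous_map_preimage[OF cont, of V] by (intro closedin_diff) auto
    moreover have "{0..1} - {t \<in> {0..1}. \<gamma> t \<in> V} = N"
      by (auto simp: N_def)
    ultimately have "compact N"
      using closedin_compact_eq[of "{0..1::real}" N] by auto
    \<comment> \<open>The first time outside \<open>V\<close>, which exists because \<open>V\<close>
      is open.\<close>
    then obtain T where T: "T \<in> N" "\<And>t. t \<in> N \<Longrightarrow> T \<le> t"
      using compact_attains_inf[of N] \<open>N \<noteq> {}\<close> by blast
    have before: "\<gamma> t \<in> V" if "0 \<le> t" "t < T" for t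
      using T(2)[of t] T(1) that by (auto simp: N_def)
    have "\<gamma> 0 \<in> V"
      using assms(3) \<open>\<beta> < \<rho>\<close> \<open>0 \<le> \<beta>\<close> by (auto simp: V_def y_def)
    then have "T \<noteq> 0"
      using T(1) by (auto simp: N_def)
    then have T01: "0 < T" "T \<le> 1"
      using T(1) by (auto simp: N_def)
    define C where "C = param c ` cball y \<beta>"
    have cbim: "cball y \<beta> \<subseteq> codom c"
      using ball \<open>\<beta> < \<rho>\<close> by (auto simp: y_def)
    have "compactin X C"
      unfolding C_def
      by (rule image_compactin[OF _ continuous_map_param[OF c]]) (use cbim in \<open>simp add: compactin_subtopology\<close>)
    then have "closedin X C"
      using manifold compactin_imp_closedin by (auto simp: smooth_manifold_def)
    then have "closedin (top_of_set {0..1}) {t \<in> {0..1}. \<gamma> t \<in> C}"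
      using closedin_continuous_map_preimage[OF cont] by simp
    then have "closed {t \<in> {0..1}. \<gamma> t \<in> C}"
      using closedin_closed_trans by blast
    moreover have "{0..<T} \<subseteq> {t \<in> {0..1}. \<gamma> t \<in> C}"
    proof
      fix t assume t: "t \<in> {0..<T}"
      then have "norm (coord c (\<gamma> t) - y) \<le> \<beta>"
        using before T01 by (intro bound) auto
      moreover have "\<gamma> t \<in> fst c"
        using before[of t] t by (auto simp: V_def)
      ultimately show "t \<in> {t \<in> {0..1}. \<gamma> t \<in> C}"
        using t T01 c param_image_eq[OF c cbim] by (auto simp: C_def dist_norm norm_minus_commute)
    qed
    ultimately have "closure {0..<T} \<subseteq> {t \<in> {0..1}. \<gamma> t \<in> C}"
      by (rule closure_minimal[rotated])
    then have "\<gamma> T \<in> C"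
      using T01 subsetD[of "{0..T}" "{t \<in> {0..1}. \<gamma> t \<in> C}" T] by (simp add: closure_atLeastLessThan)
    then have "\<gamma> T \<in> V"
      using param_image_eq[OF c cbim] \<open>\<beta> < \<rho>\<close> by (auto simp: C_def V_def)
    then show False
      using T(1) by (simp add: N_def)
  qed
  then have V: "\<gamma> s \<in> V" if "s \<in> {0..1}" for s
    using that by (auto simp: N_def)
  show "\<gamma> t \<in> fst c"
    using V[OF t] by (simp add: V_def)
  show "norm (coord c (\<gamma> t) - coord c (\<gamma> 0)) \<le> length_g \<gamma> / sqrt a"
    using bound[OF t] V t by (auto simp: y_def \<beta>_def)
qed

text \<open>Collects what is used about one small ball. The last two clauses compare its volume with
  the Euclidean one in cross-multiplied form; the clause with \<open>e\<close> puts a coordinate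
  ball inside the metric ball.\<close>

definition ball_estimate :: "('a, 'n) chart \<Rightarrow> real \<Rightarrow> real \<Rightarrow> 'a \<Rightarrow> real \<Rightarrow> bool"
  where "ball_estimate c K B p r \<longleftrightarrow>
       ms.mball p r \<subseteq> fst c \<and> coord c ` ms.mball p r \<subseteq> ball (coord c p) (B * r) \<and>
       (\<exists>e>0. param c ` ball (coord c p) e \<subseteq> ms.mball p r) \<and>
       sqrt (1 - K * r\<^sup>2) ^ CARD('n) * measure \<mu> (ms.mball p r)
         \<le> sqrt (1 + K * r\<^sup>2) ^ CARD('n) * (measure lborel (ball (0 :: real ^ 'n) 1) * r ^ CARD('n)) \<and>
       sqrt (1 - K * r\<^sup>2) ^ CARD('n) * (measure lborel (ball (0 :: real ^ 'n) 1) * r ^ CARD('n))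
         \<le> sqrt (1 + K * r\<^sup>2) ^ CARD('n) * measure \<mu> (ms.mball p r)"

text \<open>With \<open>\<epsilon> = K * r^2\<close>, \<open>curve_length_ge\<close> shows that
  \<open>P\<close> maps a curve shorter than \<open>r\<close> into the Euclidean ball of radius
  \<open>r * sqrt (1 + \<epsilon>)\<close>, while \<open>radial_curve\<close> joins the centre to
  every point with \<open>norm (P x) < r * sqrt (1 - \<epsilon>)\<close> by a curve shorter than
  \<open>r\<close>.\<close>

lemma small_balls:
  assumes "p0 \<in> topspace X"
  obtains c \<rho> r1 K B where "c \<in> \<A>" "p0 \<in> fst c" "0 < \<rho>" "0 < r1" "0 \<le> K" "0 < B" "K * r1\<^sup>2 \<le> 1 / 2" "B * r1 \<le> \<rho>"
    "cball (coord c p0) (2 * \<rho>) \<subseteq> codom c"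
    "\<And>p r. p \<in> fst c \<Longrightarrow> coord c p \<in> ball (coord c p0) \<rho> \<Longrightarrow> 0 < r \<Longrightarrow> r < r1 \<Longrightarrow>
       ball_estimate c K B p r"
proof -
  obtain c where c: "c \<in> \<A>" and p0: "p0 \<in> fst c"
    using assms manifold by (auto simp: smooth_manifold_def)
  define x0 where "x0 = coord c p0"
  have "x0 \<in> codom c"
    using p0 by (simp add: x0_def)
  obtain \<rho> \<kappa> a where iso: "0 < \<rho>" "0 \<le> \<kappa>" "0 < a" "cball x0 (2 * \<rho>) \<subseteq> codom c" "\<kappa> * \<rho>\<^sup>2 \<le> 1 / 2"
    "\<And>x v. x \<in> cball x0 (2 * \<rho>) \<Longrightarrow> a * (norm v)\<^sup>2 \<le> v \<bullet> (g c x *v v)"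
    "\<And>y. y \<in> cball x0 \<rho> \<Longrightarrow> \<exists>P P'. almost_isometric_chart (g c) y \<rho> \<kappa> (sqrt a / 2) P P'"
    by (rule almost_isometric_charts[OF metric_C2[OF c] open_codom[OF c] \<open>x0 \<in> codom c\<close>])
      (use metric_sym[OF c] metric_pos[OF c] that in blast)+
  obtain r0 where r0: "0 < r0" "\<And>p q r. p \<in> topspace X \<Longrightarrow> q \<in> topspace X \<Longrightarrow> p \<noteq> q \<Longrightarrow>
      dist_g p q < r \<Longrightarrow> r \<le> r0 \<Longrightarrow>
      \<exists>\<gamma>. pw_C1 \<gamma> \<and> \<gamma> 0 = p \<and> \<gamma> 1 = q \<and> length_g \<gamma> < r"
    by (rule short_curve[OF ms.Metric_space_axioms]) (rule that)
  define \<sigma> where "\<sigma> = sqrt a / 2"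
  \<comment> \<open>Where \<open>norm (P x) < s\<close> and \<open>s \<le> 2 * r\<close>, the point
    lies within \<open>s / \<sigma> \<le> 4 * r / sqrt a\<close> of the centre; squaring gives the
    16, so the relative error is at most \<open>K * r^2\<close>.\<close>
  define K where "K = 16 * \<kappa> / a"
  define B where "B = 1 / sqrt a"
  \<comment> \<open>\<open>r0\<close> guarantees short curves; the other bound gives
    \<open>2 * r \<le> \<sigma> * \<rho> / 2\<close>, as the chart requires, and
    \<open>K * r^2 \<le> 1 / 8\<close>.\<close>
  define r1 where "r1 = min r0 (sqrt a * \<rho> / 8)"
  define n where "n = CARD('n)"
  define \<omega> where "\<omega> = measure lborel (ball (0 :: real ^ 'n) 1)"
  have pos: "0 < \<sigma>" "0 \<le> K" "0 < B" "0 < r1" "0 < sqrt a"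
    using iso r0 by (simp_all add: \<sigma>_def K_def B_def r1_def)
  have Kr: "K * r\<^sup>2 \<le> 1 / 8" if "0 < r" "r \<le> r1" for r
  proof -
    have "r\<^sup>2 \<le> (sqrt a * \<rho> / 8)\<^sup>2"
      using that by (intro power_mono) (auto simp: r1_def)
    then have "K * r\<^sup>2 \<le> K * (sqrt a * \<rho> / 8)\<^sup>2"
      using pos by (intro mult_left_mono)
    also have "\<dots> = \<kappa> * \<rho>\<^sup>2 / 4"
      using iso(3) by (simp add: K_def power_mult_distrib power_divide)
    also have "\<dots> \<le> 1 / 8"
      using iso(5) by simp
    finally show ?thesis .
  qed
  have "B * r1 \<le> \<rho>"
  proof -
    have "B * r1 \<le> B * (sqrt a * \<rho> / 8)"
      using pos by (intro mult_left_mono) (auto simp: r1_def)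
    also have "\<dots> = \<rho> / 8"
      using pos by (simp add: B_def)
    finally show ?thesis
      using iso(1) by simp
  qed
  have main: "ms.mball p r \<subseteq> fst c \<and> coord c ` ms.mball p r \<subseteq> ball (coord c p) (B * r) \<and>
       (\<exists>e>0. param c ` ball (coord c p) e \<subseteq> ms.mball p r) \<and>
       sqrt (1 - K * r\<^sup>2) ^ n * measure \<mu> (ms.mball p r) \<le> sqrt (1 + K * r\<^sup>2) ^ n * (\<omega> * r ^ n) \<and>
       sqrt (1 - K * r\<^sup>2) ^ n * (\<omega> * r ^ n) \<le> sqrt (1 + K * r\<^sup>2) ^ n * measure \<mu> (ms.mball p r)"
    if p: "p \<in> fst c" "coord c p \<in> ball x0 \<rho>" and r: "0 < r" "r < r1" for p r
  proof -
    define y where "y = coord c p"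
    define \<epsilon> where "\<epsilon> = K * r\<^sup>2"
    have \<epsilon>: "0 \<le> \<epsilon>" "\<epsilon> \<le> 1 / 8"
      using Kr[of r] r pos by (auto simp: \<epsilon>_def)
    have rr: "r \<le> r0" "r < sqrt a * \<rho> / 8"
      using r by (auto simp: r1_def)
    have pM: "p \<in> topspace X"
      using p chart_subset[OF c] by blast
    have ballK: "ball y \<rho> \<subseteq> cball x0 (2 * \<rho>)"
    proof
      fix x assume "x \<in> ball y \<rho>"
      then show "x \<in> cball x0 (2 * \<rho>)"
        using p dist_triangle[of x0 x y] by (simp add: y_def)
    qed
    have ballim: "ball y \<rho> \<subseteq> codom c"
      using ballK iso(4) by blast
    have lowera: "a * (norm v)\<^sup>2 \<le> v \<bullet> (g c x *v v)" if "x \<in> ball y \<rho>" for x v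
      using iso(6) ballK that by blast
    obtain P P' where ch: "almost_isometric_chart (g c) y \<rho> \<kappa> \<sigma> P P'"
      using iso(7)[of y] p by (auto simp: y_def \<sigma>_def)
    have sym: "transpose (g c x) = g c x" if "x \<in> ball y \<rho>" for x
      using metric_sym[OF c] ballim that by blast
    have posg: "0 < v \<bullet> (g c x *v v)" if "x \<in> ball y \<rho>" "v \<noteq> 0" for x v
      using metric_pos[OF c] ballim that by blast
    note ctx = ch pos(1) iso(2) iso(1) sym posg
    define E where "E s = {x \<in> ball y \<rho>. norm (P x) < s}" for s
    have E_eq: "chart_ball P y \<rho> s = E s" for s
      by (simp add: E_def chart_ball_def)
    have openE: "open (E s)" for s
      using open_chart_ball[OF ctx] unfolding E_eq .
    have Eim: "E s \<subseteq> codom c" for s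
      using ballim by (auto simp: E_def)
    \<comment> \<open>Radii up to \<open>2 * r\<close> include both
      \<open>r * sqrt (1 - \<epsilon>)\<close> and \<open>r * sqrt (1 + \<epsilon>)\<close>.\<close>
    have vol: "ennreal (sqrt (1 - \<epsilon>) ^ n) * emeasure \<mu> (param c ` E s) \<le> ennreal (\<omega> * s ^ n)"
      "ennreal (\<omega> * s ^ n) \<le> ennreal (sqrt (1 + \<epsilon>) ^ n) * emeasure \<mu> (param c ` E s)"
      if s: "0 < s" "s \<le> 2 * r" for s
    proof -
      have s1: "s \<le> \<sigma> * \<rho> / 2"
        using s rr by (simp add: \<sigma>_def)
      have "s / \<sigma> \<le> 4 * r / sqrt a"
        using s pos by (simp add: \<sigma>_def divide_right_mono)
      then have "(s / \<sigma>)\<^sup>2 \<le> (4 * r / sqrt a)\<^sup>2"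
        using s pos by (intro power_mono) auto
      then have "\<kappa> * (s / \<sigma>)\<^sup>2 \<le> \<kappa> * (4 * r / sqrt a)\<^sup>2"
        using iso(2) by (rule mult_left_mono)
      also have "\<dots> = \<epsilon>"
        using iso(3) by (simp add: \<epsilon>_def K_def power_mult_distrib power_divide)
      finally have s2: "\<kappa> * (s / \<sigma>)\<^sup>2 \<le> \<epsilon>" .
      have contg: "continuous_on (ball y \<rho>) (g c)"
        using continuous_on_metric[OF c] ballim continuous_on_subset by blast
      have "emeasure lborel (ball (0 :: real ^ 'n) s) = ennreal (\<omega> * s ^ n)"
        using s emeasure_lebesgue_ball_conv_unit_ball[of s "0 :: real ^ 'n"]
          emeasure_eq_ennreal_measure[of lborel "ball (0 :: real ^ 'n) 1"] emeasure_lborel_ball_finite[of "0 :: real ^ 'n" 1]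
        by (simp add: \<omega>_def n_def ennreal_mult' mult.commute less_top)
      then show "ennreal (sqrt (1 - \<epsilon>) ^ n) * emeasure \<mu> (param c ` E s) \<le> ennreal (\<omega> * s ^ n)"
        "ennreal (\<omega> * s ^ n) \<le> ennreal (sqrt (1 + \<epsilon>) ^ n) * emeasure \<mu> (param c ` E s)"
        using chart_ball_volume[OF ctx s(1) s1 s2 _ contg] \<epsilon> emeasure_chart[OF c openE Eim, of s]
        unfolding E_eq n_def by simp_all
    qed
    have outer: "q \<in> fst c \<and> coord c q \<in> ball y (B * r) \<and> coord c q \<in> E (r * sqrt (1 + \<epsilon>))"
      if q: "q \<in> ms.mball p r" for q
    \<comment> \<open>The centre is separate because \<open>short_curve\<close> speaks of distinct
      points.\<close>
    proof (cases "q = p")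
      case True
      then show ?thesis
        using p r pos iso(1) \<epsilon> chart_centre[OF ctx] by (simp add: y_def[symmetric] E_def add_pos_nonneg)
    next
      case False
      have "q \<in> topspace X" "dist_g p q < r"
        using q by auto
      then obtain \<gamma> where \<gamma>: "pw_C1 \<gamma>" "\<gamma> 0 = p" "\<gamma> 1 = q" "length_g \<gamma> < r"
        using r0(2)[OF pM _ _ _ rr(1)] False by metis
      have y: "coord c (\<gamma> 0) = y"
        by (simp add: \<gamma>(2) y_def)
      have len: "length_g \<gamma> < sqrt a * \<rho>"
        using \<gamma>(4) rr(2) mult_pos_pos[OF pos(5) iso(1)] by linarith
      have stay: "\<gamma> t \<in> fst c" "coord c (\<gamma> t) \<in> ball y (B * r)" if "t \<in> {0..1}" for t
      proof -
        have b: "ball (coord c (\<gamma> 0)) \<rho> \<subseteq> codom c" "\<gamma> 0 \<in> fst c"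
          using ballim p(1) \<gamma>(2) unfolding y by simp_all
        have l: "a * (norm v)\<^sup>2 \<le> v \<bullet> (g c x *v v)" if "x \<in> ball (coord c (\<gamma> 0)) \<rho>" for x v
          using lowera that unfolding y .
        have "\<gamma> t \<in> fst c \<and> norm (coord c (\<gamma> t) - y) \<le> length_g \<gamma> / sqrt a"
          using curve_stays_in_chart[OF c b iso(3) l \<gamma>(1) len that] unfolding y by blast
        moreover have "length_g \<gamma> / sqrt a < B * r"
          using \<gamma>(4) pos by (simp add: B_def divide_strict_right_mono)
        ultimately show "\<gamma> t \<in> fst c" "coord c (\<gamma> t) \<in> ball y (B * r)"
          by (auto simp: dist_norm norm_minus_commute)
      qed
      have sub: "ball y (B * r) \<subseteq> ball y \<rho>"
      proof (rule subset_ball)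
        have "r \<le> sqrt a * \<rho>"
          using rr(2) r(1) by linarith
        then show "B * r \<le> \<rho>"
          using pos by (simp add: B_def pos_divide_le_eq mult.commute)
      qed
      have "norm (P (coord c (\<gamma> 1)) - P (coord c (\<gamma> 0))) \<le> sqrt (1 + \<epsilon>) * length_g \<gamma>"
      proof (rule curve_length_ge[OF \<gamma>(1) c, where W = "ball y (B * r)" and F' = P'])
        show "(P has_derivative P' x) (at x)" if "x \<in> ball y (B * r)" for x
          using chart_derivative[OF ctx] sub that by blast
        show "norm (P' x v) \<le> sqrt (1 + \<epsilon>) * sqrt (v \<bullet> (g c x *v v))" if x: "x \<in> ball y (B * r)" for x v
        proof -
          have "norm (x - y) \<le> r / sqrt a"
            using x by (simp add: dist_norm norm_minus_commute B_def)
          then have "(norm (x - y))\<^sup>2 \<le> (r / sqrt a)\<^sup>2"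
            by (intro power_mono) auto
          then have "\<kappa> * (norm (x - y))\<^sup>2 \<le> \<kappa> * (r / sqrt a)\<^sup>2"
            using iso(2) by (rule mult_left_mono)
          also have "\<dots> \<le> \<epsilon>"
            using iso(2,3) by (simp add: \<epsilon>_def K_def power_divide divide_right_mono mult_right_mono)
          finally have "(norm (P' x v))\<^sup>2 \<le> (1 + \<epsilon>) * (v \<bullet> (g c x *v v))"
            using chart_quasi_isometry(2)[OF ctx, of x] x sub by blast
          then have "norm (P' x v) \<le> sqrt ((1 + \<epsilon>) * (v \<bullet> (g c x *v v)))"
            by (rule real_le_rsqrt)
          then show ?thesis
            by (simp only: real_sqrt_mult)
        qed
      qed (use stay \<epsilon> in auto)
      also have "\<dots> < sqrt (1 + \<epsilon>) * r"
        using \<gamma>(4) \<epsilon> by (intro mult_strict_left_mono) auto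
      finally have "norm (P (coord c q)) < r * sqrt (1 + \<epsilon>)"
        using chart_centre[OF ctx] by (simp add: \<gamma>(3) y mult.commute)
      then show ?thesis
        using stay[of 1] \<gamma>(3) sub by (auto simp: E_def)
    qed
    have inner: "param c ` E (r * sqrt (1 - \<epsilon>)) \<subseteq> ms.mball p r"
    proof
      fix q assume "q \<in> param c ` E (r * sqrt (1 - \<epsilon>))"
      then obtain x where x: "q = param c x" "x \<in> ball y \<rho>" "norm (P x) < r * sqrt (1 - \<epsilon>)"
        by (auto simp: E_def)
      have "r * sqrt (1 - \<epsilon>) \<le> r * 1"
        using r \<epsilon> by (intro mult_left_mono) auto
      then have Px: "norm (P x) < r"
        using x(3) by simp
      have z: "norm (P x) < \<sigma> * \<rho> / 2"
        using Px rr(2) r(1) unfolding \<sigma>_def by linarith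
      have "norm (P x) / \<sigma> \<le> 4 * r / sqrt a"
        using Px pos r by (simp add: \<sigma>_def divide_right_mono)
      then have "(norm (P x) / \<sigma>)\<^sup>2 \<le> (4 * r / sqrt a)\<^sup>2"
        using pos by (intro power_mono) auto
      then have "\<kappa> * (norm (P x) / \<sigma>)\<^sup>2 \<le> \<kappa> * (4 * r / sqrt a)\<^sup>2"
        using iso(2) by (rule mult_left_mono)
      also have "\<dots> = \<epsilon>"
        using iso(3) by (simp add: \<epsilon>_def K_def power_mult_distrib power_divide)
      finally have k: "\<kappa> * (norm (P x) / \<sigma>)\<^sup>2 \<le> \<epsilon>" .
      have "\<epsilon> < 1"
        using \<epsilon> by simp
      obtain w D where w: "w 0 = y" "w 1 = x" "\<And>t. t \<in> {0..1} \<Longrightarrow> w t \<in> ball y \<rho>"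
        "\<And>t. t \<in> {0..1} \<Longrightarrow> (w has_vector_derivative D t) (at t within {0..1})"
        "continuous_on {0..1} D"
        "\<And>t. t \<in> {0..1} \<Longrightarrow> sqrt (D t \<bullet> (g c (w t) *v D t)) \<le> norm (P x) / sqrt (1 - \<epsilon>)"
        by (rule radial_curve[OF ctx z x(2) k \<open>\<epsilon> < 1\<close> iso(3) lowera]) (assumption+, rule that)
      have "dist_g (param c (w 0)) (param c (w 1)) \<le> norm (P x) / sqrt (1 - \<epsilon>)"
        using w(3) ballim by (intro Riemannian_dist_le[OF c _ w(4) w(5) w(6)]) auto
      also have "\<dots> < r"
        using x(3) \<epsilon> by (simp add: pos_divide_less_eq)
      finally have "dist_g p q < r"
        using w(1,2) x(1) c p(1) by (simp add: y_def)
      moreover have "q \<in> topspace X"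
        using x(1,2) ballim param_in chart_subset[OF c] by blast
      ultimately show "q \<in> ms.mball p r"
        using pM by simp
    qed
    have out2: "ms.mball p r \<subseteq> param c ` E (r * sqrt (1 + \<epsilon>))"
      using outer param_image_eq[OF c Eim] by blast
    have sq: "sqrt (1 + \<epsilon>) \<le> 2" "sqrt (1 - \<epsilon>) \<le> 2" "0 < sqrt (1 + \<epsilon>)" "0 < sqrt (1 - \<epsilon>)"
      using \<epsilon> by (auto intro!: real_le_lsqrt)
    have em: "emeasure \<mu> (ms.mball p r) = ennreal (measure \<mu> (ms.mball p r))"
      using mball_finite[of p r] by (intro emeasure_eq_ennreal_measure) (simp add: less_top)
    have "\<exists>e>0. param c ` ball y e \<subseteq> ms.mball p r"
    proof -
      have "y \<in> E (r * sqrt (1 - \<epsilon>))"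
        using iso(1) r sq chart_centre[OF ctx] by (simp add: E_def)
      then obtain e where "e > 0" "ball y e \<subseteq> E (r * sqrt (1 - \<epsilon>))"
        using openE openE by (meson openE open_contains_ball)
      then show ?thesis
        using inner by blast
    qed
    moreover have "sqrt (1 - \<epsilon>) ^ n * measure \<mu> (ms.mball p r) \<le> sqrt (1 + \<epsilon>) ^ n * (\<omega> * r ^ n)"
    proof -
      have "emeasure \<mu> (ms.mball p r) \<le> emeasure \<mu> (param c ` E (r * sqrt (1 + \<epsilon>)))"
        by (rule emeasure_mono[OF out2 openin_sets[OF openin_param_image[OF c openE Eim]]])
      then have "ennreal (sqrt (1 - \<epsilon>) ^ n) * emeasure \<mu> (ms.mball p r)
          \<le> ennreal (sqrt (1 - \<epsilon>) ^ n) * emeasure \<mu> (param c ` E (r * sqrt (1 + \<epsilon>)))"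
        by (rule mult_left_mono) simp
      also have "\<dots> \<le> ennreal (\<omega> * (r * sqrt (1 + \<epsilon>)) ^ n)"
        using sq r by (intro vol(1)) (auto simp: mult.commute)
      finally have "ennreal (sqrt (1 - \<epsilon>) ^ n * measure \<mu> (ms.mball p r)) \<le> ennreal (\<omega> * (r * sqrt (1 + \<epsilon>)) ^ n)"
        using sq by (simp add: em ennreal_mult')
      then show ?thesis
        using sq r by (subst (asm) ennreal_le_iff) (auto simp: \<omega>_def power_mult_distrib mult_ac)
    qed
    moreover have "sqrt (1 - \<epsilon>) ^ n * (\<omega> * r ^ n) \<le> sqrt (1 + \<epsilon>) ^ n * measure \<mu> (ms.mball p r)"
    proof -
      have "ennreal (\<omega> * (r * sqrt (1 - \<epsilon>)) ^ n) \<le> ennreal (sqrt (1 + \<epsilon>) ^ n) * emeasure \<mu> (param c ` E (r * sqrt (1 - \<epsilon>)))"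
        using sq r by (intro vol(2)) (auto simp: mult.commute)
      also have "\<dots> \<le> ennreal (sqrt (1 + \<epsilon>) ^ n) * emeasure \<mu> (ms.mball p r)"
        by (rule mult_left_mono[OF emeasure_mono[OF inner mball_sets]]) simp
      finally have "ennreal (\<omega> * (r * sqrt (1 - \<epsilon>)) ^ n) \<le> ennreal (sqrt (1 + \<epsilon>) ^ n * measure \<mu> (ms.mball p r))"
        using sq by (simp add: em ennreal_mult')
      then show ?thesis
        using sq by (subst (asm) ennreal_le_iff) (auto simp: power_mult_distrib mult_ac)
    qed
    ultimately show ?thesis
      using outer unfolding \<epsilon>_def[symmetric] y_def[symmetric] by blast
  qed
  show ?thesis
  proof (rule that[of c \<rho> r1 K B])
    show "K * r1\<^sup>2 \<le> 1 / 2"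
      using Kr[of r1] pos by simp
  qed (use c p0 iso pos \<open>B * r1 \<le> \<rho>\<close> main in \<open>simp_all add: x0_def n_def \<omega>_def ball_estimate_def\<close>)
qed

end

section \<open>From ball volumes to volume ratios\<close>

lemma power_one_plus_le:
  fixes x :: real
  assumes "0 \<le> x" "x \<le> 2"
  shows "(1 + x) ^ n \<le> 1 + real n * 3 ^ n * x"
proof (induction n)
  case (Suc n)
  have "(1 + x) ^ Suc n \<le> (1 + x) * (1 + real n * 3 ^ n * x)"
    using Suc assms by (simp add: mult_left_mono)
  also have "\<dots> = 1 + x + (1 + x) * (real n * 3 ^ n * x)"
    by (simp add: algebra_simps)
  also have "\<dots> \<le> 1 + 3 ^ Suc n * x + 3 * (real n * 3 ^ n * x)"
  proof (intro add_mono mult_right_mono order_refl)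
    show "x \<le> 3 ^ Suc n * x"
      using assms mult_right_mono[of 1 "3 ^ Suc n" x] one_le_power[of "3::real" "Suc n"] by simp
  qed (use assms in auto)
  also have "\<dots> = 1 + real (Suc n) * 3 ^ Suc n * x"
    by (simp add: algebra_simps)
  finally show ?case .
qed simp

text \<open>One side is the bound on \<open>a / b\<close>; for the other,
  \<open>a / b + b / a \<ge> 2\<close> turns the bound on \<open>b / a\<close> into one on
  \<open>1 - a / b\<close>.\<close>

lemma abs_one_minus_ratio_le:
  fixes a b h :: real
  assumes "0 < a" "0 < b" "a \<le> h * b" "b \<le> h * a"
  shows "\<bar>1 - a / b\<bar> \<le> h - 1"
proof -
  have "a / b \<le> h" "b / a \<le> h"
    using assms by (simp_all add: pos_divide_le_eq)
  moreover have "2 \<le> a / b + b / a"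
  proof -
    have "2 * (a * b) \<le> a * a + b * b"
      using sum_squares_bound[of a b] by (simp add: power2_eq_square)
    then show ?thesis
      using assms(1,2) by (simp add: field_simps)
  qed
  ultimately show ?thesis
    by linarith
qed

context riemannian_space
begin

text \<open>Both balls are compared with the same Euclidean volume. The centre \<open>q\<close>
  varies but stays in the coordinate ball on which the constants of \<open>small_balls\<close> are
  uniform.\<close>

lemma mball_measure_ratio:
  assumes "p \<in> topspace X"
  obtains r2 C where "0 < r2" "0 \<le> C"
    "\<And>r q. 0 < r \<Longrightarrow> r < r2 \<Longrightarrow> q \<in> ms.mball p r \<Longrightarrow>
      \<bar>1 - measure \<mu> (ms.mball p r) / measure \<mu> (ms.mball q r)\<bar> \<le> C * r\<^sup>2"
proof -
  define n where "n = CARD('n)"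
  obtain c \<rho> r1 K B where sb: "c \<in> \<A>" "p \<in> fst c" "0 < \<rho>" "0 < r1" "0 \<le> K" "0 < B" "K * r1\<^sup>2 \<le> 1 / 2" "B * r1 \<le> \<rho>"
    "cball (coord c p) (2 * \<rho>) \<subseteq> codom c"
    "\<And>q r. q \<in> fst c \<Longrightarrow> coord c q \<in> ball (coord c p) \<rho> \<Longrightarrow> 0 < r \<Longrightarrow> r < r1 \<Longrightarrow>
       ball_estimate c K B q r"
    by (rule small_balls[OF assms]) (rule that)
  show ?thesis
  proof
    show "0 < r1" "0 \<le> real n * 3 ^ n * (4 * K)"
      using sb by auto
    fix r q assume r: "0 < r" "r < r1" and q: "q \<in> ms.mball p r"
    define \<epsilon> where "\<epsilon> = K * r\<^sup>2"
    define W where "W = measure lborel (ball (0 :: real ^ 'n) 1) * r ^ n"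
    define lo where "lo = sqrt (1 - \<epsilon>) ^ n"
    define hi where "hi = sqrt (1 + \<epsilon>) ^ n"
    have "\<epsilon> \<le> K * r1\<^sup>2"
      unfolding \<epsilon>_def using r sb(5) by (intro mult_left_mono power_mono) auto
    then have \<epsilon>: "0 \<le> \<epsilon>" "\<epsilon> \<le> 1 / 2"
      using sb(5,7) by (auto simp: \<epsilon>_def)
    have lohi: "0 < lo" "0 < hi"
      using \<epsilon> by (simp_all add: lo_def hi_def add_pos_nonneg)
    have pp: "coord c p \<in> ball (coord c p) \<rho>"
      using sb(3) by simp
    have "coord c q \<in> ball (coord c p) (B * r)" "q \<in> fst c"
      using sb(10)[OF sb(2) pp r, unfolded ball_estimate_def] q by blast+
    moreover have "B * r \<le> \<rho>"
      using r sb(6,8) by (smt (verit) mult_left_mono)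
    ultimately have qq: "q \<in> fst c" "coord c q \<in> ball (coord c p) \<rho>"
      by auto
    have est: "lo * measure \<mu> (ms.mball x r) \<le> hi * W" "lo * W \<le> hi * measure \<mu> (ms.mball x r)"
      if "x = p \<or> x = q" for x
      using sb(10)[OF sb(2) pp r, unfolded ball_estimate_def] sb(10)[OF qq r, unfolded ball_estimate_def] that by (auto simp: lo_def hi_def W_def n_def \<epsilon>_def)
    \<comment> \<open>Passing through \<open>W\<close> costs \<open>hi / lo\<close> on each side,
      hence the square, which also removes the square roots below.\<close>
    have cmp: "measure \<mu> (ms.mball x r) \<le> (hi / lo)\<^sup>2 * measure \<mu> (ms.mball z r)"
      if "x = p \<or> x = q" "z = p \<or> z = q" for x z
    proof -
      have "lo * (lo * measure \<mu> (ms.mball x r)) \<le> lo * (hi * W)"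
        using est(1)[OF that(1)] lohi by (intro mult_left_mono) auto
      also have "\<dots> = hi * (lo * W)"
        by simp
      also have "\<dots> \<le> hi * (hi * measure \<mu> (ms.mball z r))"
        using est(2)[OF that(2)] lohi by (intro mult_left_mono) auto
      finally show ?thesis
        using lohi by (simp add: power2_eq_square field_simps)
    qed
    have "q \<in> topspace X"
      using q by auto
    then have "\<bar>1 - measure \<mu> (ms.mball p r) / measure \<mu> (ms.mball q r)\<bar> \<le> (hi / lo)\<^sup>2 - 1"
      using mball_pos assms r cmp by (intro abs_one_minus_ratio_le) auto
    also have "(hi / lo)\<^sup>2 = ((1 + \<epsilon>) / (1 - \<epsilon>)) ^ n"
    proof -
      have "(hi / lo)\<^sup>2 = ((sqrt (1 + \<epsilon>))\<^sup>2 / (sqrt (1 - \<epsilon>))\<^sup>2) ^ n"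
        by (simp add: lo_def hi_def power_divide power_mult[symmetric] mult.commute)
      then show ?thesis
        using \<epsilon> by simp
    qed
    also have "\<dots> \<le> (1 + 4 * \<epsilon>) ^ n"
    proof (rule power_mono)
      \<comment> \<open>After clearing the denominator, the claim below is twice this
        inequality.\<close>
      have "0 \<le> \<epsilon> * (1 - 2 * \<epsilon>)"
        using \<epsilon> by simp
      then show "(1 + \<epsilon>) / (1 - \<epsilon>) \<le> 1 + 4 * \<epsilon>"
        using \<epsilon> by (simp add: pos_divide_le_eq algebra_simps)
    qed (use \<epsilon> in auto)
    also have "\<dots> \<le> 1 + real n * 3 ^ n * (4 * \<epsilon>)"
      using \<epsilon> by (intro power_one_plus_le) auto
    finally show "\<bar>1 - measure \<mu> (ms.mball p r) / measure \<mu> (ms.mball q r)\<bar> \<le> real n * 3 ^ n * (4 * K) * r\<^sup>2"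
      by (simp add: \<epsilon>_def mult_ac)
  qed
qed

text \<open>Continuity from below of \<open>\<mu>\<close> makes the volume of a ball a lower semicontinuous function of its centre.\<close>

lemma borel_measurable_mball: "(\<lambda>y. measure \<mu> (ms.mball y r)) \<in> borel_measurable \<mu>"
  unfolding borel_measurable_iff_greater
proof
  fix t :: real
  have "openin ms.mtopology {y \<in> topspace X. t < measure \<mu> (ms.mball y r)}"
    unfolding ms.openin_mtopology
  proof (intro conjI allI impI)
    fix y assume "y \<in> {y \<in> topspace X. t < measure \<mu> (ms.mball y r)}"
    then have y: "y \<in> topspace X" "t < measure \<mu> (ms.mball y r)"
      by auto
    define S where "S k = ms.mball y (r - inverse (real (Suc k)))" for k
    have "incseq S"
    proof (rule incseq_SucI)
      fix k
      have "inverse (real (Suc (Suc k))) \<le> inverse (real (Suc k))"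
        by (intro le_imp_inverse_le) auto
      then show "S k \<subseteq> S (Suc k)"
        unfolding S_def by (intro ms.mball_subset_concentric) simp
    qed
    moreover have "(\<Union>k. S k) = ms.mball y r"
    proof
      show "(\<Union>k. S k) \<subseteq> ms.mball y r"
        unfolding S_def by (intro UN_least ms.mball_subset_concentric) simp
      show "ms.mball y r \<subseteq> (\<Union>k. S k)"
      proof
        fix z assume z: "z \<in> ms.mball y r"
        then have "0 < r - dist_g y z"
          by simp
        then obtain k where "inverse (real (Suc k)) < r - dist_g y z"
          using reals_Archimedean by blast
        then show "z \<in> (\<Union>k. S k)"
          using z by (auto simp: S_def intro!: exI[of _ k])
      qed
    qed
    ultimately have "(\<lambda>k. measure \<mu> (S k)) \<longlonglongrightarrow> measure \<mu> (ms.mball y r)"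
      using Lim_measure_incseq[of S \<mu>] mball_sets mball_finite[of y r]
      by (auto simp: S_def less_top)
    then have "\<forall>\<^sub>F k in sequentially. t < measure \<mu> (S k)"
      using y(2) by (rule order_tendstoD)
    then obtain k where k: "t < measure \<mu> (S k)"
      using eventually_happens by fastforce
    \<comment> \<open>Exactly the radius given up in \<open>S k\<close>: a centre moved by less than
      \<open>\<delta>\<close> still has \<open>S k\<close> inside its ball of radius
      \<open>r\<close>.\<close>
    define \<delta> where "\<delta> = inverse (real (Suc k))"
    show "\<exists>e>0. ms.mball y e \<subseteq> {y \<in> topspace X. t < measure \<mu> (ms.mball y r)}"
    proof (intro exI[of _ \<delta>] conjI subsetI)
      fix z assume z: "z \<in> ms.mball y \<delta>"
      have "S k \<subseteq> ms.mball z r"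
      proof
        fix w assume w: "w \<in> S k"
        have "dist_g z w \<le> dist_g z y + dist_g y w"
          using z w by (intro ms.triangle) (auto simp: S_def)
        then show "w \<in> ms.mball z r"
          using z w by (auto simp: S_def \<delta>_def ms.commute)
      qed
      then have "measure \<mu> (S k) \<le> measure \<mu> (ms.mball z r)"
        using mball_sets mball_finite[of z r]
        by (intro measure_mono_fmeasurable) (auto simp: S_def fmeasurable_def)
      then show "z \<in> {y \<in> topspace X. t < measure \<mu> (ms.mball y r)}"
        using k z by auto
    qed (simp add: \<delta>_def)
  qed auto
  then show "{w \<in> space \<mu>. t < measure \<mu> (ms.mball w r)} \<in> sets \<mu>"
    using mms by (auto simp: space_\<mu> metric_measure_space_def borel_sets_of_def)
qed

section \<open>Lebesgue points\<close>

lemma measurable_param: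
  assumes c: "c \<in> \<A>" and W: "open W" "W \<subseteq> codom c"
  shows "param c \<in> measurable (restrict_space borel W) \<mu>"
proof (rule measurable_sigma_sets)
  show "sets \<mu> = sigma_sets (topspace X) {U. openin X U}"
    using volume by (simp add: is_Riemannian_volume_def borel_sets_of_def)
  show "{U. openin X U} \<subseteq> Pow (topspace X)"
    using openin_subset by auto
  show "param c \<in> space (restrict_space borel W) \<rightarrow> topspace X"
  proof
    fix x assume "x \<in> space (restrict_space borel W)"
    then have "x \<in> codom c"
      using W(2) by (auto simp: space_restrict_space)
    then show "param c x \<in> topspace X"
      using param_in chart_subset[OF c] by blast
  qed
  fix V assume "V \<in> {U. openin X U}"
  then have "openin (top_of_set (codom c)) {x \<in> codom c. param c x \<in> V}"
    using openin_continuous_map_preimage[OF continuous_map_param[OF c]] by simp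
  then have "open {x \<in> codom c. param c x \<in> V}"
    using open_codom[OF c] openin_open_trans by blast
  moreover have "param c -` V \<inter> space (restrict_space borel W) = {x \<in> codom c. param c x \<in> V} \<inter> W"
    using W(2) by (auto simp: space_restrict_space)
  ultimately show "param c -` V \<inter> space (restrict_space borel W) \<in> sets (restrict_space borel W)"
    unfolding sets_restrict_space by (intro image_eqI[of _ _ "{x \<in> codom c. param c x \<in> V}"]) auto
qed

lemma measurable_coord:
  assumes c: "c \<in> \<A>" and W: "open W" "W \<subseteq> codom c"
  shows "coord c \<in> borel_measurable (restrict_space \<mu> (param c ` W))"
proof (rule borel_measurableI)
  fix S :: "(real ^ 'n) set" assume "open S"
  have V: "param c ` W \<in> sets \<mu>"
    using openin_param_image[OF c W] by (rule openin_sets)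
  have "coord c -` S \<inter> space (restrict_space \<mu> (param c ` W)) = {q \<in> fst c. coord c q \<in> S} \<inter> param c ` W"
    using param_image_eq[OF c W(2)] V sets.sets_into_space by (fastforce simp: space_restrict_space)
  moreover have "{q \<in> fst c. coord c q \<in> S} \<in> sets \<mu>"
    using openin_coord_preimage[OF c \<open>open S\<close>] by (rule openin_sets)
  ultimately show "coord c -` S \<inter> space (restrict_space \<mu> (param c ` W)) \<in> sets (restrict_space \<mu> (param c ` W))"
    using V by (auto simp: sets_restrict_space)
qed

lemma measurable_density:
  assumes c: "c \<in> \<A>" and W: "open W" "W \<subseteq> codom c"
  shows "(\<lambda>x. ennreal (sqrt (det (g c x))) * indicator W x) \<in> borel_measurable borel"
proof -
  have "(\<lambda>x. indicator W x *\<^sub>R sqrt (det (g c x))) \<in> borel_measurable borel"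
    using W continuous_on_subset[OF continuous_on_metric[OF c] W(2)]
    by (intro borel_measurable_continuous_on_indicator continuous_on_real_sqrt continuous_on_det) auto
  then have "(\<lambda>x. ennreal (indicator W x *\<^sub>R sqrt (det (g c x)))) \<in> borel_measurable borel"
    by simp
  then show ?thesis
    by (rule measurable_cong[THEN iffD1, rotated]) (auto simp: indicator_def)
qed

text \<open>The definition of the volume measures Borel sets; read as a push-forward identity, it
  transports integrals to coordinates.\<close>

lemma distr_coord:
  assumes c: "c \<in> \<A>" and W: "open W" "W \<subseteq> codom c"
  shows "distr (restrict_space \<mu> (param c ` W)) borel (coord c)
    = density lborel (\<lambda>x. ennreal (sqrt (det (g c x))) * indicator W x)"
proof (rule measure_eqI)
  fix A assume "A \<in> sets (distr (restrict_space \<mu> (param c ` W)) borel (coord c))"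
  then have A: "A \<in> sets borel" by simp
  let ?V = "param c ` W"
  have V: "?V \<in> sets \<mu>"
    using openin_param_image[OF c W] by (rule openin_sets)
  note m = measurable_coord[OF c W]
  define B where "B = coord c -` A \<inter> ?V"
  have B_eq: "B = coord c -` A \<inter> space (restrict_space \<mu> ?V)"
    using V sets.sets_into_space by (auto simp: B_def space_restrict_space)
  have "B \<in> sets (restrict_space \<mu> ?V)"
    unfolding B_eq using m A by (rule measurable_sets)
  then have "B \<in> sets \<mu>"
    using V sets_restrict_space_subset[of ?V \<mu>] by (auto simp: sets_restrict_space)
  then have B: "B \<in> borel_sets_of X"
    using volume by (simp add: is_Riemannian_volume_def)
  have B_sub: "B \<subseteq> fst c"
    using param_image_eq[OF c W(2)] by (auto simp: B_def)
  have B_im: "coord c ` B = A \<inter> W"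
  proof (intro equalityI subsetI)
    fix x assume "x \<in> A \<inter> W"
    then show "x \<in> coord c ` B"
      using W(2) by (intro image_eqI[of _ _ "param c x"]) (auto simp: B_def subset_iff)
  next
    fix x assume "x \<in> coord c ` B"
    then show "x \<in> A \<inter> W"
      using param_image_eq[OF c W(2)] by (auto simp: B_def)
  qed
  have "emeasure (distr (restrict_space \<mu> ?V) borel (coord c)) A = emeasure (restrict_space \<mu> ?V) B"
    unfolding B_eq using m A by (rule emeasure_distr)
  also have "\<dots> = emeasure \<mu> B"
    using V by (intro emeasure_restrict_space) (auto simp: B_def)
  also have "\<dots> = (\<integral>\<^sup>+x\<in>A \<inter> W. ennreal (sqrt (det (g c x))) \<partial>lborel)"
    using volume c B B_sub unfolding is_Riemannian_volume_def B_im[symmetric] by blast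
  also have "\<dots> = (\<integral>\<^sup>+x\<in>A. (ennreal (sqrt (det (g c x))) * indicator W x) \<partial>lborel)"
    by (intro nn_integral_cong) (auto simp: indicator_def)
  also have "\<dots> = emeasure (density lborel (\<lambda>x. ennreal (sqrt (det (g c x))) * indicator W x)) A"
    using measurable_density[OF c W] A by (simp add: emeasure_density)
  finally show "emeasure (distr (restrict_space \<mu> ?V) borel (coord c)) A
    = emeasure (density lborel (\<lambda>x. ennreal (sqrt (det (g c x))) * indicator W x)) A" .
qed simp

lemma nn_integral_chart:
  assumes c: "c \<in> \<A>" and W: "open W" "W \<subseteq> codom c" and F: "F \<in> borel_measurable borel"
  shows "(\<integral>\<^sup>+q\<in>param c ` W. F (coord c q) \<partial>\<mu>) = (\<integral>\<^sup>+x. ennreal (sqrt (det (g c x))) * indicator W x * F x \<partial>lborel)"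
proof -
  have V: "param c ` W \<in> sets \<mu>"
    using openin_param_image[OF c W] by (rule openin_sets)
  have "(\<integral>\<^sup>+q\<in>param c ` W. F (coord c q) \<partial>\<mu>) = (\<integral>\<^sup>+q. F (coord c q) \<partial>restrict_space \<mu> (param c ` W))"
    using V by (simp add: nn_integral_restrict_space)
  also have "\<dots> = (\<integral>\<^sup>+x. F x \<partial>distr (restrict_space \<mu> (param c ` W)) borel (coord c))"
    using F by (intro nn_integral_distr[OF measurable_coord[OF c W], symmetric]) simp
  also have "\<dots> = (\<integral>\<^sup>+x. ennreal (sqrt (det (g c x))) * indicator W x * F x \<partial>lborel)"
    unfolding distr_coord[OF c W] using measurable_density[OF c W] F by (intro nn_integral_density) auto
  finally show ?thesis .
qed

lemma det_metric_bounds: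
  assumes c: "c \<in> \<A>" and K: "compact K" "K \<subseteq> codom c" "K \<noteq> {}"
  obtains l h :: real where "0 < l" "0 < h" "\<And>x. x \<in> K \<Longrightarrow> l \<le> sqrt (det (g c x)) \<and> sqrt (det (g c x)) \<le> h"
proof -
  have cont: "continuous_on K (\<lambda>x. sqrt (det (g c x)))"
    by (intro continuous_on_real_sqrt continuous_on_det continuous_on_subset[OF continuous_on_metric[OF c] K(2)])
  have pos: "0 < sqrt (det (g c x))" if "x \<in> K" for x
  proof -
    have "x \<in> codom c" using that K by blast
    obtain S :: "real ^ 'n ^ 'n" where S: "transpose S ** S = g c x"
      by (rule posdef_imp_Gram[OF metric_sym[OF c \<open>x \<in> codom c\<close>] metric_pos[OF c \<open>x \<in> codom c\<close>]])
    \<comment> \<open>\<open>S\<close> is compared with its own Gram matrix, so both constants can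
      be 1.\<close>
    have "0 < det (g c x)"
      using sqrt_det_comparison(3)[OF metric_sym[OF c \<open>x \<in> codom c\<close>] metric_pos[OF c \<open>x \<in> codom c\<close>] zero_less_one, of S 1]
        norm_Gram[of S] by (simp add: S)
    then show ?thesis by simp
  qed
  obtain xl xh where "xl \<in> K" "\<And>x. x \<in> K \<Longrightarrow> sqrt (det (g c xl)) \<le> sqrt (det (g c x))"
    "xh \<in> K" "\<And>x. x \<in> K \<Longrightarrow> sqrt (det (g c x)) \<le> sqrt (det (g c xh))"
    using continuous_attains_inf[OF K(1,3) cont] continuous_attains_sup[OF K(1,3) cont] by metis
  then show ?thesis
    using that[of "sqrt (det (g c xl))" "sqrt (det (g c xh))"] pos by blast
qed

section \<open>Lebesgue values of a locally integrable function and the two approximants\<close>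

context
  fixes u :: "'a \<Rightarrow> real"
  assumes L1: "L1_loc (topspace X) dist_g \<mu> u"
begin

lemma u_measurable [measurable]: "u \<in> borel_measurable \<mu>"
  using L1 by (simp add: L1_loc_def)

lemma integrable_small_mball:
  assumes "p \<in> topspace X"
  obtains r3 where "0 < r3" "\<And>r a. r \<le> r3 \<Longrightarrow> set_integrable \<mu> (ms.mball p r) (\<lambda>y. u y - a)"
proof -
  obtain r3 where r3: "0 < r3" "set_integrable \<mu> (ms.mball p r3) u"
    using L1 assms by (auto simp: L1_loc_def)
  have "set_integrable \<mu> (ms.mball p r) (\<lambda>y. u y - a)" if "r \<le> r3" for r a
  proof (rule set_integral_diff(1))
    show "set_integrable \<mu> (ms.mball p r) u"
      using r3(2) mball_sets by (rule set_integrable_subset) (rule ms.mball_subset_concentric[OF that])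
    show "set_integrable \<mu> (ms.mball p r) (\<lambda>y. a)"
      using mball_finite mball_sets by (simp add: set_integrable_def integrable_indicator_iff)
  qed
  with r3(1) show ?thesis
    using that by blast
qed

text \<open>Two candidates differ by at most the sum of their mean deviations over every small ball,
  and these tend to 0. This uniqueness gives the definite description in \<open>leb_value\<close>
  its meaning.\<close>

lemma leb_value_eq:
  assumes p: "p \<in> topspace X" and a: "lebesgue_value u p a"
  shows "leb_value (topspace X) dist_g \<mu> u p = a"
  unfolding leb_value_def
proof (rule the_equality, rule a)
  fix b assume b: "lebesgue_value u p b"
  obtain r3 where r3: "0 < r3" "\<And>r a. r \<le> r3 \<Longrightarrow> set_integrable \<mu> (ms.mball p r) (\<lambda>y. u y - a)"
    by (rule integrable_small_mball[OF p]) (rule that)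
  have le: "\<bar>b - a\<bar> \<le> avg \<mu> (ms.mball p r) (\<lambda>y. \<bar>u y - a\<bar>) + avg \<mu> (ms.mball p r) (\<lambda>y. \<bar>u y - b\<bar>)"
    if r: "0 < r" "r < r3" for r
  proof -
    let ?B = "ms.mball p r"
    have m: "0 < measure \<mu> ?B"
      using mball_pos[OF p r(1)] .
    have int: "set_integrable \<mu> ?B (\<lambda>y. \<bar>u y - a\<bar>)" for a
      using r3(2)[of r a] r by (intro set_integrable_abs) auto
    have "measure \<mu> ?B * \<bar>b - a\<bar> = set_lebesgue_integral \<mu> ?B (\<lambda>y. \<bar>b - a\<bar>)"
      using mball_finite[of p r] mball_sets by (simp add: set_lebesgue_integral_def)
    also have "\<dots> \<le> set_lebesgue_integral \<mu> ?B (\<lambda>y. \<bar>u y - a\<bar> + \<bar>u y - b\<bar>)"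
      using int mball_finite[of p r] mball_sets
      by (intro set_integral_mono set_integral_add(1)) (auto simp: set_integrable_def integrable_indicator_iff)
    also have "\<dots> = set_lebesgue_integral \<mu> ?B (\<lambda>y. \<bar>u y - a\<bar>) + set_lebesgue_integral \<mu> ?B (\<lambda>y. \<bar>u y - b\<bar>)"
      by (rule set_integral_add(2)[OF int int])
    finally show ?thesis
      using m by (simp add: avg_def field_simps)
  qed
  have "((\<lambda>r. avg \<mu> (ms.mball p r) (\<lambda>y. \<bar>u y - a\<bar>) + avg \<mu> (ms.mball p r) (\<lambda>y. \<bar>u y - b\<bar>)) \<longlongrightarrow> 0 + 0) (at_right 0)"
    using a b unfolding has_lebesgue_value_def by (rule tendsto_add)
  moreover have "\<forall>\<^sub>F r in at_right 0. \<bar>b - a\<bar> \<le> avg \<mu> (ms.mball p r) (\<lambda>y. \<bar>u y - a\<bar>) + avg \<mu> (ms.mball p r) (\<lambda>y. \<bar>u y - b\<bar>)"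
    using le r3(1) by (intro eventually_at_rightI[of 0 r3]) auto
  ultimately have "\<bar>b - a\<bar> \<le> 0 + 0"
    by (rule tendsto_lowerbound) simp
  then show "b = a"
    by simp
qed

text \<open>The volume ratio contributes \<open>C * r^2\<close>, which cancels
  \<open>1 / r^2\<close> and leaves \<open>C / 2\<close> times the mean deviation from
  \<open>a\<close>; this tends to 0 at a Lebesgue point.\<close>

lemma AMV_minus_SAMV_tendsto_0:
  assumes p: "p \<in> topspace X" and a: "lebesgue_value u p a"
  shows "((\<lambda>r. AMV u r p
    - SAMV u r p) \<longlongrightarrow> 0) (at_right 0)"
proof -
  obtain r2 C where r2: "0 < r2" "0 \<le> C" "\<And>r q. 0 < r \<Longrightarrow> r < r2 \<Longrightarrow> q \<in> ms.mball p r \<Longrightarrow>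
      \<bar>1 - measure \<mu> (ms.mball p r) / measure \<mu> (ms.mball q r)\<bar> \<le> C * r\<^sup>2"
    by (rule mball_measure_ratio[OF p]) (rule that)
  obtain r3 where r3: "0 < r3" "\<And>r a. r \<le> r3 \<Longrightarrow> set_integrable \<mu> (ms.mball p r) (\<lambda>y. u y - a)"
    by (rule integrable_small_mball[OF p]) (rule that)
  have le: "norm (AMV u r p
      - SAMV u r p)
      \<le> C / 2 * avg \<mu> (ms.mball p r) (\<lambda>y. \<bar>u y - a\<bar>)" if r: "0 < r" "r < min r2 r3" for r
  proof -
    let ?B = "ms.mball p r"
    define k where "k y = measure \<mu> ?B / measure \<mu> (ms.mball y r)" for y
    note borel_measurable_mball [measurable]
    have [measurable]: "?B \<in> sets \<mu>"
      by (rule mball_sets)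
    have [measurable]: "k \<in> borel_measurable \<mu>"
      unfolding k_def by measurable
    have m: "0 < measure \<mu> ?B"
      using mball_pos[OF p r(1)] .
    have k: "\<bar>1 - k y\<bar> \<le> C * r\<^sup>2" if "y \<in> ?B" for y
      using r2(3)[of r y] r that by (simp add: k_def)
    have i1: "set_integrable \<mu> ?B (\<lambda>y. u y - a)"
      using r3(2)[of r a] r by simp
    \<comment> \<open>Splitting the SAMV integral requires this integrability, and it rests on the
      measurability of the ball volume as a function of the centre.\<close>
    have i2: "set_integrable \<mu> ?B (\<lambda>y. (u y - a) * (1 - k y))"
    proof (rule set_integrable_bound)
      show "set_integrable \<mu> ?B (\<lambda>y. C * r\<^sup>2 * (u y - a))"
        using i1 by simp
      show "set_borel_measurable \<mu> ?B (\<lambda>y. (u y - a) * (1 - k y))"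
        unfolding set_borel_measurable_def by measurable
      show "AE y in \<mu>. y \<in> ?B \<longrightarrow> norm ((u y - a) * (1 - k y)) \<le> norm (C * r\<^sup>2 * (u y - a))"
        using k r2(2) by (intro AE_I2) (auto simp: abs_mult mult.commute[of "\<bar>u _ - a\<bar>"] intro!: mult_right_mono)
    qed
    have "(\<lambda>y. (u y - a) * (1 + k y)) = (\<lambda>y. 2 * (u y - a) - (u y - a) * (1 - k y))"
      by (simp add: algebra_simps)
    then have "set_lebesgue_integral \<mu> ?B (\<lambda>y. (u y - a) * (1 + k y))
        = set_lebesgue_integral \<mu> ?B (\<lambda>y. 2 * (u y - a)) - set_lebesgue_integral \<mu> ?B (\<lambda>y. (u y - a) * (1 - k y))"
      using set_integral_diff(2)[OF set_integrable_mult_right[of 2, OF i1] i2] by simp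
    then have "set_lebesgue_integral \<mu> ?B (\<lambda>y. (u y - a) * (1 + k y))
        = 2 * set_lebesgue_integral \<mu> ?B (\<lambda>y. u y - a) - set_lebesgue_integral \<mu> ?B (\<lambda>y. (u y - a) * (1 - k y))"
      by (simp only: set_integral_mult_right)
    then have eq: "AMV u r p
        - SAMV u r p
        = 1 / (2 * r\<^sup>2) * (1 / measure \<mu> ?B) * set_lebesgue_integral \<mu> ?B (\<lambda>y. (u y - a) * (1 - k y))"
      unfolding AMV_approx_def SAMV_approx_def leb_value_eq[OF p a] avg_def k_def[symmetric]
      using r m by (simp add: field_simps)
    have "\<bar>set_lebesgue_integral \<mu> ?B (\<lambda>y. (u y - a) * (1 - k y))\<bar>
        \<le> set_lebesgue_integral \<mu> ?B (\<lambda>y. \<bar>(u y - a) * (1 - k y)\<bar>)"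
      using set_integral_norm_bound[OF i2] by simp
    also have "\<dots> \<le> set_lebesgue_integral \<mu> ?B (\<lambda>y. C * r\<^sup>2 * \<bar>u y - a\<bar>)"
    proof (rule set_integral_mono)
      show "set_integrable \<mu> ?B (\<lambda>y. \<bar>(u y - a) * (1 - k y)\<bar>)"
        using i2 by (rule set_integrable_abs)
      show "set_integrable \<mu> ?B (\<lambda>y. C * r\<^sup>2 * \<bar>u y - a\<bar>)"
        using set_integrable_abs[OF i1] by simp
      show "\<bar>(u y - a) * (1 - k y)\<bar> \<le> C * r\<^sup>2 * \<bar>u y - a\<bar>" if "y \<in> ?B" for y
        using k[OF that] by (simp add: abs_mult mult.commute[of "\<bar>u y - a\<bar>"] mult_right_mono)
    qed
    also have "\<dots> = C * r\<^sup>2 * set_lebesgue_integral \<mu> ?B (\<lambda>y. \<bar>u y - a\<bar>)"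
      by simp
    finally have "1 / (2 * r\<^sup>2) * (1 / measure \<mu> ?B) * \<bar>set_lebesgue_integral \<mu> ?B (\<lambda>y. (u y - a) * (1 - k y))\<bar>
        \<le> 1 / (2 * r\<^sup>2) * (1 / measure \<mu> ?B) * (C * r\<^sup>2 * set_lebesgue_integral \<mu> ?B (\<lambda>y. \<bar>u y - a\<bar>))"
      using m by (intro mult_left_mono) auto
    also have "\<dots> = C / 2 * avg \<mu> ?B (\<lambda>y. \<bar>u y - a\<bar>)"
      using r by (simp add: avg_def field_simps)
    finally show ?thesis
      unfolding eq by (simp add: abs_mult)
  qed
  have "((\<lambda>r. C / 2 * avg \<mu> (ms.mball p r) (\<lambda>y. \<bar>u y - a\<bar>)) \<longlongrightarrow> C / 2 * 0) (at_right 0)"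
    using a unfolding has_lebesgue_value_def by (rule tendsto_mult_left)
  then have lim: "((\<lambda>r. C / 2 * avg \<mu> (ms.mball p r) (\<lambda>y. \<bar>u y - a\<bar>)) \<longlongrightarrow> 0) (at_right 0)"
    by simp
  show ?thesis
    by (rule Lim_null_comparison[OF _ lim], rule eventually_at_rightI[of 0 "min r2 r3"])
      (use le r2(1) r3(1) in auto)
qed

text \<open>Euclidean differentiation, applied to \<open>u\<close> read in a chart, transfers to
  metric balls: each lies in a coordinate ball of radius \<open>B * r\<close> and of comparable
  volume, so the averages grow by a bounded factor.\<close>

lemma locally_ae_Leb:
  assumes p0: "p0 \<in> topspace X"
  obtains V N where "openin X V" "p0 \<in> V" "N \<in> null_sets \<mu>"
    "\<And>p. p \<in> V - N \<Longrightarrow> lebesgue_value u p (u p)"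
proof -
  define n where "n = CARD('n)"
  define \<omega> where "\<omega> = measure lborel (ball (0 :: real ^ 'n) 1)"
  obtain c \<rho> r1 K B where sb: "c \<in> \<A>" "p0 \<in> fst c" "0 < \<rho>" "0 < r1" "0 \<le> K" "0 < B" "K * r1\<^sup>2 \<le> 1 / 2" "B * r1 \<le> \<rho>"
    "cball (coord c p0) (2 * \<rho>) \<subseteq> codom c"
    "\<And>p r. p \<in> fst c \<Longrightarrow> coord c p \<in> ball (coord c p0) \<rho> \<Longrightarrow> 0 < r \<Longrightarrow> r < r1 \<Longrightarrow>
       ball_estimate c K B p r"
    by (rule small_balls[OF p0]) (rule that)
  define x0 where "x0 = coord c p0"
  obtain r3 where r3: "0 < r3" "\<And>r a. r \<le> r3 \<Longrightarrow> set_integrable \<mu> (ms.mball p0 r) (\<lambda>y. u y - a)"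
    by (rule integrable_small_mball[OF p0]) (rule that)
  \<comment> \<open>\<open>r3\<close> makes \<open>u\<close> integrable on the ball; halving
    \<open>r1\<close> makes \<open>s < r1\<close> strict.\<close>
  define s where "s = min r3 (r1 / 2)"
  have s: "0 < s" "s < r1" "s \<le> r3"
    using r3(1) sb(4) by (auto simp: s_def)
  obtain e where e: "0 < e" "param c ` ball x0 e \<subseteq> ms.mball p0 s"
    using sb(10)[OF sb(2) _ s(1,2), unfolded ball_estimate_def] sb(3) by (auto simp: x0_def)
  \<comment> \<open>Inside that metric ball, for integrability, and inside
    \<open>ball x0 \<rho>\<close>, for the uniform ball estimates.\<close>
  define W where "W = ball x0 (min e \<rho>)"
  have W: "open W" "W \<subseteq> cball x0 (2 * \<rho>)" "W \<subseteq> ball x0 \<rho>" "W \<subseteq> ball x0 e" "x0 \<in> W"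
    using e(1) sb(3) by (auto simp: W_def)
  have Wim: "W \<subseteq> codom c"
    using W(2) sb(9) by (auto simp: x0_def)
  have [measurable]: "W \<in> sets borel"
    using W(1) by simp
  have "cball x0 (2 * \<rho>) \<noteq> {}"
    using sb(3) by simp
  obtain l h where lh: "0 < l" "0 < h"
    "\<And>x. x \<in> cball x0 (2 * \<rho>) \<Longrightarrow> l \<le> sqrt (det (g c x)) \<and> sqrt (det (g c x)) \<le> h"
    by (rule det_metric_bounds[OF sb(1) compact_cball sb(9)[folded x0_def] \<open>cball x0 (2 * \<rho>) \<noteq> {}\<close>]) (rule that)
  define V where "V = param c ` W"
  have V: "openin X V"
    unfolding V_def by (rule openin_param_image[OF sb(1) W(1) Wim])
  have V_eq: "V = {q \<in> fst c. coord c q \<in> W}"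
    unfolding V_def by (rule param_image_eq[OF sb(1) Wim])
  have "p0 \<in> V"
    using W(5) sb(2) by (simp add: V_eq x0_def)
  \<comment> \<open>Extension by 0 gives a Borel function on the whole space; off the image of the
    chart, \<open>param c\<close> is arbitrary.\<close>
  define v where "v x = indicator W x * u (param c x)" for x
  have [measurable]: "v \<in> borel_measurable borel"
  proof -
    have "(\<lambda>x. u (param c x)) \<in> borel_measurable (restrict_space borel W)"
      using measurable_compose[OF measurable_param[OF sb(1) W(1) Wim] u_measurable] .
    then show ?thesis
      unfolding v_def by (subst (asm) borel_measurable_restrict_space_iff) simp_all
  qed
  have finW: "emeasure lborel W < \<infinity>"
    unfolding W_def by (rule emeasure_lborel_ball_finite)
  have "(\<integral>\<^sup>+x\<in>W. ennreal \<bar>v x\<bar> \<partial>lborel) < \<infinity>"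
  proof -
    have i: "set_integrable \<mu> (ms.mball p0 s) u"
      using r3(2)[OF s(3), of 0] by simp
    have "ennreal l * (\<integral>\<^sup>+x\<in>W. ennreal \<bar>v x\<bar> \<partial>lborel) = (\<integral>\<^sup>+x. ennreal l * (ennreal \<bar>v x\<bar> * indicator W x) \<partial>lborel)"
      by (rule nn_integral_cmult[symmetric]) measurable
    also have "\<dots> \<le> (\<integral>\<^sup>+x. ennreal (sqrt (det (g c x))) * indicator W x * ennreal \<bar>v x\<bar> \<partial>lborel)"
      using lh W(2) by (intro nn_integral_mono) (auto simp: indicator_def intro!: mult_right_mono ennreal_leI)
    also have "\<dots> = (\<integral>\<^sup>+q\<in>V. ennreal \<bar>v (coord c q)\<bar> \<partial>\<mu>)"
      unfolding V_def by (rule nn_integral_chart[OF sb(1) W(1) Wim, symmetric]) measurable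
    also have "\<dots> \<le> (\<integral>\<^sup>+q. ennreal (norm (indicator (ms.mball p0 s) q *\<^sub>R u q)) \<partial>\<mu>)"
    proof (rule nn_integral_mono)
      fix q
      have "q \<in> ms.mball p0 s" if "q \<in> V"
        using that e(2) W(4) unfolding V_def by blast
      then show "ennreal \<bar>v (coord c q)\<bar> * indicator V q \<le> ennreal (norm (indicator (ms.mball p0 s) q *\<^sub>R u q))"
        using sb(1) by (auto simp: indicator_def v_def V_eq)
    qed
    also have "\<dots> < \<infinity>"
      using i unfolding set_integrable_def integrable_iff_bounded by blast
    finally show ?thesis
      using lh(1) by (auto simp: ennreal_mult_less_top)
  qed
  then obtain N0 where N0: "negligible N0" "\<And>x \<epsilon>. x \<in> W - N0 \<Longrightarrow> 0 < \<epsilon> \<Longrightarrow>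
      \<forall>\<^sub>F r in at_right 0. (\<integral>\<^sup>+y\<in>ball x r. ennreal \<bar>v y - v x\<bar> \<partial>lborel) \<le> ennreal \<epsilon> * emeasure lborel (ball x r)"
    using Lebesgue_differentiation[of v W] W(1) finW by auto
  \<comment> \<open>A negligible set need not be Borel, whereas \<open>\<mu>\<close> is defined on
    Borel sets; it is enlarged to a Borel null set before being pulled back.\<close>
  obtain N1 where N1: "N0 \<subseteq> N1" "N1 \<in> null_sets lborel"
  proof -
    have "N0 \<in> null_sets (completion lborel)"
      using N0(1) by (simp add: negligible_iff_null_sets)
    then show ?thesis
      using that unfolding null_sets_completion_iff2 by blast
  qed
  have [measurable]: "N1 \<in> sets borel"
    using N1(2) by auto
  define N where "N = {q \<in> V. coord c q \<in> N1}"
  have "N \<in> null_sets \<mu>"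
  proof (rule null_setsI)
    have Vs: "V \<in> sets \<mu>"
      using V by (rule openin_sets)
    have "coord c -` N1 \<inter> space (restrict_space \<mu> V) \<in> sets (restrict_space \<mu> V)"
      unfolding V_def using measurable_coord[OF sb(1) W(1) Wim] by (rule measurable_sets) measurable
    moreover have "coord c -` N1 \<inter> space (restrict_space \<mu> V) = N"
      using Vs sets.sets_into_space by (auto simp: N_def space_restrict_space)
    ultimately show Ns: "N \<in> sets \<mu>"
      using Vs by (auto simp: sets_restrict_space)
    have "emeasure \<mu> N = (\<integral>\<^sup>+q. indicator N q \<partial>\<mu>)"
      using Ns by simp
    also have "\<dots> = (\<integral>\<^sup>+q\<in>V. indicator N1 (coord c q) \<partial>\<mu>)"
      by (intro nn_integral_cong) (auto simp: N_def indicator_def)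
    also have "\<dots> = (\<integral>\<^sup>+x. ennreal (sqrt (det (g c x))) * indicator W x * indicator N1 x \<partial>lborel)"
      unfolding V_def by (rule nn_integral_chart[OF sb(1) W(1) Wim]) measurable
    also have "\<dots> = 0"
      using nn_integral_null_set[OF N1(2)] by simp
    finally show "emeasure \<mu> N = 0" .
  qed
  moreover have "lebesgue_value u p (u p)" if p: "p \<in> V - N" for p
  proof -
    define x where "x = coord c p"
    have x: "x \<in> W - N0" and pc: "p \<in> fst c"
      using p N1(1) by (auto simp: N_def V_eq x_def)
    have vx: "v x = u p"
      using x pc sb(1) by (simp add: v_def x_def)
    have pM: "p \<in> topspace X"
      using pc chart_subset[OF sb(1)] by blast
    have px: "coord c p \<in> ball (coord c p0) \<rho>"
      using x W(3) by (auto simp: x_def x0_def)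
    obtain \<delta> where \<delta>: "0 < \<delta>" "ball x \<delta> \<subseteq> W"
      using x W(1) openE by blast
    \<comment> \<open>\<open>h\<close> bounds the density, \<open>B ^ n\<close> compares radius
      \<open>B * r\<close> with radius \<open>r\<close>, and \<open>sqrt 3 ^ n\<close> is the
      quotient of \<open>sqrt (3 / 2) ^ n\<close> by \<open>sqrt (1 / 2) ^ n\<close> in the lower
      volume bound.\<close>
    define Q where "Q = h * B ^ n * sqrt 3 ^ n"
    have "0 < Q"
      using lh(2) sb(6) by (simp add: Q_def)
    have est: "avg \<mu> (ms.mball p r) (\<lambda>y. \<bar>u y - u p\<bar>) \<le> \<epsilon> * Q"
      if r: "0 < r" "r < r1" "B * r < \<delta>" and "0 < \<epsilon>"
        and \<epsilon>: "(\<integral>\<^sup>+y\<in>ball x (B * r). ennreal \<bar>v y - v x\<bar> \<partial>lborel) \<le> ennreal \<epsilon> * emeasure lborel (ball x (B * r))"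
      for r \<epsilon>
    proof -
      let ?M = "ms.mball p r"
      have [measurable]: "ball x (B * r) \<in> sets borel"
        by simp
      have m: "0 < measure \<mu> ?M"
        using mball_pos[OF pM r(1)] .
      have inV: "q \<in> V" "coord c q \<in> ball x (B * r)" if "q \<in> ?M" for q
      proof -
        have q: "q \<in> fst c" "coord c q \<in> ball x (B * r)"
          using sb(10)[OF pc px r(1,2), unfolded ball_estimate_def] that unfolding x_def by blast+
        have "ball x (B * r) \<subseteq> W"
          using \<delta>(2) r(3) subset_ball[of "B * r" \<delta> x] by simp
        then show "q \<in> V" "coord c q \<in> ball x (B * r)"
          using q by (auto simp: V_eq)
      qed
      have "(\<integral>\<^sup>+q\<in>?M. ennreal \<bar>u q - u p\<bar> \<partial>\<mu>)
          \<le> (\<integral>\<^sup>+q\<in>V. (ennreal \<bar>v (coord c q) - v x\<bar> * indicator (ball x (B * r)) (coord c q)) \<partial>\<mu>)"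
      proof (rule nn_integral_mono)
        fix q
        show "ennreal \<bar>u q - u p\<bar> * indicator ?M q
            \<le> ennreal \<bar>v (coord c q) - v x\<bar> * indicator (ball x (B * r)) (coord c q) * indicator V q"
        proof (cases "q \<in> ?M")
          case True
          have "v (coord c q) = u q"
            using inV(1)[OF True] sb(1) by (simp add: v_def V_eq)
          then show ?thesis
            using inV[OF True] True by (simp add: vx)
        qed simp
      qed
      also have "\<dots> = (\<integral>\<^sup>+y. ennreal (sqrt (det (g c y))) * indicator W y
          * (ennreal \<bar>v y - v x\<bar> * indicator (ball x (B * r)) y) \<partial>lborel)"
        unfolding V_def by (rule nn_integral_chart[OF sb(1) W(1) Wim]) measurable
      also have "\<dots> \<le> (\<integral>\<^sup>+y. ennreal h * (ennreal \<bar>v y - v x\<bar> * indicator (ball x (B * r)) y) \<partial>lborel)"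
        using lh W(2) by (intro nn_integral_mono) (auto simp: indicator_def intro!: mult_right_mono ennreal_leI)
      also have "\<dots> = ennreal h * (\<integral>\<^sup>+y\<in>ball x (B * r). ennreal \<bar>v y - v x\<bar> \<partial>lborel)"
        by (rule nn_integral_cmult) measurable
      also have "\<dots> \<le> ennreal h * (ennreal \<epsilon> * emeasure lborel (ball x (B * r)))"
        using \<epsilon> by (rule mult_left_mono) simp
      also have "emeasure lborel (ball x (B * r)) = ennreal ((B * r) ^ n * \<omega>)"
        using r(1) sb(6) emeasure_lebesgue_ball_conv_unit_ball[of "B * r" x]
          emeasure_eq_ennreal_measure[of lborel "ball (0 :: real ^ 'n) 1"] emeasure_lborel_ball_finite[of "0 :: real ^ 'n" 1]
        by (simp add: \<omega>_def n_def ennreal_mult' less_top)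
      also have "ennreal h * (ennreal \<epsilon> * ennreal ((B * r) ^ n * \<omega>)) = ennreal (h * (\<epsilon> * ((B * r) ^ n * \<omega>)))"
        using lh(2) \<open>0 < \<epsilon>\<close> by (simp add: ennreal_mult')
      finally have nn: "(\<integral>\<^sup>+q\<in>?M. ennreal \<bar>u q - u p\<bar> \<partial>\<mu>) \<le> ennreal (h * (\<epsilon> * ((B * r) ^ n * \<omega>)))" .
      have "set_lebesgue_integral \<mu> ?M (\<lambda>y. \<bar>u y - u p\<bar>) = enn2real (\<integral>\<^sup>+q\<in>?M. ennreal \<bar>u q - u p\<bar> \<partial>\<mu>)"
        unfolding set_lebesgue_integral_def using mball_sets
        by (subst integral_eq_nn_integral) (auto simp: ennreal_mult' ennreal_indicator mult.commute)
      also have "\<dots> \<le> enn2real (ennreal (h * (\<epsilon> * ((B * r) ^ n * \<omega>))))"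
        using nn by (rule enn2real_mono) simp
      also have "\<dots> = h * (\<epsilon> * ((B * r) ^ n * \<omega>))"
        using lh(2) \<open>0 < \<epsilon>\<close> sb(6) r(1) by (simp add: \<omega>_def)
      finally have int: "set_lebesgue_integral \<mu> ?M (\<lambda>y. \<bar>u y - u p\<bar>) \<le> h * (\<epsilon> * ((B * r) ^ n * \<omega>))" .
      have "\<omega> * r ^ n \<le> sqrt 3 ^ n * measure \<mu> ?M"
      proof -
        have "K * r\<^sup>2 \<le> K * r1\<^sup>2"
          using r sb(5) by (intro mult_left_mono power_mono) auto
        then have k: "0 \<le> K * r\<^sup>2" "K * r\<^sup>2 \<le> 1 / 2"
          using sb(5,7) by auto
        have "sqrt (1 / 2) ^ n * (\<omega> * r ^ n) \<le> sqrt (1 - K * r\<^sup>2) ^ n * (\<omega> * r ^ n)"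
          using k r(1) by (intro mult_right_mono power_mono) (auto simp: \<omega>_def)
        also have "\<dots> \<le> sqrt (1 + K * r\<^sup>2) ^ n * measure \<mu> ?M"
          using sb(10)[OF pc px r(1,2), unfolded ball_estimate_def] by (simp add: n_def \<omega>_def)
        also have "\<dots> \<le> sqrt (3 / 2) ^ n * measure \<mu> ?M"
          using k by (intro mult_right_mono power_mono) auto
        also have "sqrt (3 / 2) = sqrt 3 * sqrt (1 / 2)"
          by (simp flip: real_sqrt_mult)
        finally show ?thesis
          by (simp add: power_mult_distrib)
      qed
      then have "h * (\<epsilon> * ((B * r) ^ n * \<omega>)) \<le> \<epsilon> * Q * measure \<mu> ?M"
        using lh(2) \<open>0 < \<epsilon>\<close> sb(6) mult_left_mono[of "\<omega> * r ^ n" "sqrt 3 ^ n * measure \<mu> ?M" "h * \<epsilon> * B ^ n"]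
        by (simp add: Q_def power_mult_distrib mult_ac)
      then show ?thesis
        using int m by (simp add: avg_def pos_divide_le_eq)
    qed
    show ?thesis
      unfolding has_lebesgue_value_def
    proof (rule tendstoI)
      fix \<eta> :: real assume "0 < \<eta>"
      \<comment> \<open>The factor 2 makes the final inequality strict.\<close>
      define \<epsilon> where "\<epsilon> = \<eta> / (2 * Q)"
      have "0 < \<epsilon>"
        using \<open>0 < \<eta>\<close> \<open>0 < Q\<close> by (simp add: \<epsilon>_def)
      obtain \<tau> where \<tau>: "0 < \<tau>" "\<And>r. 0 < r \<Longrightarrow> r < \<tau> \<Longrightarrow>
          (\<integral>\<^sup>+y\<in>ball x r. ennreal \<bar>v y - v x\<bar> \<partial>lborel) \<le> ennreal \<epsilon> * emeasure lborel (ball x r)"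
        using N0(2)[OF x \<open>0 < \<epsilon>\<close>] unfolding eventually_at_right_field by auto
      define r' where "r' = min r1 (min \<delta> \<tau> / B)"
      have "dist (avg \<mu> (ms.mball p r) (\<lambda>y. \<bar>u y - u p\<bar>)) 0 < \<eta>" if r: "0 < r" "r < r'" for r
      proof -
        have "B * r < min \<delta> \<tau>" "r < r1" "0 < B * r"
          using r sb(6) by (auto simp: r'_def pos_less_divide_eq mult.commute)
        then have "avg \<mu> (ms.mball p r) (\<lambda>y. \<bar>u y - u p\<bar>) \<le> \<epsilon> * Q"
          using r \<open>0 < \<epsilon>\<close> \<tau>(2)[of "B * r"] by (intro est) auto
        also have "\<dots> < \<eta>"
          using \<open>0 < \<eta>\<close> \<open>0 < Q\<close> by (simp add: \<epsilon>_def)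
        finally have "avg \<mu> (ms.mball p r) (\<lambda>y. \<bar>u y - u p\<bar>) < \<eta>" .
        moreover have "0 \<le> avg \<mu> (ms.mball p r) (\<lambda>y. \<bar>u y - u p\<bar>)"
          unfolding avg_def set_lebesgue_integral_def by simp
        ultimately show ?thesis
          by simp
      qed
      moreover have "0 < r'"
        using sb(4,6) \<delta>(1) \<tau>(1) by (simp add: r'_def)
      ultimately show "\<forall>\<^sub>F r in at_right 0. dist (avg \<mu> (ms.mball p r) (\<lambda>y. \<bar>u y - u p\<bar>)) 0 < \<eta>"
        by (intro eventually_at_rightI[of 0 r']) auto
    qed
  qed
  ultimately show ?thesis
    using that V \<open>p0 \<in> V\<close> by blast
qed

text \<open>Second countability gives the Lindelof property: countably many local neighbourhoods
  cover the manifold, and their exceptional sets have a null union.\<close>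

lemma ae_Leb: "AE p in \<mu>. lebesgue_value u p (u p)"
proof -
  define good where "good p \<longleftrightarrow> lebesgue_value u p (u p)" for p
  define \<V> where "\<V> = {V. openin X V \<and> (\<exists>N\<in>null_sets \<mu>. \<forall>p\<in>V - N. good p)}"
  have "\<Union>\<V> = topspace X"
  proof
    show "\<Union>\<V> \<subseteq> topspace X"
      using openin_subset by (auto simp: \<V>_def)
    show "topspace X \<subseteq> \<Union>\<V>"
    proof
      fix p0 assume "p0 \<in> topspace X"
      then obtain V N where "openin X V" "p0 \<in> V" "N \<in> null_sets \<mu>"
          "\<And>p. p \<in> V - N \<Longrightarrow> lebesgue_value u p (u p)"
        by (rule locally_ae_Leb) (rule that)
      then show "p0 \<in> \<Union>\<V>"
        unfolding \<V>_def good_def by blast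
    qed
  qed
  moreover have "Lindelof_space X"
    using manifold second_countable_imp_Lindelof_space by (auto simp: smooth_manifold_def)
  ultimately obtain \<U> where \<U>: "countable \<U>" "\<U> \<subseteq> \<V>" "\<Union>\<U> = topspace X"
    using Lindelof_spaceD[of X \<V>] by (auto simp: \<V>_def)
  then have "\<forall>V\<in>\<U>. \<exists>N\<in>null_sets \<mu>. \<forall>p\<in>V - N. good p"
    by (auto simp: \<V>_def)
  then obtain N where N: "\<And>V. V \<in> \<U> \<Longrightarrow> N V \<in> null_sets \<mu>" "\<And>V p. V \<in> \<U> \<Longrightarrow> p \<in> V - N V \<Longrightarrow> good p"
    by metis
  have "(\<Union>V\<in>\<U>. N V) \<in> null_sets \<mu>"
    using \<U>(1) N(1) by (rule null_sets_UN')
  moreover have "{p \<in> space \<mu>. \<not> good p} \<subseteq> (\<Union>V\<in>\<U>. N V)"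
  proof
    fix p assume "p \<in> {p \<in> space \<mu>. \<not> good p}"
    then have "p \<in> \<Union>\<U>" "\<not> good p"
      using \<U>(3) by (simp_all add: space_\<mu>)
    then show "p \<in> (\<Union>V\<in>\<U>. N V)"
      using N(2) by blast
  qed
  ultimately show ?thesis
    unfolding good_def by (rule AE_I')
qed

end

end

theorem proposition4p3:
  fixes X :: "'a topology"
    and \<A> :: "('a, 'n::finite) chart set"
    and g :: "('a, 'n) metric_tensor"
    and \<mu> :: "'a measure"
    and M :: "'a set"
    and d :: "'a \<Rightarrow> 'a \<Rightarrow> real"
    and u :: "'a \<Rightarrow> real"
  assumes "smooth_manifold X \<A>"
    and "C2_Riemannian_metric \<A> g"
    and "M = topspace X"
    and "d = Riemannian_dist X \<A> g"
    and "is_Riemannian_volume X \<A> g \<mu>"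
    and "metric_measure_space M d \<mu>"
    and "L1_loc M d \<mu> u"
  shows "(AE x in \<mu>. x \<in> Leb M d \<mu> u \<and>
            ((\<lambda>r. \<bar>AMV_approx M d \<mu> r u x - SAMV_approx M d \<mu> r u x\<bar>) \<longlongrightarrow> 0) (at_right 0)) \<and>
         (AE x in \<mu>. x \<in> Leb M d \<mu> u \<and>
            (AMV_converges M d \<mu> u x \<longleftrightarrow> SAMV_converges M d \<mu> u x) \<and>
            (AMV_converges M d \<mu> u x \<longrightarrow> AMV_Laplacian M d \<mu> u x = SAMV_Laplacian M d \<mu> u x))"
proof -
  interpret riemannian_space X \<A> g \<mu>
    using assms by unfold_locales auto
  have L1: "L1_loc (topspace X) (Riemannian_dist X \<A> g) \<mu> u"
    using assms by simp
  define A where "A x r = AMV_approx M d \<mu> r u x" for x r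
  define S where "S x r = SAMV_approx M d \<mu> r u x" for x r
  have main: "x \<in> Leb M d \<mu> u \<and> ((\<lambda>r. A x r - S x r) \<longlongrightarrow> 0) (at_right 0)"
    if "x \<in> M" "has_lebesgue_value M d \<mu> u x (u x)" for x
    using AMV_minus_SAMV_tendsto_0[OF L1, of x "u x"] that assms(3,4)
    by (auto simp: Leb_def A_def S_def)
  have ae: "AE x in \<mu>. x \<in> M \<and> has_lebesgue_value M d \<mu> u x (u x)"
    using ae_Leb[OF L1] assms(3,4) space_\<mu> by auto
  have iff: "(A x \<longlongrightarrow> l) (at_right 0) \<longleftrightarrow> (S x \<longlongrightarrow> l) (at_right 0)"
    if "((\<lambda>r. A x r - S x r) \<longlongrightarrow> 0) (at_right 0)" for x l
    using Lim_transform[OF _ that, of l] Lim_transform2[OF _ that, of l] by blast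
  show ?thesis
  proof (intro conjI)
    show "AE x in \<mu>. x \<in> Leb M d \<mu> u \<and>
        ((\<lambda>r. \<bar>AMV_approx M d \<mu> r u x - SAMV_approx M d \<mu> r u x\<bar>) \<longlongrightarrow> 0) (at_right 0)"
      using ae
    proof eventually_elim
      case (elim x)
      then show ?case
        using main[of x] tendsto_rabs_zero by (auto simp: A_def S_def)
    qed
    show "AE x in \<mu>. x \<in> Leb M d \<mu> u \<and>
        (AMV_converges M d \<mu> u x \<longleftrightarrow> SAMV_converges M d \<mu> u x) \<and>
        (AMV_converges M d \<mu> u x \<longrightarrow> AMV_Laplacian M d \<mu> u x = SAMV_Laplacian M d \<mu> u x)"
      using ae
    proof eventually_elim
      case (elim x)
      then have x: "x \<in> Leb M d \<mu> u" "\<And>l. (A x \<longlongrightarrow> l) (at_right 0) \<longleftrightarrow> (S x \<longlongrightarrow> l) (at_right 0)"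
        using main[of x] iff[of x] by auto
      \<comment> \<open>\<open>Lim\<close> is a definite description over the convergence predicate,
        so equivalence for every \<open>l\<close> makes the two values equal whether or not a limit
        exists.\<close>
      have "Lim (at_right 0) (A x) = Lim (at_right 0) (S x)"
        unfolding Topological_Spaces.Lim_def using x(2) by simp
      then show ?case
        using x unfolding AMV_converges_def SAMV_converges_def AMV_Laplacian_def SAMV_Laplacian_def
        by (auto simp: A_def[abs_def] S_def[abs_def])
    qed
  qed
qed

end
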